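(* Let $S\subset\mathbb{R}^{n+1}$ be an immersed submanifold and let $v\in\Gamma(TS)$ be a tangent vector field on $S$ of unit length. Suppose that $\Phi_v:S\to T\mathbb{S}^n$ is an immersion and that $\Phi_v(S)\subset T\mathbb{S}^n$ is an immersed submanifold. Then the following are equivalent: (a) $\Phi_v(S)$ is isotropic. (b) Each $p\in S$ has an open neighbourhood $U\subseteq S$ on which $v|_U=\mathrm{grad}\, f$ for some smooth function $f:U\to\mathbb{R}$. (If $S$ is simply connected, one may take $U=S$.) (c) The distribution $v^\perp$ on $S$ is integrable and $v$ is a geodesic vector field on $S$.
   Context: "Smooth" means $C^2$. $\langle\cdot,\cdot\rangle$ is the Euclidean inner product on $\mathbb{R}^{n+1}$ and $\overline\nabla$ the flat connection. A subset $\mathcal N$ of a manifold $\mathcal M$ is called immersed if $\mathcal N$ itself is a smooth manifold and the inclusion $\mathcal N\hookrightarrow\mathcal M$ is a smooth immersion. $S$ carries the induced metric, $\nabla$ is its Levi-Civita connection, and gradients on $S$ are taken with respect to the induced metric. Identify $T\mathbb{S}^n=\{(\xi,\eta)\in\mathbb{R}^{n+1}\times\mathbb{R}^{n+1}: |\xi|=1,\ \langle\xi,\eta\rangle=0\}$; $(\xi,\eta)$ corresponds to the oriented line $\{\eta+t\xi:t\in\mathbb{R}\}$. The map $\Phi_v:S\to T\mathbb{S}^n$ is $\Phi_v(p)=(v(p),\,p-\langle v(p),p\rangle v(p))$, i.e. it sends $p$ to the oriented line through $p$ in direction $v(p)$. Let $g$ be the round metric on $\mathbb{S}^n$ and $\pi:T\mathbb{S}^n\to\mathbb{S}^n$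 the projection. The Liouville form on $T\mathbb{S}^n$ is $\theta_{(\xi,\eta)}(X)=g_\xi(\mathrm{d}\pi(X),\eta)$ and the symplectic form is $\Omega=-\mathrm{d}\theta$. An immersed submanifold $\Gamma\subseteq T\mathbb{S}^n$ is isotropic if $\Omega|_\Gamma=0$. The distribution $v^\perp$ is $p\mapsto\{X\in T_pS:\langle X,v(p)\rangle=0\}$; $v$ is a geodesic vector field on $S$ if $\nabla_vv=0$. *)

theory Defs
  imports "HOL-Analysis.Analysis"
begin

section \<open>Maps of class $C^1$ and $C^2$\<close>

text \<open>The set \<open>W\<close> is always relatively open in a linear subspace of the ambient space (most often
  open); derivatives are therefore taken within \<open>W\<close>.\<close>

definition C1_on :: "'m::real_normed_vector set \<Rightarrow> ('m \<Rightarrow> 'b::real_normed_vector) \<Rightarrow> bool" where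
  "C1_on W f \<longleftrightarrow> (\<exists>f' :: 'm \<Rightarrow> 'm \<Rightarrow>\<^sub>L 'b.
     (\<forall>x\<in>W. (f has_derivative blinfun_apply (f' x)) (at x within W)) \<and> continuous_on W f')"

definition C2_on :: "'m::real_normed_vector set \<Rightarrow> ('m \<Rightarrow> 'b::real_normed_vector) \<Rightarrow> bool" where
  "C2_on W f \<longleftrightarrow> (\<exists>f' :: 'm \<Rightarrow> 'm \<Rightarrow>\<^sub>L 'b.
     (\<forall>x\<in>W. (f has_derivative blinfun_apply (f' x)) (at x within W)) \<and> C1_on W f')"


section \<open>Manifolds of class $C^2$\<close>

text \<open>A manifold has its own topology \<open>topol\<close>, its points being the elements of the carrier.
  The atlas consists of local parametrizations \<open>(W, \<psi>)\<close>, the inverses of charts, where \<open>W\<close> is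
  relatively open in the model space. The model space is a linear subspace of a Euclidean space
  rather than a whole type, so that manifolds whose dimension is not the dimension of a type
  (such as leaves of codimension one, possibly of dimension zero) are available.\<close>

record ('p, 'm) mfd =
  model :: "'m set"
  topol :: "'p topology"
  atlas :: "('m set \<times> ('m \<Rightarrow> 'p)) set"

definition carrier :: "('p, 'm) mfd \<Rightarrow> 'p set" where
  "carrier M = topspace (topol M)"

definition C2_manifold :: "('p, 'm::euclidean_space) mfd \<Rightarrow> bool" where
  "C2_manifold M \<longleftrightarrow>
     subspace (model M) \<and> Hausdorff_space (topol M) \<and> second_countable (topol M) \<and>
     (\<forall>(W, \<psi>)\<in>atlas M. openin (top_of_set (model M)) W \<and> openin (topol M) (\<psi> ` W) \<and>
        homeomorphic_map (top_of_set W) (subtopology (topol M) (\<psi> ` W)) \<psi>) \<and>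
     carrier M = (\<Union>(W, \<psi>)\<in>atlas M. \<psi> ` W) \<and>
     (\<forall>(W, \<psi>)\<in>atlas M. \<forall>(W', \<phi>)\<in>atlas M. C2_on (W \<inter> \<psi> -` (\<phi> ` W')) (inv_into W' \<phi> \<circ> \<psi>))"

definition euclidean_mfd :: "('a::euclidean_space, 'a) mfd" where
  "euclidean_mfd = \<lparr>model = UNIV, topol = euclidean, atlas = {(UNIV, \<lambda>x. x)}\<rparr>"

definition C2_map :: "('p, 'm::euclidean_space) mfd \<Rightarrow> ('q, 'k::euclidean_space) mfd \<Rightarrow> ('p \<Rightarrow> 'q) \<Rightarrow> bool"
  where
  "C2_map M N f \<longleftrightarrow> continuous_map (topol M) (topol N) f \<and>
     (\<forall>(W, \<psi>)\<in>atlas M. \<forall>(W', \<phi>)\<in>atlas N.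
        C2_on (W \<inter> (f \<circ> \<psi>) -` (\<phi> ` W')) (inv_into W' \<phi> \<circ> f \<circ> \<psi>))"

definition immersion :: "('p, 'm::euclidean_space) mfd \<Rightarrow> ('q, 'k::euclidean_space) mfd \<Rightarrow> ('p \<Rightarrow> 'q) \<Rightarrow> bool"
  where
  "immersion M N f \<longleftrightarrow> C2_map M N f \<and>
     (\<forall>(W, \<psi>)\<in>atlas M. \<forall>(W', \<phi>)\<in>atlas N. \<forall>x \<in> W \<inter> (f \<circ> \<psi>) -` (\<phi> ` W').
        inj_on (frechet_derivative (inv_into W' \<phi> \<circ> f \<circ> \<psi>) (at x within model M)) (model M))"

definition immersed_submanifold :: "('p, 'm::euclidean_space) mfd \<Rightarrow> ('p, 'k::euclidean_space) mfd \<Rightarrow> bool"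
  where
  "immersed_submanifold N M \<longleftrightarrow>
     C2_manifold N \<and> carrier N \<subseteq> carrier M \<and> immersion N M (\<lambda>q. q)"

text \<open>The analogue of \<^const>\<open>simply_connected\<close> for an abstract topology. It is needed because the
  topology of an immersed submanifold can be finer than the subspace topology.\<close>

definition simply_connected_space :: "'p topology \<Rightarrow> bool" where
  "simply_connected_space X \<longleftrightarrow> (\<forall>p q. pathin X p \<and> p 1 = p 0 \<and> pathin X q \<and> q 1 = q 0 \<longrightarrow>
     homotopic_with (\<lambda>r. r 1 = r 0) (top_of_set {0..1}) X p q)"

lemma simply_connected_space_top_of_set:
  "simply_connected_space (top_of_set T) \<longleftrightarrow> simply_connected T"
  unfolding simply_connected_space_def simply_connected_def homotopic_loops_def pathin_canon_iff
    path_def path_image_def pathstart_def pathfinish_def image_subset_iff_funcset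
  by meson

lemma C2_manifold_euclidean_mfd: "C2_manifold (euclidean_mfd :: ('a::euclidean_space, 'a) mfd)"
proof -
  have "C2_on UNIV (\<lambda>x::'a. x)"
    unfolding C2_on_def C1_on_def
    by (rule exI[of _ "\<lambda>_. id_blinfun"], intro conjI ballI exI[of _ "\<lambda>_. 0"])
      (simp_all add: zero_blinfun.rep_eq)
  moreover have "inv_into UNIV (\<lambda>x::'a. x) = (\<lambda>x. x)"
    by (auto simp: inv_into_def)
  moreover have "second_countable (euclidean :: 'a topology)"
  proof -
    obtain B :: "'a set set" where B: "countable B" "topological_basis B"
      using ex_countable_basis by blast
    have "\<exists>V\<in>B. x \<in> V \<and> V \<subseteq> U" if "open U" "x \<in> U" for U x
      using topological_basisE[OF B(2) that] by blast
    then show ?thesis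
      unfolding second_countable_def using B topological_basis_open[OF B(2)]
      by (intro exI[of _ B]) (auto simp flip: open_openin)
  qed
  moreover have "homeomorphic_map euclidean euclidean (\<lambda>x::'a. x)"
    using homeomorphic_map_id[of euclidean euclidean] by (simp add: id_def)
  ultimately show ?thesis
    by (auto simp: C2_manifold_def euclidean_mfd_def carrier_def comp_def)
qed


section \<open>Calculus on a submanifold of a Euclidean space\<close>

text \<open>The tangent space at \<open>p\<close>, as a subspace of the ambient space.\<close>

definition tangent_space :: "('a::euclidean_space, 'm::euclidean_space) mfd \<Rightarrow> 'a \<Rightarrow> 'a set" where
  "tangent_space M p = {frechet_derivative \<psi> (at x within model M) w | W \<psi> x w.
     (W, \<psi>) \<in> atlas M \<and> x \<in> W \<and> \<psi> x = p \<and> w \<in> model M}"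

text \<open>The differential at \<open>p\<close> of a (possibly vector-valued) function \<open>h\<close> on the submanifold, applied
  to a tangent vector \<open>u\<close>.\<close>

definition deriv_along ::
  "('a::euclidean_space, 'm::euclidean_space) mfd \<Rightarrow> ('a \<Rightarrow> 'b::real_normed_vector) \<Rightarrow> 'a \<Rightarrow> 'a \<Rightarrow> 'b"
  where
  "deriv_along M h p u = (THE d. \<exists>W \<psi> x w. (W, \<psi>) \<in> atlas M \<and> x \<in> W \<and> \<psi> x = p \<and> w \<in> model M \<and>
     frechet_derivative \<psi> (at x within model M) w = u \<and>
     d = frechet_derivative (h \<circ> \<psi>) (at x within model M) w)"

definition C1_fun :: "('a::euclidean_space, 'm::euclidean_space) mfd \<Rightarrow> ('a \<Rightarrow> 'b::real_normed_vector) \<Rightarrow> bool"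
  where
  "C1_fun M h \<longleftrightarrow> (\<forall>(W, \<psi>)\<in>atlas M. C1_on W (h \<circ> \<psi>))"

text \<open>\<open>f\<close> is of class $C^2$ on the open subset \<open>U\<close> of the submanifold; values of \<open>f\<close> outside \<open>U\<close> are
  irrelevant.\<close>

definition C2_fun_on ::
  "('a::euclidean_space, 'm::euclidean_space) mfd \<Rightarrow> 'a set \<Rightarrow> ('a \<Rightarrow> real) \<Rightarrow> bool" where
  "C2_fun_on M U f \<longleftrightarrow> (\<forall>(W, \<psi>)\<in>atlas M. C2_on (W \<inter> \<psi> -` U) (f \<circ> \<psi>))"

text \<open>\<open>g\<close> is the gradient of \<open>f\<close> at \<open>p\<close> with respect to the induced metric.\<close>

definition is_gradient_at ::
  "('a::euclidean_space, 'm::euclidean_space) mfd \<Rightarrow> ('a \<Rightarrow> real) \<Rightarrow> 'a \<Rightarrow> 'a \<Rightarrow> bool" where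
  "is_gradient_at M f p g \<longleftrightarrow>
     g \<in> tangent_space M p \<and> (\<forall>u\<in>tangent_space M p. g \<bullet> u = deriv_along M f p u)"

definition gradient_on ::
  "('a::euclidean_space, 'm::euclidean_space) mfd \<Rightarrow> 'a set \<Rightarrow> ('a \<Rightarrow> 'a) \<Rightarrow> ('a \<Rightarrow> real) \<Rightarrow> bool" where
  "gradient_on M U v f \<longleftrightarrow> C2_fun_on M U f \<and> (\<forall>p\<in>U. is_gradient_at M f p (v p))"

definition tangent_field :: "('a::euclidean_space, 'm::euclidean_space) mfd \<Rightarrow> ('a \<Rightarrow> 'a) \<Rightarrow> bool" where
  "tangent_field M X \<longleftrightarrow> (\<forall>p\<in>carrier M. X p \<in> tangent_space M p)"

text \<open>The characterization $[X,Y]h = X(Yh) - Y(Xh)$ of the Lie bracket, applied to the ambient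
  coordinate functions \<open>h\<close>, for which \<open>Yh\<close> is the corresponding component of \<open>Y\<close>.\<close>

definition lie_bracket ::
  "('a::euclidean_space, 'm::euclidean_space) mfd \<Rightarrow> ('a \<Rightarrow> 'a) \<Rightarrow> ('a \<Rightarrow> 'a) \<Rightarrow> 'a \<Rightarrow> 'a" where
  "lie_bracket M X Y p = deriv_along M Y p (X p) - deriv_along M X p (Y p)"

text \<open>\<open>D\<close> is the Levi-Civita connection of the induced metric: an affine connection which is metric
  and torsion-free. On a submanifold of class $C^2$ the tangent bundle is only of class $C^1$, hence
  a connection acts on vector fields of class $C^1$. Fields are represented by functions on the
  whole ambient space, of which only the values on the submanifold matter.\<close>

definition levi_civita ::
  "('a::euclidean_space, 'm::euclidean_space) mfd \<Rightarrow> (('a \<Rightarrow> 'a) \<Rightarrow> ('a \<Rightarrow> 'a) \<Rightarrow> 'a \<Rightarrow> 'a) \<Rightarrow> bool" where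
  "levi_civita M D \<longleftrightarrow>
     (\<forall>X Y Z h. \<forall>p\<in>carrier M.
        C1_fun M X \<and> tangent_field M X \<and> C1_fun M Y \<and> tangent_field M Y \<and>
        C1_fun M Z \<and> tangent_field M Z \<and> C1_fun M (h :: 'a \<Rightarrow> real) \<longrightarrow>
          D X Y p \<in> tangent_space M p \<and>
          D (\<lambda>q. X q + Z q) Y p = D X Y p + D Z Y p \<and>
          D (\<lambda>q. h q *\<^sub>R X q) Y p = h p *\<^sub>R D X Y p \<and>
          D X (\<lambda>q. Y q + Z q) p = D X Y p + D X Z p \<and>
          D X (\<lambda>q. h q *\<^sub>R Y q) p = deriv_along M h p (X p) *\<^sub>R Y p + h p *\<^sub>R D X Y p \<and>
          deriv_along M (\<lambda>q. Y q \<bullet> Z q) p (X p) = D X Y p \<bullet> Z p + Y p \<bullet> D X Z p \<and>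
          D X Y p - D Y X p = lie_bracket M X Y p)"

text \<open>A distribution is integrable if every point lies on an integral manifold. Every manifold that
  can be immersed in \<open>M\<close> has a model of its dimension among the subspaces of the type \<open>'m\<close>.\<close>

definition integrable_distribution ::
  "('a::euclidean_space, 'm::euclidean_space) mfd \<Rightarrow> ('a \<Rightarrow> 'a set) \<Rightarrow> bool" where
  "integrable_distribution M E \<longleftrightarrow>
     (\<forall>p\<in>carrier M. \<exists>N :: ('a, 'm) mfd. immersed_submanifold N M \<and> p \<in> carrier N \<and>
        (\<forall>q\<in>carrier N. tangent_space N q = E q))"

definition orth_distribution ::
  "('a::euclidean_space, 'm::euclidean_space) mfd \<Rightarrow> ('a \<Rightarrow> 'a) \<Rightarrow> 'a \<Rightarrow> 'a set" where
  "orth_distribution M v p = {X \<in> tangent_space M p. X \<bullet> v p = 0}"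


section \<open>The space of oriented lines\<close>

text \<open>The tangent bundle of the unit sphere, which is an embedded submanifold of \<open>'a \<times> 'a\<close>.\<close>

definition TSphere :: "('a::euclidean_space \<times> 'a) set" where
  "TSphere = {(\<xi>, \<eta>). norm \<xi> = 1 \<and> \<xi> \<bullet> \<eta> = 0}"

text \<open>Since \<^const>\<open>TSphere\<close> is embedded, a map into it is a $C^2$ immersion iff it is one as a map
  into \<open>'a \<times> 'a\<close>.\<close>

definition immersion_into_TSphere ::
  "('p, 'm::euclidean_space) mfd \<Rightarrow> ('p \<Rightarrow> 'a::euclidean_space \<times> 'a) \<Rightarrow> bool" where
  "immersion_into_TSphere M f \<longleftrightarrow> f ` carrier M \<subseteq> TSphere \<and> immersion M euclidean_mfd f"

definition immersed_in_TSphere :: "('a::euclidean_space \<times> 'a, 'k::euclidean_space) mfd \<Rightarrow> bool" where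
  "immersed_in_TSphere \<Gamma> \<longleftrightarrow> C2_manifold \<Gamma> \<and> immersion_into_TSphere \<Gamma> (\<lambda>q. q)"

definition Phi :: "('a::euclidean_space \<Rightarrow> 'a) \<Rightarrow> 'a \<Rightarrow> 'a \<times> 'a" where
  "Phi v p = (v p, p - (v p \<bullet> p) *\<^sub>R v p)"

text \<open>The Liouville form, extended by the same formula to all of \<open>'a \<times> 'a\<close>; the derivative of
  \<^const>\<open>fst\<close> is the differential of the bundle projection. Since the exterior derivative commutes
  with restriction to submanifolds, \<open>Omega\<close> restricts on the tangent spaces of \<^const>\<open>TSphere\<close>
  to the symplectic form.\<close>

definition liouville_form :: "'a::euclidean_space \<times> 'a \<Rightarrow> 'a \<times> 'a \<Rightarrow> real" where
  "liouville_form z X = frechet_derivative fst (at z) X \<bullet> snd z"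

definition ext_deriv :: "('e::euclidean_space \<Rightarrow> 'e \<Rightarrow> real) \<Rightarrow> 'e \<Rightarrow> 'e \<Rightarrow> 'e \<Rightarrow> real" where
  "ext_deriv \<alpha> z X Y =
     frechet_derivative (\<lambda>y. \<alpha> y Y) (at z) X - frechet_derivative (\<lambda>y. \<alpha> y X) (at z) Y"

definition Omega :: "'a::euclidean_space \<times> 'a \<Rightarrow> 'a \<times> 'a \<Rightarrow> 'a \<times> 'a \<Rightarrow> real" where
  "Omega z X Y = - ext_deriv liouville_form z X Y"

lemma Omega_eq: "Omega z X Y = fst X \<bullet> snd Y - snd X \<bullet> fst Y"
proof -
  have fst': "frechet_derivative fst (at y) = (fst :: 'a \<times> 'a \<Rightarrow> 'a)" for y
    by (rule frechet_derivative_at[symmetric], rule bounded_linear_imp_has_derivative) (rule bounded_linear_fst)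
  have "frechet_derivative (\<lambda>y::'a \<times> 'a. c \<bullet> snd y) (at z) = (\<lambda>Y. c \<bullet> snd Y)" for c
    by (rule frechet_derivative_at[symmetric], rule bounded_linear_imp_has_derivative)
      (rule bounded_linear_compose[OF bounded_linear_inner_right bounded_linear_snd])
  then show ?thesis
    by (simp add: Omega_def ext_deriv_def liouville_form_def fst' inner_commute)
qed

definition isotropic :: "('a::euclidean_space \<times> 'a, 'k::euclidean_space) mfd \<Rightarrow> bool" where
  "isotropic \<Gamma> \<longleftrightarrow>
     (\<forall>q\<in>carrier \<Gamma>. \<forall>X\<in>tangent_space \<Gamma> q. \<forall>Y\<in>tangent_space \<Gamma> q. Omega q X Y = 0)"

end

theory Submission
  imports Defs
begin

text \<open>
  In a chart \<open>\<psi>\<close> of \<open>S\<close>, the pullback of the symplectic form under \<open>\<Phi>\<^sub>v \<circ> \<psi>\<close> is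
  \<open>(w, w') \<mapsto> \<langle>d(v \<circ> \<psi>) w, d\<psi> w'\<rangle> - \<langle>d(v \<circ> \<psi>) w', d\<psi> w\<rangle>\<close>, which is the exterior derivative of
  the one-form \<open>\<langle>v, \<cdot>\<rangle>\<close>. Hence (a) says that this one-form is closed, and (b) that it is locally exact,
  so that the equivalence of (a) and (b) is the Poincare lemma. For (c), the form vanishes on
  \<open>(v, w)\<close> for all \<open>w\<close> if and only if \<open>v\<close> is geodesic, and on pairs of vectors orthogonal to \<open>v\<close> if
  \<open>v\<^sup>\<bottom>\<close> is integrable; conversely the leaves are the level sets of the local primitives.

  Since \<open>\<Gamma>\<close> and \<open>S\<close> share only the image of \<open>\<Phi>\<^sub>v\<close>, and \<open>\<Phi>\<^sub>v\<close> need not be injective or continuous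
  into \<open>\<Gamma>\<close>, a Baire category argument compares their tangent spaces at a dense set of points.
\<close>


section \<open>Maps of class $C^1$ and $C^2$\<close>

text \<open>Charts and \<open>v\<close> are only C2, so the dual one-form and the coordinate vector
  fields are only C1; every argument gets by with one derivative of these. \<open>nabla\<close> is
  any operator obeying the axioms of \<open>levi_civita\<close>, so its value on \<open>v\<close>
  can be read off only from inner products with C1 fields defined on all of \<open>S\<close>; hence
  tangent vectors are extended by a cutoff. A leaf of the orthogonal distribution is modelled on a
  proper subspace, and a derivative within a subspace is determined only on vectors of that
  subspace; hence the separate calculus there. The statement for simply connected \<open>S\<close>
  avoids integrating the form along curves, which would require smoothing paths and homotopies:
  local primitives are instead continued along merely continuous maps of a square.\<close>

lemma C1_onI:
  assumes "\<And>x. x \<in> W \<Longrightarrow> (f has_derivative blinfun_apply (f' x)) (at x within W)"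
    and "continuous_on W f'"
  shows "C1_on W f"
  using assms unfolding C1_on_def by blast

lemma C2_onI:
  assumes "\<And>x. x \<in> W \<Longrightarrow> (f has_derivative blinfun_apply (f' x)) (at x within W)"
    and "C1_on W f'"
  shows "C2_on W f"
  using assms unfolding C2_on_def by blast

lemma C1_on_imp_continuous_on:
  assumes "C1_on W f"
  shows "continuous_on W f"
  using assms unfolding C1_on_def by (auto intro: has_derivative_continuous_on)

lemma C2_on_imp_C1_on: "C2_on W f \<Longrightarrow> C1_on W f"
  unfolding C2_on_def using C1_onI C1_on_imp_continuous_on by blast

lemma C1_on_subset:
  assumes "C1_on W f" "V \<subseteq> W"
  shows "C1_on V f"
proof -
  obtain f' where "\<And>x. x \<in> W \<Longrightarrow> (f has_derivative blinfun_apply (f' x)) (at x within W)"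
    "continuous_on W f'"
    using assms(1) unfolding C1_on_def by blast
  then show ?thesis
    using assms(2) by (intro C1_onI[of V f f']) (auto intro: has_derivative_subset continuous_on_subset)
qed

lemma C2_on_subset:
  assumes "C2_on W f" "V \<subseteq> W"
  shows "C2_on V f"
proof -
  obtain f' where "\<And>x. x \<in> W \<Longrightarrow> (f has_derivative blinfun_apply (f' x)) (at x within W)"
    "C1_on W f'"
    using assms(1) unfolding C2_on_def by blast
  then show ?thesis
    using assms(2) by (intro C2_onI[of V f f']) (auto intro: has_derivative_subset C1_on_subset)
qed

lemma C1_on_cong:
  assumes "\<And>x. x \<in> W \<Longrightarrow> f x = g x"
  shows "C1_on W f \<longleftrightarrow> C1_on W g"
proof -
  have "(f has_derivative F) (at x within W) \<longleftrightarrow> (g has_derivative F) (at x within W)"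
    if "x \<in> W" for x F
    using assms that has_derivative_transform[of x W f g F] has_derivative_transform[of x W g f F] by metis
  then show ?thesis
    unfolding C1_on_def by simp
qed

lemma C2_on_cong:
  assumes "\<And>x. x \<in> W \<Longrightarrow> f x = g x"
  shows "C2_on W f \<longleftrightarrow> C2_on W g"
proof -
  have "(f has_derivative F) (at x within W) \<longleftrightarrow> (g has_derivative F) (at x within W)"
    if "x \<in> W" for x F
    using assms that has_derivative_transform[of x W f g F] has_derivative_transform[of x W g f F] by metis
  then show ?thesis
    unfolding C2_on_def by simp
qed

lemma C1_on_compose:
  assumes "C1_on W f" "C1_on V g" "f ` W \<subseteq> V"
  shows "C1_on W (\<lambda>x. g (f x))"
proof -
  obtain f' where f: "\<And>x. x \<in> W \<Longrightarrow> (f has_derivative blinfun_apply (f' x)) (at x within W)"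
    "continuous_on W f'"
    using assms(1) unfolding C1_on_def by blast
  obtain g' where g: "\<And>x. x \<in> V \<Longrightarrow> (g has_derivative blinfun_apply (g' x)) (at x within V)"
    "continuous_on V g'"
    using assms(2) unfolding C1_on_def by blast
  have "((\<lambda>x. g (f x)) has_derivative blinfun_apply (g' (f x) o\<^sub>L f' x)) (at x within W)"
    if "x \<in> W" for x
    using has_derivative_in_compose2[of V g "\<lambda>y. blinfun_apply (g' y)" f W x "blinfun_apply (f' x)"] f g assms(3) that
    by (simp add: blinfun_compose.rep_eq comp_def)
  moreover have "continuous_on W (\<lambda>x. g' (f x) o\<^sub>L f' x)"
    using continuous_on_compose2[OF g(2) C1_on_imp_continuous_on[OF assms(1)] assms(3)] f(2)
    by (intro continuous_intros)
  ultimately show ?thesis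
    by (rule C1_onI)
qed

text \<open>The product rule, with the derivative assembled from \<open>prod_left\<close> and
  \<open>prod_right\<close>; inner products, scaling, and application and composition of bounded
  linear maps are its instances.\<close>

lemma (in bounded_bilinear) C1_on:
  assumes "C1_on W f" "C1_on W g"
  shows "C1_on W (\<lambda>x. prod (f x) (g x))"
proof -
  obtain f' where f: "\<And>x. x \<in> W \<Longrightarrow> (f has_derivative blinfun_apply (f' x)) (at x within W)"
    "continuous_on W f'"
    using assms(1) unfolding C1_on_def by blast
  obtain g' where g: "\<And>x. x \<in> W \<Longrightarrow> (g has_derivative blinfun_apply (g' x)) (at x within W)"
    "continuous_on W g'"
    using assms(2) unfolding C1_on_def by blast
  have "((\<lambda>x. prod (f x) (g x)) has_derivative
      blinfun_apply ((prod_right (f x) o\<^sub>L g' x) + (prod_left (g x) o\<^sub>L f' x))) (at x within W)"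
    if "x \<in> W" for x
    by (rule has_derivative_eq_rhs[OF FDERIV[OF f(1)[OF that] g(1)[OF that]]])
      (auto simp: plus_blinfun.rep_eq prod_left.rep_eq prod_right.rep_eq)
  moreover have "continuous_on W (\<lambda>x. (prod_right (f x) o\<^sub>L g' x) + (prod_left (g x) o\<^sub>L f' x))"
    by (intro continuous_intros f g bounded_linear.continuous_on[OF bounded_linear_prod_right]
        bounded_linear.continuous_on[OF bounded_linear_prod_left] C1_on_imp_continuous_on assms)
  ultimately show ?thesis
    by (rule C1_onI)
qed

lemma (in bounded_linear) C1_on:
  assumes "C1_on W g"
  shows "C1_on W (\<lambda>x. f (g x))"
proof -
  have "C1_on UNIV f"
    by (rule C1_onI[of _ _ "\<lambda>_. Blinfun f"])
      (auto simp: bounded_linear_Blinfun_apply bounded_linear_axioms bounded_linear_imp_has_derivative)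
  from C1_on_compose[OF assms this] show ?thesis
    by simp
qed

lemma C1_on_const: "C1_on W (\<lambda>x. c)"
  by (rule C1_onI[of _ _ "\<lambda>_. 0"]) (auto simp: zero_blinfun.rep_eq)

lemma C1_on_id: "C1_on W (\<lambda>x. x)"
  by (rule C1_onI[of _ _ "\<lambda>_. id_blinfun"]) auto

lemma C1_on_add:
  assumes "C1_on W f" "C1_on W g"
  shows "C1_on W (\<lambda>x. f x + g x)"
proof -
  obtain f' where f: "\<And>x. x \<in> W \<Longrightarrow> (f has_derivative blinfun_apply (f' x)) (at x within W)"
    "continuous_on W f'"
    using assms(1) unfolding C1_on_def by blast
  obtain g' where g: "\<And>x. x \<in> W \<Longrightarrow> (g has_derivative blinfun_apply (g' x)) (at x within W)"
    "continuous_on W g'"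
    using assms(2) unfolding C1_on_def by blast
  show ?thesis
    using f g by (intro C1_onI[of _ _ "\<lambda>x. f' x + g' x"] continuous_intros)
      (auto intro!: derivative_eq_intros simp: plus_blinfun.rep_eq)
qed

lemma C1_on_minus: "C1_on W f \<Longrightarrow> C1_on W (\<lambda>x. - f x)"
  by (rule bounded_linear.C1_on[OF bounded_linear_minus[OF bounded_linear_ident]])

lemma C1_on_diff: "C1_on W f \<Longrightarrow> C1_on W g \<Longrightarrow> C1_on W (\<lambda>x. f x - g x)"
  using C1_on_add[of W f "\<lambda>x. - g x"] C1_on_minus[of W g] by simp

lemma C1_on_inverse:
  fixes f :: "'m::real_normed_vector \<Rightarrow> real"
  assumes "C1_on W f" "\<And>x. x \<in> W \<Longrightarrow> f x \<noteq> 0"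
  shows "C1_on W (\<lambda>x. inverse (f x))"
proof -
  obtain f' where f: "\<And>x. x \<in> W \<Longrightarrow> (f has_derivative blinfun_apply (f' x)) (at x within W)"
    "continuous_on W f'"
    using assms(1) unfolding C1_on_def by blast
  show ?thesis
    using f assms C1_on_imp_continuous_on[OF assms(1)]
    by (intro C1_onI[of _ _ "\<lambda>x. (- (inverse (f x) * inverse (f x))) *\<^sub>R f' x"] continuous_intros)
      (auto intro!: derivative_eq_intros simp: scaleR_blinfun.rep_eq uminus_blinfun.rep_eq)
qed

lemmas C1_on_inner = bounded_bilinear.C1_on[OF bounded_bilinear_inner]
lemmas C1_on_scaleR = bounded_bilinear.C1_on[OF bounded_bilinear_scaleR]
lemmas C1_on_blinfun_apply = bounded_bilinear.C1_on[OF bounded_bilinear_blinfun_apply]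
lemmas C1_on_blinfun_compose = bounded_bilinear.C1_on[OF bounded_bilinear_blinfun_compose]

lemma C2_on_compose:
  assumes "C2_on W f" "C2_on V g" "f ` W \<subseteq> V"
  shows "C2_on W (\<lambda>x. g (f x))"
proof -
  obtain f' where f: "\<And>x. x \<in> W \<Longrightarrow> (f has_derivative blinfun_apply (f' x)) (at x within W)"
    "C1_on W f'"
    using assms(1) unfolding C2_on_def by blast
  obtain g' where g: "\<And>x. x \<in> V \<Longrightarrow> (g has_derivative blinfun_apply (g' x)) (at x within V)"
    "C1_on V g'"
    using assms(2) unfolding C2_on_def by blast
  have "((\<lambda>x. g (f x)) has_derivative blinfun_apply (g' (f x) o\<^sub>L f' x)) (at x within W)"
    if "x \<in> W" for x
    using has_derivative_in_compose2[of V g "\<lambda>y. blinfun_apply (g' y)" f W x "blinfun_apply (f' x)"] f g assms(3) that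
    by (simp add: blinfun_compose.rep_eq comp_def)
  moreover have "C1_on W (\<lambda>x. g' (f x) o\<^sub>L f' x)"
    by (intro C1_on_blinfun_compose f C1_on_compose[OF C2_on_imp_C1_on[OF assms(1)] g(2) assms(3)])
  ultimately show ?thesis
    by (rule C2_onI)
qed

text \<open>On an open set the derivative is unique, so the witness hidden in \<open>C1_on\<close>
  can only be the Frechet derivative; the existential definition becomes a condition that can be
  checked locally.\<close>

lemma C1_on_open:
  assumes "open W"
  shows "C1_on W f \<longleftrightarrow> (\<forall>x\<in>W. f differentiable at x) \<and>
    continuous_on W (\<lambda>x. Blinfun (frechet_derivative f (at x)))"
proof
  assume "C1_on W f"
  then obtain f' where f: "\<And>x. x \<in> W \<Longrightarrow> (f has_derivative blinfun_apply (f' x)) (at x within W)"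
    "continuous_on W f'"
    unfolding C1_on_def by blast
  then have f1: "(f has_derivative blinfun_apply (f' x)) (at x)" if "x \<in> W" for x
    using that assms by (metis at_within_open)
  then have "Blinfun (frechet_derivative f (at x)) = f' x" if "x \<in> W" for x
    using that by (metis blinfun_apply_inverse frechet_derivative_at)
  then show "(\<forall>x\<in>W. f differentiable at x) \<and>
    continuous_on W (\<lambda>x. Blinfun (frechet_derivative f (at x)))"
    using f(2) f1 by (auto simp: differentiable_def cong: continuous_on_cong)
next
  assume *: "(\<forall>x\<in>W. f differentiable at x) \<and>
    continuous_on W (\<lambda>x. Blinfun (frechet_derivative f (at x)))"
  show "C1_on W f"
  proof (rule C1_onI)
    show "continuous_on W (\<lambda>x. Blinfun (frechet_derivative f (at x)))"
      using * by blast
    fix x assume "x \<in> W"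
    then have "(f has_derivative frechet_derivative f (at x)) (at x)"
      using * by (simp add: frechet_derivative_works)
    then show "(f has_derivative blinfun_apply (Blinfun (frechet_derivative f (at x)))) (at x within W)"
      by (simp add: has_derivative_at_withinI bounded_linear_Blinfun_apply has_derivative_bounded_linear)
  qed
qed

text \<open>Both conditions in \<open>C1_on_open\<close> are local. This makes the extension of a
  cut-off field by zero a C1 field.\<close>

lemma C1_on_Un_open:
  assumes "open V" "open W" "C1_on V f" "C1_on W f"
  shows "C1_on (V \<union> W) f"
  using assms by (auto simp: C1_on_open[OF open_Un[OF assms(1,2)]] C1_on_open continuous_on_open_Un)

lemma C2_on_frechet:
  assumes "open W" "C2_on W f" "x \<in> W"
  shows "(f has_derivative frechet_derivative f (at x)) (at x)"
  using assms C1_on_open[of W f] C2_on_imp_C1_on frechet_derivative_works by blast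

lemma C2_on_open:
  assumes "open W" "C2_on W f"
  shows "C1_on W (\<lambda>x. Blinfun (frechet_derivative f (at x)))"
proof -
  obtain f' where f: "\<And>x. x \<in> W \<Longrightarrow> (f has_derivative blinfun_apply (f' x)) (at x within W)"
    "C1_on W f'"
    using assms(2) unfolding C2_on_def by blast
  then have f1: "(f has_derivative blinfun_apply (f' x)) (at x)" if "x \<in> W" for x
    using that assms by (metis at_within_open)
  then have "Blinfun (frechet_derivative f (at x)) = f' x" if "x \<in> W" for x
    using that by (metis blinfun_apply_inverse frechet_derivative_at)
  then show ?thesis
    using f(2) by (simp cong: C1_on_cong)
qed


section \<open>Derivatives within a relatively open subset of a subspace\<close>

text \<open>Near \<open>x\<close> the sets \<open>W\<close> and \<open>T\<close> coincide.
  \<open>C1_on\<close> and \<open>C2_on\<close> differentiate within \<open>W\<close>,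
  \<open>tangent_space\<close> within the model; this passes between the two.\<close>

lemma at_within_openin_subspace:
  assumes "openin (top_of_set T) W" "x \<in> W"
  shows "at x within W = at x within T"
proof -
  obtain V where V: "open V" "W = T \<inter> V"
    using assms(1) by (auto simp: openin_open)
  then show ?thesis
    using assms(2) by (intro at_within_nhd[of x V]) auto
qed

lemma openin_subspace_line:
  fixes T :: "'m::real_normed_vector set"
  assumes "subspace T" "openin (top_of_set T) W" "x \<in> W"
  obtains d where "d > 0" "\<And>u. u \<in> T \<Longrightarrow> norm u < d \<Longrightarrow> x + u \<in> W"
proof -
  have T: "x \<in> T" "W \<subseteq> T"
    using openin_imp_subset[OF assms(2)] assms(3) by auto
  obtain d where d: "d > 0" "ball x d \<inter> T \<subseteq> W"
    using assms(2,3) unfolding openin_contains_ball by blast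
  show thesis
  proof (rule that[OF d(1)])
    fix u assume "u \<in> T" "norm u < d"
    then have "x + u \<in> ball x d \<inter> T"
      using T assms(1) by (simp add: dist_norm subspace_add)
    then show "x + u \<in> W"
      using d(2) by blast
  qed
qed

text \<open>The segment through \<open>x\<close> in a direction of \<open>T\<close> stays in
  \<open>W\<close> for small parameters of both signs, so a derivative within \<open>W\<close>
  restricts to an ordinary derivative in one variable.\<close>

lemma has_derivative_along_line:
  assumes "subspace T" "openin (top_of_set T) W" "x \<in> W" "w \<in> T"
    and "(f has_derivative F) (at x within W)"
  shows "((\<lambda>t. f (x + t *\<^sub>R w)) has_vector_derivative F w) (at 0)"
proof -
  obtain d where d: "d > 0" "\<And>u. u \<in> T \<Longrightarrow> norm u < d \<Longrightarrow> x + u \<in> W"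
    using openin_subspace_line[OF assms(1-3)] by blast
  \<comment> \<open>The summand 1 keeps the quotient meaningful for \<open>w = 0\<close>.\<close>
  define e where "e = d / (norm w + 1)"
  have e: "e > 0" using d(1) by (auto simp: e_def add_nonneg_pos)
  have sub: "(\<lambda>t. x + t *\<^sub>R w) ` ball 0 e \<subseteq> W"
  proof clarify
    fix t :: real assume "t \<in> ball 0 e"
    then have "\<bar>t\<bar> * (norm w + 1) < d"
      by (simp add: e_def pos_less_divide_eq add_nonneg_pos)
    moreover have "norm (t *\<^sub>R w) \<le> \<bar>t\<bar> * (norm w + 1)"
      by (simp add: mult_left_mono)
    ultimately show "x + t *\<^sub>R w \<in> W"
      using assms(1,4) by (intro d(2)) (auto simp: subspace_scale)
  qed
  have lin: "linear F"
    by (rule has_derivative_linear[OF assms(5)])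
  have 1: "((\<lambda>t. x + t *\<^sub>R w) has_derivative (\<lambda>t. t *\<^sub>R w)) (at 0 within ball 0 e)"
    by (auto intro!: derivative_eq_intros)
  have 2: "(f has_derivative F) (at (x + 0 *\<^sub>R w) within (\<lambda>t. x + t *\<^sub>R w) ` ball 0 e)"
    using has_derivative_subset[OF assms(5) sub] by simp
  have "((\<lambda>t. f (x + t *\<^sub>R w)) has_derivative (\<lambda>t. F (t *\<^sub>R w))) (at 0 within ball 0 e)"
    using has_derivative_in_compose[OF 1 2] by simp
  then have "((\<lambda>t. f (x + t *\<^sub>R w)) has_derivative (\<lambda>t. F (t *\<^sub>R w))) (at 0)"
    using e by (simp add: at_within_open[of 0 "ball 0 e"])
  then show ?thesis
    using linear_cmul[OF lin] by (simp add: has_vector_derivative_def)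
qed

text \<open>Two derivatives within a subspace may differ off \<open>T\<close>; on \<open>T\<close>
  both compute the same derivative along a line.\<close>

lemma has_derivative_unique_subspace:
  assumes "subspace T" "openin (top_of_set T) W" "x \<in> W" "w \<in> T"
    and "(f has_derivative F) (at x within W)" "(f has_derivative G) (at x within W)"
  shows "F w = G w"
  using has_derivative_along_line[OF assms(1-4) assms(5)] has_derivative_along_line[OF assms(1-4) assms(6)]
  by (rule vector_derivative_unique_at)

text \<open>The mean value theorem, applied to the increments of \<open>f\<close> along \<open>w\<close>, compares the second
  difference quotient with the second derivative.\<close>

lemma second_difference:
  fixes f :: "'m::real_normed_vector \<Rightarrow> real"
  assumes T: "subspace T" "openin (top_of_set T) W" "x \<in> W" "w \<in> T" "w' \<in> T"
    and f: "\<And>y. y \<in> W \<Longrightarrow> (f has_derivative blinfun_apply (f' y)) (at y within W)"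
    and f': "(f' has_derivative f'') (at x within W)"
    and e: "e > 0"
  obtains d where "d > 0" "\<And>t. 0 < t \<Longrightarrow> t < d \<Longrightarrow>
    \<bar>(f (x + t *\<^sub>R w + t *\<^sub>R w') - f (x + t *\<^sub>R w) - f (x + t *\<^sub>R w') + f x) / t\<^sup>2 - f'' w' w\<bar>
      \<le> e"
proof -
  \<comment> \<open>\<open>t * C\<close> bounds the displacement from \<open>x\<close> whenever both
    coefficients are at most \<open>t\<close> in absolute value. Two remainders of size
    \<open>e' * (t * C) * C\<close>, divided by \<open>t\<close>, must add up to \<open>e\<close>,
    which fixes \<open>e'\<close>.\<close>
  define C where "C = norm w + norm w' + 1"
  have C: "C > 0" by (simp add: C_def add_nonneg_pos)
  define e' where "e' = e / (2 * C * C)"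
  have e': "e' > 0" using e C by (simp add: e'_def)
  have lin: "linear f''"
    by (rule has_derivative_linear[OF f'])
  obtain d0 where d0: "d0 > 0" "\<And>u. u \<in> T \<Longrightarrow> norm u < d0 \<Longrightarrow> x + u \<in> W"
    using openin_subspace_line[OF T(1-3)] by blast
  obtain d1 where d1: "d1 > 0"
    "\<And>y. y \<in> W \<Longrightarrow> norm (y - x) < d1 \<Longrightarrow> norm (f' y - f' x - f'' (y - x)) \<le> e' * norm (y - x)"
    using f' e' unfolding has_derivative_within_alt by blast
  define d where "d = min d0 d1 / C"
  have d: "d > 0" using d0 d1 C by (simp add: d_def)
  show thesis
  proof (rule that[OF d])
    fix t :: real assume t: "0 < t" "t < d"
    then have tC: "t * C < d0" "t * C < d1"
      using C by (auto simp: d_def field_simps)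
    have sm: "s *\<^sub>R w + r *\<^sub>R w' \<in> T" "norm (s *\<^sub>R w + r *\<^sub>R w') \<le> t * C"
      "x + (s *\<^sub>R w + r *\<^sub>R w') \<in> W" if "\<bar>s\<bar> \<le> t" "\<bar>r\<bar> \<le> t" for s r
    proof -
      show 1: "s *\<^sub>R w + r *\<^sub>R w' \<in> T"
        using T by (simp add: subspace_add subspace_scale)
      have "norm (s *\<^sub>R w + r *\<^sub>R w') \<le> \<bar>s\<bar> * norm w + \<bar>r\<bar> * norm w'"
        by (metis norm_scaleR norm_triangle_ineq)
      also have "\<dots> \<le> t * norm w + t * norm w'"
        using that by (intro add_mono mult_right_mono) auto
      also have "\<dots> \<le> t * C"
        using t by (simp add: C_def algebra_simps)
      finally show 2: "norm (s *\<^sub>R w + r *\<^sub>R w') \<le> t * C" .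
      show "x + (s *\<^sub>R w + r *\<^sub>R w') \<in> W"
        using d0(2)[OF 1] 2 tC by linarith
    qed
    have line: "((\<lambda>s. f (x + (s *\<^sub>R w + r *\<^sub>R w'))) has_real_derivative
        f' (x + (s *\<^sub>R w + r *\<^sub>R w')) w) (at s)"
      if "\<bar>s\<bar> \<le> t" "\<bar>r\<bar> \<le> t" for s r
    proof -
      have "((\<lambda>q. f (x + (s *\<^sub>R w + r *\<^sub>R w') + q *\<^sub>R w)) has_vector_derivative
          f' (x + (s *\<^sub>R w + r *\<^sub>R w')) w) (at 0)"
        by (rule has_derivative_along_line[OF T(1,2) sm(3)[OF that] T(4) f[OF sm(3)[OF that]]])
      then have "((\<lambda>q. f (x + (s *\<^sub>R w + r *\<^sub>R w') + q *\<^sub>R w)) has_real_derivative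
          f' (x + (s *\<^sub>R w + r *\<^sub>R w')) w) (at (s + - s))"
        by (simp add: has_real_derivative_iff_has_vector_derivative)
      then have "((\<lambda>q. f (x + (s *\<^sub>R w + r *\<^sub>R w') + (q + - s) *\<^sub>R w)) has_real_derivative
          f' (x + (s *\<^sub>R w + r *\<^sub>R w')) w) (at s)"
        by (subst (asm) DERIV_shift)
      then show ?thesis
        by (simp add: algebra_simps)
    qed
    \<comment> \<open>\<open>\<phi>\<close> is the increment of \<open>f\<close> in the direction
      \<open>w'\<close>, and its own increment over the interval from 0 to \<open>t\<close> is the
      second difference. The mean value theorem turns the latter into a difference of two values of
      \<open>f'\<close>, each of which is compared with the linearization of \<open>f'\<close> at
      \<open>x\<close>.\<close>
    define \<phi> where "\<phi> s = f (x + (s *\<^sub>R w + t *\<^sub>R w')) - f (x + (s *\<^sub>R w + 0 *\<^sub>R w'))" for s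
    have "\<exists>z>0. z < t \<and> \<phi> t - \<phi> 0 = (t - 0) *
      (f' (x + (z *\<^sub>R w + t *\<^sub>R w')) w - f' (x + (z *\<^sub>R w + 0 *\<^sub>R w')) w)"
      unfolding \<phi>_def using t by (intro MVT2 DERIV_diff line) auto
    then obtain z where z: "0 < z" "z < t" and
      \<phi>: "\<phi> t - \<phi> 0 = t * (f' (x + (z *\<^sub>R w + t *\<^sub>R w')) w - f' (x + (z *\<^sub>R w + 0 *\<^sub>R w')) w)"
      by auto
    define R where "R r = f' (x + (z *\<^sub>R w + r *\<^sub>R w')) - f' x - f'' (z *\<^sub>R w + r *\<^sub>R w')" for r
    have R: "norm (R r w) \<le> e' * (t * C) * C" if "\<bar>r\<bar> \<le> t" for r
    proof -
      have zr: "\<bar>z\<bar> \<le> t" "\<bar>r\<bar> \<le> t" using z that by auto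
      have "norm (R r) \<le> e' * norm (z *\<^sub>R w + r *\<^sub>R w')"
        unfolding R_def using d1(2)[OF sm(3)[OF zr]] sm(2)[OF zr] tC by simp
      also have "\<dots> \<le> e' * (t * C)"
        using sm(2)[OF zr] e' by simp
      finally have "norm (R r) * norm w \<le> e' * (t * C) * C"
        using e' t C by (intro mult_mono) (auto simp: C_def)
      then show ?thesis
        using norm_blinfun[of "R r" w] by linarith
    qed
    define \<Delta> where "\<Delta> = f (x + t *\<^sub>R w + t *\<^sub>R w') - f (x + t *\<^sub>R w) - f (x + t *\<^sub>R w') + f x"
    have "\<Delta> = \<phi> t - \<phi> 0"
      by (simp add: \<Delta>_def \<phi>_def add.assoc)
    also have "\<dots> = t * (t * f'' w' w + (R t w - R 0 w))"
      unfolding \<phi> R_def using lin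
      by (simp add: linear_add linear_cmul blinfun.diff_left blinfun.add_left blinfun.scaleR_left)
    finally have "\<Delta> / t\<^sup>2 - f'' w' w = (R t w - R 0 w) / t"
      using t by (simp add: power2_eq_square diff_divide_eq_iff distrib_left add_divide_distrib)
    also have "\<bar>(R t w - R 0 w) / t\<bar> \<le> (2 * (e' * (t * C) * C)) / t"
    proof -
      have "\<bar>R t w - R 0 w\<bar> \<le> 2 * (e' * (t * C) * C)"
        using R[of t] R[of 0] t by simp
      then show ?thesis
        using t divide_right_mono[of "\<bar>R t w - R 0 w\<bar>" "2 * (e' * (t * C) * C)" t]
        by (simp only: abs_divide abs_of_pos)
    qed
    also have "\<dots> = e"
      using t C by (simp add: e'_def)
    finally show "\<bar>(f (x + t *\<^sub>R w + t *\<^sub>R w') - f (x + t *\<^sub>R w) - f (x + t *\<^sub>R w') + f x) / t\<^sup>2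
        - f'' w' w\<bar> \<le> e"
      by (simp add: \<Delta>_def)
  qed
qed

text \<open>The second difference is symmetric in \<open>w\<close> and \<open>w'\<close>, and its
  quotient by \<open>t\<^sup>2\<close> tends to both values.\<close>

lemma symmetric_second_derivative_real:
  fixes f :: "'m::real_normed_vector \<Rightarrow> real"
  assumes T: "subspace T" "openin (top_of_set T) W" "x \<in> W" "w \<in> T" "w' \<in> T"
    and f: "\<And>y. y \<in> W \<Longrightarrow> (f has_derivative blinfun_apply (f' y)) (at y within W)"
    and f': "(f' has_derivative f'') (at x within W)"
  shows "f'' w w' = f'' w' w"
proof (rule ccontr)
  assume "f'' w w' \<noteq> f'' w' w"
  \<comment> \<open>With a third of the gap as tolerance, a single quotient \<open>q\<close> cannot
    be close to both values.\<close>
  then have e: "\<bar>f'' w w' - f'' w' w\<bar> / 3 > 0" (is "?e > 0") by simp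
  obtain d where d: "d > 0" "\<And>t. 0 < t \<Longrightarrow> t < d \<Longrightarrow>
    \<bar>(f (x + t *\<^sub>R w + t *\<^sub>R w') - f (x + t *\<^sub>R w) - f (x + t *\<^sub>R w') + f x) / t\<^sup>2 - f'' w' w\<bar> \<le> ?e"
    using second_difference[OF T f f' e] by blast
  obtain d' where d': "d' > 0" "\<And>t. 0 < t \<Longrightarrow> t < d' \<Longrightarrow>
    \<bar>(f (x + t *\<^sub>R w' + t *\<^sub>R w) - f (x + t *\<^sub>R w') - f (x + t *\<^sub>R w) + f x) / t\<^sup>2 - f'' w w'\<bar> \<le> ?e"
    using second_difference[OF T(1-3) T(5) T(4) f f' e] by blast
  define t where "t = min d d' / 2"
  define q where "q = (f (x + t *\<^sub>R w + t *\<^sub>R w') - f (x + t *\<^sub>R w) - f (x + t *\<^sub>R w') + f x) / t\<^sup>2"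
  have t: "0 < t" "t < d" "t < d'"
    using d d' by (auto simp: t_def)
  have "(f (x + t *\<^sub>R w' + t *\<^sub>R w) - f (x + t *\<^sub>R w') - f (x + t *\<^sub>R w) + f x) / t\<^sup>2 = q"
    by (simp add: q_def add_ac)
  then have "\<bar>q - f'' w w'\<bar> \<le> ?e" "\<bar>q - f'' w' w\<bar> \<le> ?e"
    using d(2)[OF t(1,2)] d'(2)[OF t(1,3)] by (simp_all only: q_def)
  moreover have "\<bar>f'' w w' - f'' w' w\<bar> \<le> \<bar>q - f'' w w'\<bar> + \<bar>q - f'' w' w\<bar>"
    by linarith
  ultimately show False
    using e by simp
qed

lemma symmetric_second_derivative:
  fixes f :: "'m::real_normed_vector \<Rightarrow> 'b::real_inner"
  assumes T: "subspace T" "openin (top_of_set T) W" "x \<in> W" "w \<in> T" "w' \<in> T"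
    and f: "\<And>y. y \<in> W \<Longrightarrow> (f has_derivative blinfun_apply (f' y)) (at y within W)"
    and f': "(f' has_derivative f'') (at x within W)"
  shows "f'' w w' = f'' w' w"
proof -
  \<comment> \<open>Pairing \<open>f\<close> with the defect of symmetry itself reduces to the real
    case and yields \<open>b \<bullet> b = 0\<close>.\<close>
  define b where "b = f'' w w' - f'' w' w"
  have "((\<lambda>y. b \<bullet> f y) has_derivative blinfun_apply (blinfun_inner_right b o\<^sub>L f' y)) (at y within W)"
    if "y \<in> W" for y
    using has_derivative_inner_right[OF f[OF that], of b]
    by (simp add: blinfun_compose.rep_eq blinfun_inner_right.rep_eq comp_def)
  moreover have "((\<lambda>y. blinfun_inner_right b o\<^sub>L f' y) has_derivative
      (\<lambda>h. blinfun_inner_right b o\<^sub>L f'' h)) (at x within W)"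
    by (rule bounded_linear.has_derivative[OF
        bounded_bilinear.bounded_linear_right[OF bounded_bilinear_blinfun_compose] f'])
  ultimately have "(blinfun_inner_right b o\<^sub>L f'' w) w' = (blinfun_inner_right b o\<^sub>L f'' w') w"
    by (rule symmetric_second_derivative_real[OF T])
  then have "b \<bullet> b = 0"
    by (simp add: b_def inner_diff_right)
  then show ?thesis
    by (simp add: b_def)
qed


section \<open>Closed one-forms on a ball\<close>

text \<open>The primitive is the integral of \<open>\<alpha>\<close> over the segment from
  \<open>x0\<close> to \<open>x\<close>. Differentiation under the integral sign produces an
  integrand which, by closedness, is the derivative of \<open>t *\<^sub>R \<alpha> (y x t)\<close>
  in \<open>t\<close>, so the integral collapses to \<open>\<alpha> x\<close>.\<close>

lemma closed_one_form_primitive: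
  fixes \<alpha> :: "'m::euclidean_space \<Rightarrow> 'm \<Rightarrow>\<^sub>L real"
  assumes "C1_on (ball x0 r) \<alpha>"
    and closed: "\<And>x F w w'. x \<in> ball x0 r \<Longrightarrow> (\<alpha> has_derivative F) (at x) \<Longrightarrow> F w w' = F w' w"
  obtains f where "\<And>x. x \<in> ball x0 r \<Longrightarrow> (f has_derivative blinfun_apply (\<alpha> x)) (at x)"
proof -
  let ?U = "ball x0 r"
  obtain \<alpha>' where \<alpha>': "\<And>x. x \<in> ?U \<Longrightarrow> (\<alpha> has_derivative blinfun_apply (\<alpha>' x)) (at x within ?U)"
    and cont': "continuous_on ?U \<alpha>'"
    using assms(1) unfolding C1_on_def by blast
  have cont: "continuous_on ?U \<alpha>"
    using assms(1) by (rule C1_on_imp_continuous_on)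
  have \<alpha>'_at: "(\<alpha> has_derivative blinfun_apply (\<alpha>' x)) (at x)" if "x \<in> ?U" for x
    using \<alpha>'[OF that] at_within_open[OF that] by simp
  define y where "y x t = x0 + t *\<^sub>R (x - x0)" for x and t :: real
  have y: "y x t \<in> ?U" if "x \<in> ?U" "t \<in> {0..1}" for x t
  proof -
    have "norm (t *\<^sub>R (x - x0)) \<le> 1 * norm (x - x0)"
      unfolding norm_scaleR using that by (intro mult_right_mono) auto
    then show ?thesis
      using that by (simp add: y_def dist_norm norm_minus_commute)
  qed
  have cont_y: "continuous_on (?U \<times> cbox 0 1) (\<lambda>p. y (fst p) (snd p))"
    unfolding y_def by (intro continuous_intros)
  \<comment> \<open>Derivative of the integrand in \<open>x\<close>: the first summand
    differentiates the base point \<open>y x t\<close>, which contributes the factor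
    \<open>t\<close>; the second differentiates the argument \<open>x - x0\<close>.\<close>
  define fx where "fx x t = (blinfun.prod_left (x - x0) o\<^sub>L (t *\<^sub>R \<alpha>' (y x t))) + \<alpha> (y x t)" for x t
  have fx_apply: "blinfun_apply (fx x t) u = t * \<alpha>' (y x t) u (x - x0) + \<alpha> (y x t) u" for x t u
    by (simp add: fx_def plus_blinfun.rep_eq blinfun.prod_left.rep_eq scaleR_blinfun.rep_eq)
  have leibniz: "((\<lambda>x. integral (cbox 0 1) (\<lambda>t. \<alpha> (y x t) (x - x0))) has_derivative
      integral (cbox 0 1) (fx x)) (at x within ?U)" if x: "x \<in> ?U" for x
  proof (rule leibniz_rule[where fx = fx])
    fix x t assume xt: "x \<in> ?U" "t \<in> cbox (0::real) 1"
    have "((\<lambda>x. y x t) has_derivative (\<lambda>h. t *\<^sub>R h)) (at x within ?U)"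
      unfolding y_def by (auto intro!: derivative_eq_intros)
    from diff_chain_within[OF this has_derivative_at_withinI[OF \<alpha>'_at[OF y]]] xt
    have "((\<lambda>x. \<alpha> (y x t)) has_derivative (\<lambda>h. \<alpha>' (y x t) (t *\<^sub>R h))) (at x within ?U)"
      by (simp add: comp_def)
    then show "((\<lambda>x. \<alpha> (y x t) (x - x0)) has_derivative blinfun_apply (fx x t)) (at x within ?U)"
      by (rule blinfun.FDERIV[THEN has_derivative_eq_rhs])
        (auto intro!: derivative_eq_intros
          simp: fx_apply[abs_def] blinfun.scaleR_right blinfun.scaleR_left algebra_simps fun_eq_iff)
  next
    fix x assume x: "x \<in> ?U"
    have "continuous_on (cbox 0 1) (\<lambda>t. y x t)"
      unfolding y_def by (intro continuous_intros)
    then have "continuous_on (cbox 0 1) (\<lambda>t. \<alpha> (y x t))"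
      using y x by (intro continuous_on_compose2[OF cont]) auto
    then show "(\<lambda>t. \<alpha> (y x t) (x - x0)) integrable_on cbox 0 1"
      by (intro integrable_continuous continuous_intros)
  next
    have "(\<lambda>p. y (fst p) (snd p)) ` (?U \<times> cbox 0 1) \<subseteq> ?U"
      using y by auto
    then show "continuous_on (?U \<times> cbox 0 1) (\<lambda>(x, t). fx x t)"
      unfolding fx_def case_prod_beta
      by (intro continuous_intros bounded_linear.continuous_on[OF blinfun.bounded_linear_prod_left]
          continuous_on_compose2[OF cont cont_y] continuous_on_compose2[OF cont' cont_y])
  qed (use x in auto)
  have int: "integral (cbox 0 1) (fx x) = \<alpha> x" if x: "x \<in> ?U" for x
  proof -
    have "((\<lambda>t. t *\<^sub>R \<alpha> (y x t)) has_vector_derivative fx x t) (at t within {0..1})"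
      if t: "t \<in> {0..1}" for t
    proof -
      have "((\<lambda>t. y x t) has_derivative (\<lambda>s. s *\<^sub>R (x - x0))) (at t within {0..1})"
        unfolding y_def by (auto intro!: derivative_eq_intros)
      from diff_chain_within[OF this has_derivative_at_withinI[OF \<alpha>'_at[OF y[OF x t]]]]
      have "((\<lambda>t. \<alpha> (y x t)) has_derivative (\<lambda>s. s *\<^sub>R \<alpha>' (y x t) (x - x0))) (at t within {0..1})"
        by (simp add: comp_def blinfun.scaleR_right)
      then have "((\<lambda>t. t *\<^sub>R \<alpha> (y x t)) has_derivative
          (\<lambda>s. t *\<^sub>R (s *\<^sub>R \<alpha>' (y x t) (x - x0)) + s *\<^sub>R \<alpha> (y x t))) (at t within {0..1})"
        by (auto intro!: derivative_eq_intros)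
      \<comment> \<open>Closedness enters here, exchanging the direction of differentiation with the
        argument of the form.\<close>
      moreover have "fx x t = t *\<^sub>R \<alpha>' (y x t) (x - x0) + \<alpha> (y x t)"
        using closed[OF y[OF x t] \<alpha>'_at[OF y[OF x t]]]
        by (intro blinfun_eqI) (simp add: fx_apply plus_blinfun.rep_eq scaleR_blinfun.rep_eq)
      ultimately show ?thesis
        by (simp add: has_vector_derivative_def algebra_simps)
    qed
    then have "(fx x has_integral (1 *\<^sub>R \<alpha> (y x 1) - 0 *\<^sub>R \<alpha> (y x 0))) {0..1}"
      by (intro fundamental_theorem_of_calculus) auto
    then show ?thesis
      by (simp add: y_def integral_unique)
  qed
  show thesis
  proof (rule that)
    fix x assume x: "x \<in> ?U"
    show "((\<lambda>x. integral (cbox 0 1) (\<lambda>t. \<alpha> (y x t) (x - x0))) has_derivative blinfun_apply (\<alpha> x)) (at x)"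
      using leibniz[OF x] unfolding int[OF x] at_within_open[OF x open_ball] .
  qed
qed


section \<open>Images of immersions covering each other\<close>

text \<open>An injective derivative has a linear left inverse, and continuity of the derivative in
  operator norm gives injectivity on an open ball. Halving the radius makes the domain compact, as
  the Baire argument requires.\<close>

lemma C1_immersion_locally_injective:
  fixes f :: "'m::euclidean_space \<Rightarrow> 'e::euclidean_space"
  assumes "open W" "C1_on W f" "x \<in> W" "inj (frechet_derivative f (at x))"
  obtains r where "r > 0" "cball x r \<subseteq> W" "inj_on f (cball x r)"
proof -
  let ?D = "\<lambda>x. frechet_derivative f (at x)"
  have D: "(f has_derivative ?D x) (at x)" if "x \<in> W" for x
    using assms(1,2) that C1_on_open frechet_derivative_works by blast
  have cont: "continuous_on W (\<lambda>x. Blinfun (?D x))"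
    using assms(1,2) C1_on_open by blast
  have lin: "linear (?D x)"
    using D[OF assms(3)] by (rule has_derivative_linear)
  obtain g where g: "linear g" "g \<circ> ?D x = id"
    using linear_injective_left_inverse[OF lin assms(4)] by blast
  have "\<exists>d>0. \<forall>z. dist x z < d \<longrightarrow> onorm (\<lambda>v. ?D z v - ?D x v) < e" if e: "e > 0" for e
  proof -
    obtain d where d: "d > 0" "\<And>z. z \<in> W \<Longrightarrow> dist z x < d \<Longrightarrow> dist (Blinfun (?D z)) (Blinfun (?D x)) < e"
      using cont assms(3) e unfolding continuous_on_iff by metis
    obtain d' where d': "d' > 0" "ball x d' \<subseteq> W"
      using assms(1,3) openE by blast
    have "onorm (\<lambda>v. ?D z v - ?D x v) < e" if "dist x z < min d d'" for z
    proof -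
      have z: "z \<in> W" using that d' by auto
      have "onorm (\<lambda>v. ?D z v - ?D x v) = norm (Blinfun (?D z) - Blinfun (?D x))"
        using has_derivative_bounded_linear[OF D[OF z]] has_derivative_bounded_linear[OF D[OF assms(3)]]
        by (simp add: norm_blinfun.rep_eq minus_blinfun.rep_eq bounded_linear_Blinfun_apply)
      then show ?thesis
        using d(2)[OF z] that by (simp add: dist_norm norm_minus_commute)
    qed
    then show ?thesis
      using d(1) d'(1) by (intro exI[of _ "min d d'"]) auto
  qed
  then obtain r where r: "r > 0" "ball x r \<subseteq> W" "inj_on f (ball x r)"
    using has_derivative_locally_injective[OF assms(3,1) linear_conv_bounded_linear[THEN iffD1, OF g(1)] g(2) D]
    by blast
  have "cball x (r/2) \<subseteq> ball x r"
    using r(1) by auto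
  then show thesis
    using r by (intro that[of "r/2"]) (auto intro: inj_on_subset)
qed

text \<open>The difference quotients of \<open>f\<close> converge to vectors tangent to \<open>g ` K\<close>. By compactness of \<open>K\<close>,
  the preimages under \<open>g\<close> of points converging to \<open>g y\<close> converge to \<open>y\<close>.\<close>

lemma tangent_inclusion:
  fixes f :: "'m::euclidean_space \<Rightarrow> 'e::euclidean_space" and g :: "'k::euclidean_space \<Rightarrow> 'e"
  assumes U: "open U" "x \<in> U" and f: "(f has_derivative f') (at x)" "continuous_on U f"
    and K: "compact K" "continuous_on K g" "inj_on g K" "f ` U \<subseteq> g ` K"
    and y: "y \<in> K" "g y = f x" and g: "(g has_derivative g') (at y)" "inj g'"
  shows "range f' \<subseteq> range g'"
proof clarify
  fix w
  define b where "b = f' w"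
  have lin: "linear g'" "linear f'"
    using g(1) f(1) has_derivative_linear by blast+
  obtain L where L: "linear L" "L \<circ> g' = id"
    using linear_injective_left_inverse[OF lin(1) g(2)] by blast
  have Lg: "L (g' u) = u" for u
    using L(2) by (metis comp_apply id_apply)
  \<comment> \<open>\<open>P\<close> is a projection with kernel \<open>range g'\<close>, so the
    claim for \<open>b\<close> reads \<open>P b = 0\<close>.\<close>
  define P where "P z = z - g' (L z)" for z
  have P: "linear P"
    using lin(1) L(1) by (intro linearI) (simp_all add: P_def linear_add linear_cmul algebra_simps)
  have Pg: "P (g' u) = 0" for u
    by (simp add: P_def Lg)
  obtain c where c: "c > 0" "\<And>z. norm (L z) \<le> c * norm z"
    using linear_bounded_pos[OF L(1)] by blast
  obtain k where k: "k > 0" "\<And>z. norm (P z) \<le> k * norm z"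
    using linear_bounded_pos[OF P] by blast
  define h where "h s = inv_into K g (f (x + s *\<^sub>R w))" for s :: real
  have line: "((\<lambda>s. x + s *\<^sub>R w) \<longlongrightarrow> x) (at_right (0::real))"
    by (auto intro!: tendsto_eq_intros)
  have inU: "\<forall>\<^sub>F s in at_right 0. x + s *\<^sub>R w \<in> U"
    using topological_tendstoD[OF line U] .
  have inv_y: "inv_into K g (f x) = y"
    using y K(3) by (metis inv_into_f_f)
  have inv_K: "continuous_on (g ` K) (inv_into K g)"
    by (rule continuous_on_inv[OF K(2,1)]) (simp add: K(3))
  have "continuous_on U (inv_into K g \<circ> f)"
    by (intro continuous_on_compose f(2) continuous_on_subset[OF _ K(4)] inv_K)
  then have "isCont (inv_into K g \<circ> f) x"
    using U continuous_on_eq_continuous_at by blast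
  from isCont_tendsto_compose[OF this line]
  have h: "(h \<longlongrightarrow> y) (at_right 0)"
    by (simp add: h_def[abs_def] inv_y)
  \<comment> \<open>At a small parameter \<open>s\<close> the increment of \<open>f\<close> is
    within order \<open>\<epsilon> * s\<close> both of \<open>s *\<^sub>R b\<close> and of a vector
    in \<open>range g'\<close>. The condition \<open>\<epsilon> * c \<le> 1/2\<close> lets the error
    of \<open>g\<close> be absorbed into \<open>norm u\<close>, which bounds \<open>u\<close> by a
    multiple of \<open>s\<close>.\<close>
  have bound: "norm (P b) \<le> \<epsilon> * (k * (2 * c * (norm b + norm w) + norm w))"
    if \<epsilon>: "\<epsilon> > 0" "\<epsilon> \<le> 1" "\<epsilon> * c \<le> 1/2" for \<epsilon>
  proof -
    obtain d where d: "d > 0" "\<And>z. norm (z - y) < d \<Longrightarrow> norm (g z - g y - g' (z - y)) \<le> \<epsilon> * norm (z - y)"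
      using g(1) \<epsilon> unfolding has_derivative_at_alt by blast
    obtain d' where d': "d' > 0" "\<And>z. norm (z - x) < d' \<Longrightarrow> norm (f z - f x - f' (z - x)) \<le> \<epsilon> * norm (z - x)"
      using f(1) \<epsilon> unfolding has_derivative_at_alt by blast
    have "\<forall>\<^sub>F s in at_right 0. x + s *\<^sub>R w \<in> U \<and> dist (h s) y < d \<and> dist (x + s *\<^sub>R w) x < d' \<and> 0 < s"
      by (intro eventually_conj inU tendstoD[OF h d(1)] tendstoD[OF line d'(1)] eventually_at_right_less)
    then obtain s where s: "x + s *\<^sub>R w \<in> U" "norm (h s - y) < d" "norm (s *\<^sub>R w) < d'" "0 < s"
      by (auto simp: dist_norm dest!: eventually_happens)
    define \<Delta> u where "\<Delta> = f (x + s *\<^sub>R w) - f x" and "u = h s - y"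
    have "g (h s) = f (x + s *\<^sub>R w)"
      unfolding h_def using s(1) K(4) by (intro f_inv_into_f) auto
    then have gu: "norm (\<Delta> - g' u) \<le> \<epsilon> * norm u"
      using d(2)[OF s(2)] y(2) by (simp add: \<Delta>_def u_def)
    have fs: "norm (\<Delta> - s *\<^sub>R b) \<le> \<epsilon> * (s * norm w)"
      using d'(2)[of "x + s *\<^sub>R w"] s lin(2) by (simp add: \<Delta>_def b_def linear_cmul)
    have "norm \<Delta> \<le> norm (s *\<^sub>R b) + norm (\<Delta> - s *\<^sub>R b)"
      by (metis add.commute diff_add_cancel norm_triangle_ineq)
    also have "\<dots> \<le> s * norm b + 1 * (s * norm w)"
    proof -
      have "\<epsilon> * (s * norm w) \<le> 1 * (s * norm w)"
        using \<epsilon> s(4) by (intro mult_right_mono) auto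
      moreover have "norm (s *\<^sub>R b) = s * norm b"
        using s(4) by simp
      ultimately show ?thesis
        using fs by linarith
    qed
    finally have \<Delta>: "norm \<Delta> \<le> s * (norm b + norm w)"
      by (simp add: algebra_simps)
    have "norm u \<le> c * norm (g' u)"
      using c(2)[of "g' u"] by (simp add: Lg)
    also have "norm (g' u) \<le> norm \<Delta> + norm (\<Delta> - g' u)"
      by (metis add_diff_cancel_left' diff_add_cancel norm_triangle_ineq4 norm_minus_commute)
    also have "c * (norm \<Delta> + norm (\<Delta> - g' u)) \<le> c * (norm \<Delta> + \<epsilon> * norm u)"
      using gu c(1) by simp
    also have "\<dots> \<le> c * norm \<Delta> + 1/2 * norm u"
      using mult_right_mono[OF \<epsilon>(3), of "norm u"] by (simp add: algebra_simps)
    finally have "norm u \<le> 2 * c * norm \<Delta>"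
      using c(1) by simp
    also have "\<dots> \<le> 2 * c * (s * (norm b + norm w))"
      using \<Delta> c(1) by simp
    finally have u: "norm u \<le> s * (2 * c * (norm b + norm w))"
      by (simp add: algebra_simps)
    \<comment> \<open>\<open>P\<close> annihilates \<open>g' u\<close>, so only the two
      linearization errors survive.\<close>
    have "s *\<^sub>R P b = P (\<Delta> - g' u) - P (\<Delta> - s *\<^sub>R b)"
      using P by (simp add: linear_diff Pg linear_cmul)
    then have "norm (s *\<^sub>R P b) \<le> norm (P (\<Delta> - g' u)) + norm (P (\<Delta> - s *\<^sub>R b))"
      by (metis norm_triangle_ineq4)
    also have "\<dots> \<le> k * norm (\<Delta> - g' u) + k * norm (\<Delta> - s *\<^sub>R b)"
      by (intro add_mono k)
    also have "\<dots> \<le> k * (\<epsilon> * (s * (2 * c * (norm b + norm w)))) + k * (\<epsilon> * (s * norm w))"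
    proof (intro add_mono mult_left_mono)
      show "norm (\<Delta> - g' u) \<le> \<epsilon> * (s * (2 * c * (norm b + norm w)))"
        using gu mult_left_mono[OF u, of \<epsilon>] \<epsilon>(1) by linarith
    qed (use fs k in auto)
    also have "\<dots> = s * (\<epsilon> * (k * (2 * c * (norm b + norm w) + norm w)))"
      by (simp add: algebra_simps)
    finally show ?thesis
      using s(4) by simp
  qed
  define M where "M = k * (2 * c * (norm b + norm w) + norm w)"
  have "norm (P b) \<le> 0"
  proof (rule tendsto_lowerbound)
    show "((\<lambda>\<epsilon>. \<epsilon> * M) \<longlongrightarrow> 0) (at_right 0)"
      by (auto intro!: tendsto_eq_intros)
    have "\<forall>\<^sub>F \<epsilon> in at_right 0. 0 < \<epsilon> \<and> \<epsilon> < min 1 (1 / (2 * c))"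
      using c(1) by (intro eventually_at_rightI[of 0 "min 1 (1 / (2 * c))"]) auto
    then show "\<forall>\<^sub>F \<epsilon> in at_right 0. norm (P b) \<le> \<epsilon> * M"
    proof eventually_elim
      case (elim \<epsilon>)
      then have "\<epsilon> * c \<le> 1/2"
        using c(1) by (simp add: field_simps)
      then show ?case
        using bound[of \<epsilon>] elim by (simp add: M_def)
    qed
  qed simp
  then have "b = g' (L b)"
    by (simp add: P_def)
  then show "f' w \<in> range g'"
    by (metis b_def rangeI)
qed

text \<open>The preimages under \<open>f\<close> of the countably many compact images are closed and
  cover a closed ball, so by Baire one of them contains an open set. There \<open>f\<close> takes
  its values in the image of a single piece, and \<open>tangent_inclusion\<close> applies.\<close>

lemma tangent_inclusion_dense:
  fixes f :: "'m::euclidean_space \<Rightarrow> 'e::euclidean_space"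
    and C :: "('k::euclidean_space set \<times> ('k \<Rightarrow> 'e)) set"
  assumes W: "open W" "\<And>x. x \<in> W \<Longrightarrow> f differentiable at x"
    and C: "countable C" "\<And>K g. (K, g) \<in> C \<Longrightarrow> compact K" "\<And>K g. (K, g) \<in> C \<Longrightarrow> inj_on g K"
      "\<And>K g y. (K, g) \<in> C \<Longrightarrow> y \<in> K \<Longrightarrow> g differentiable at y"
      "\<And>K g y. (K, g) \<in> C \<Longrightarrow> y \<in> K \<Longrightarrow> inj (frechet_derivative g (at y))"
    and cover: "f ` W \<subseteq> (\<Union>(K, g)\<in>C. g ` K)"
  shows "W \<subseteq> closure {x \<in> W. \<exists>(K, g)\<in>C. \<exists>y\<in>K. g y = f x \<and>
    range (frechet_derivative f (at x)) \<subseteq> range (frechet_derivative g (at y))}"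
proof
  fix x0 assume x0: "x0 \<in> W"
  have contf: "continuous_on W f"
    using W by (meson continuous_at_imp_continuous_on differentiable_imp_continuous_within)
  have contg: "continuous_on K g" if "(K, g) \<in> C" for K g
    using C(4)[OF that] by (meson continuous_at_imp_continuous_on differentiable_imp_continuous_within)
  have "\<exists>x \<in> W. dist x x0 < e \<and> (\<exists>(K, g)\<in>C. \<exists>y\<in>K. g y = f x \<and>
    range (frechet_derivative f (at x)) \<subseteq> range (frechet_derivative g (at y)))" if "e > 0" for e
  proof -
    obtain r0 where r0: "r0 > 0" "cball x0 r0 \<subseteq> W"
      using W(1) x0 open_contains_cball by blast
    define r where "r = min r0 (e/2)"
    define S where "S = cball x0 r"
    have r: "r > 0" "S \<subseteq> W" "r < e"
      using r0 \<open>e > 0\<close> by (auto simp: r_def S_def)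
    define A where "A p = {x \<in> S. f x \<in> snd p ` fst p}" for p :: "'k set \<times> ('k \<Rightarrow> 'e)"
    have "closed (A p)" if "p \<in> C" for p
    proof -
      have "compact (snd p ` fst p)"
        using that C(2) contg by (cases p) (auto intro!: compact_continuous_image)
      then have "closed (S \<inter> f -` (snd p ` fst p))"
        by (intro continuous_closed_preimage continuous_on_subset[OF contf r(2)] compact_imp_closed)
         (auto simp: S_def)
      then show ?thesis
        by (simp add: A_def Collect_conj_eq vimage_def)
    qed
    note closedA = this
    have "\<exists>p\<in>C. \<exists>U. open U \<and> U \<noteq> {} \<and> U \<subseteq> ball x0 r \<and> U \<subseteq> A p"
    proof (rule ccontr)
      assume no: "\<not> ?thesis"
      \<comment> \<open>If no preimage had interior, the complements would be open and dense in the
        ball, and a point common to all of them would be mapped outside the cover.\<close>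
      define G where "G = (\<lambda>p. S - A p) ` C"
      have "S \<subseteq> closure (\<Inter>G)"
      proof (rule Baire)
        fix T assume "T \<in> G"
        then obtain p where p: "p \<in> C" "T = S - A p"
          by (auto simp: G_def)
        have "openin (top_of_set S) T"
          using closedA[OF p(1)] p(2) by (simp add: openin_diff closed_subset A_def)
        moreover have "x \<in> closure T" if "x \<in> S" for x
        proof (rule ccontr)
          assume "x \<notin> closure T"
          define V where "V = - closure T"
          have V: "open V" "x \<in> V" "V \<inter> T = {}"
            using \<open>x \<notin> closure T\<close> closure_subset[of T] by (auto simp: V_def)
          \<comment> \<open>The closed ball is the closure of the open one, so \<open>V\<close>
            meets the open ball even when \<open>x\<close> lies on the sphere.\<close>
          have "x \<in> closure (ball x0 r)"
            using that r by (simp add: S_def)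
          then have "V \<inter> ball x0 r \<noteq> {}"
            using V by (meson closure_iff_nhds_not_empty disjoint_iff Int_commute order_refl)
          moreover have "V \<inter> ball x0 r \<subseteq> A p"
            using V(3) p(2) by (auto simp: S_def)
          ultimately show False
            using no p(1) V(1) by (meson inf_le2 open_Int open_ball)
        qed
        ultimately show "openin (top_of_set S) T \<and> S \<subseteq> closure T"
          by blast
      qed (use C(1) in \<open>auto simp: S_def G_def\<close>)
      moreover have "x0 \<in> S"
        using r by (simp add: S_def)
      ultimately have "\<Inter>G \<noteq> {}"
        by (metis closure_empty empty_iff subsetD)
      then obtain x where "x \<in> \<Inter>G"
        by blast
      then have x: "x \<in> S - A p" if "p \<in> C" for p
        using that unfolding G_def by blast
      obtain p0 where p0: "p0 \<in> C"
        using cover x0 by auto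
      have "x \<in> S" "x \<in> W"
        using x[OF p0] r by auto
      then show False
        using x cover by (force simp: A_def)
    qed
    then obtain K g U where K: "(K, g) \<in> C" and U: "open U" "U \<noteq> {}" "U \<subseteq> ball x0 r" "U \<subseteq> A (K, g)"
      by auto
    then obtain x where x: "x \<in> U" by blast
    have "f x \<in> g ` K"
      using x U(4) by (auto simp: A_def)
    then obtain y where y: "y \<in> K" "g y = f x"
      by auto
    have UW: "U \<subseteq> W"
      using U(4) r by (auto simp: A_def)
    have "range (frechet_derivative f (at x)) \<subseteq> range (frechet_derivative g (at y))"
    proof (rule tangent_inclusion[OF U(1) x])
      show "(f has_derivative frechet_derivative f (at x)) (at x)"
        using W(2) UW x frechet_derivative_works by blast
      show "(g has_derivative frechet_derivative g (at y)) (at y)"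
        using C(4)[OF K y(1)] frechet_derivative_works by blast
      show "f ` U \<subseteq> g ` K"
        using U(4) by (auto simp: A_def)
    qed (use K y C contg continuous_on_subset[OF contf UW] in auto)
    moreover have "x \<in> W" "dist x x0 < e"
      using x UW U(3) r(3) by (auto simp: dist_commute)
    ultimately show ?thesis
      using K y by blast
  qed
  then show "x0 \<in> closure {x \<in> W. \<exists>(K, g)\<in>C. \<exists>y\<in>K. g y = f x \<and>
    range (frechet_derivative f (at x)) \<subseteq> range (frechet_derivative g (at y))}"
    unfolding closure_approachable by blast
qed


section \<open>Manifolds and their charts\<close>

lemma C2_map_euclidean_iff:
  "C2_map M (euclidean_mfd :: ('e::euclidean_space, 'e) mfd) f \<longleftrightarrow>
     continuous_map (topol M) euclidean f \<and> (\<forall>(W, \<psi>)\<in>atlas M. C2_on W (f \<circ> \<psi>))"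
proof -
  have "inv_into UNIV (\<lambda>x::'e. x) = (\<lambda>x. x)"
    by (auto simp: inv_into_def)
  then show ?thesis
    by (auto simp: C2_map_def euclidean_mfd_def comp_def)
qed

lemma immersion_euclidean_iff:
  "immersion M (euclidean_mfd :: ('e::euclidean_space, 'e) mfd) f \<longleftrightarrow>
     C2_map M (euclidean_mfd :: ('e, 'e) mfd) f \<and> (\<forall>(W, \<psi>)\<in>atlas M. \<forall>x\<in>W.
        inj_on (frechet_derivative (f \<circ> \<psi>) (at x within model M)) (model M))"
proof -
  have "inv_into UNIV (\<lambda>x::'e. x) = (\<lambda>x. x)"
    by (auto simp: inv_into_def)
  then show ?thesis
    by (auto simp: immersion_def euclidean_mfd_def comp_def)
qed

text \<open>A model of full dimension turns derivatives within the model into derivatives at a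
  point. \<open>S\<close> and \<open>\<Gamma>\<close> are treated this way; the leaves of the
  orthogonal distribution are not.\<close>

locale full_manifold =
  fixes M :: "('p, 'm::euclidean_space) mfd"
  assumes C2_manifold: "C2_manifold M" and model: "model M = UNIV"
begin

lemma chart_open: "(W, \<psi>) \<in> atlas M \<Longrightarrow> open W"
  using C2_manifold model by (auto simp: C2_manifold_def)

lemma chart_image_openin: "(W, \<psi>) \<in> atlas M \<Longrightarrow> openin (topol M) (\<psi> ` W)"
  using C2_manifold by (auto simp: C2_manifold_def)

lemma chart_homeomorphic:
  "(W, \<psi>) \<in> atlas M \<Longrightarrow> homeomorphic_map (top_of_set W) (subtopology (topol M) (\<psi> ` W)) \<psi>"
  using C2_manifold by (auto simp: C2_manifold_def)

lemma chart_transition: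
  assumes "(W, \<psi>) \<in> atlas M" "(W', \<phi>) \<in> atlas M"
  shows "C2_on (W \<inter> \<psi> -` (\<phi> ` W')) (inv_into W' \<phi> \<circ> \<psi>)"
proof -
  have "\<forall>(W, \<psi>)\<in>atlas M. \<forall>(W', \<phi>)\<in>atlas M. C2_on (W \<inter> \<psi> -` (\<phi> ` W')) (inv_into W' \<phi> \<circ> \<psi>)"
    using C2_manifold unfolding C2_manifold_def by (elim conjE)
  from bspec[OF bspec[OF this assms(1), unfolded case_prod_conv] assms(2)] show ?thesis
    by simp
qed

lemma chart_inj_on: "(W, \<psi>) \<in> atlas M \<Longrightarrow> inj_on \<psi> W"
  using homeomorphic_imp_injective_map[OF chart_homeomorphic] by simp

lemma chart_carrier: "(W, \<psi>) \<in> atlas M \<Longrightarrow> x \<in> W \<Longrightarrow> \<psi> x \<in> carrier M"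
  using openin_subset[OF chart_image_openin] by (auto simp: carrier_def)

lemma chart_at:
  assumes "p \<in> carrier M"
  obtains W \<psi> x where "(W, \<psi>) \<in> atlas M" "x \<in> W" "\<psi> x = p"
proof -
  have "p \<in> (\<Union>(W, \<psi>)\<in>atlas M. \<psi> ` W)"
    using C2_manifold assms by (simp add: C2_manifold_def)
  then show thesis
    using that by blast
qed

lemma chart_openin_image:
  assumes "(W, \<psi>) \<in> atlas M" "open V" "V \<subseteq> W"
  shows "openin (topol M) (\<psi> ` V)"
proof -
  have "openin (top_of_set W) V"
    using assms by (simp add: open_subset)
  then have "openin (subtopology (topol M) (\<psi> ` W)) (\<psi> ` V)"
    using homeomorphic_imp_open_map[OF chart_homeomorphic[OF assms(1)]] by (auto simp: open_map_def)
  then show ?thesis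
    using chart_image_openin[OF assms(1)] openin_open_subtopology by blast
qed

lemma chart_continuous_map:
  assumes "(W, \<psi>) \<in> atlas M"
  shows "continuous_map (top_of_set W) (topol M) \<psi>"
  using homeomorphic_imp_continuous_map[OF chart_homeomorphic[OF assms]]
    continuous_map_into_fulltopology by blast

lemma chart_open_vimage:
  assumes "(W, \<psi>) \<in> atlas M" "openin (topol M) U"
  shows "open (W \<inter> \<psi> -` U)"
proof -
  have "openin (top_of_set W) {x \<in> topspace (top_of_set W). \<psi> x \<in> U}"
    using openin_continuous_map_preimage[OF chart_continuous_map[OF assms(1)] assms(2)] .
  moreover have "{x \<in> topspace (top_of_set W). \<psi> x \<in> U} = W \<inter> \<psi> -` U"
    by auto
  ultimately show ?thesis
    using chart_open[OF assms(1)] openin_open_trans by metis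
qed

text \<open>Each point has a closed ball in a chart on which \<open>f\<close> is injective; the
  images of the open balls are open and cover, and second countability gives a countable subcover by
  the Lindelof property. Compactness and injectivity are what the comparison of tangent spaces asks
  for.\<close>

lemma countable_chart_cover:
  fixes f :: "'p \<Rightarrow> 'e::euclidean_space"
  assumes f: "\<And>W \<psi>. (W, \<psi>) \<in> atlas M \<Longrightarrow> C2_on W (f \<circ> \<psi>)"
    and inj: "\<And>W \<psi> x. (W, \<psi>) \<in> atlas M \<Longrightarrow> x \<in> W \<Longrightarrow> inj (frechet_derivative (f \<circ> \<psi>) (at x))"
  obtains C where "countable C" "carrier M = (\<Union>(K, \<psi>)\<in>C. \<psi> ` K)"
    "\<And>K \<psi>. (K, \<psi>) \<in> C \<Longrightarrow> compact K \<and> inj_on (f \<circ> \<psi>) K \<and> (\<exists>W. (W, \<psi>) \<in> atlas M \<and> K \<subseteq> W)"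
proof -
  define good where "good = {(K, \<psi>). compact K \<and> inj_on (f \<circ> \<psi>) K \<and> (\<exists>W. (W, \<psi>) \<in> atlas M \<and> K \<subseteq> W)}"
  define \<U> where "\<U> = {\<psi> ` interior K | K \<psi>. (K, \<psi>) \<in> good}"
  have "Lindelof_space (topol M)"
    using C2_manifold by (auto simp: C2_manifold_def intro: second_countable_imp_Lindelof_space)
  moreover have "openin (topol M) U" if "U \<in> \<U>" for U
    using that chart_openin_image interior_subset[THEN order_trans] unfolding \<U>_def good_def
    by fastforce
  moreover have "\<Union>\<U> = topspace (topol M)"
  proof
    show "\<Union>\<U> \<subseteq> topspace (topol M)"
      using calculation(2) openin_subset by blast
    show "topspace (topol M) \<subseteq> \<Union>\<U>"
    proof
      fix p assume "p \<in> topspace (topol M)"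
      then obtain W \<psi> x where x: "(W, \<psi>) \<in> atlas M" "x \<in> W" "\<psi> x = p"
        using chart_at unfolding carrier_def by metis
      obtain r where r: "r > 0" "cball x r \<subseteq> W" "inj_on (f \<circ> \<psi>) (cball x r)"
        using C1_immersion_locally_injective[OF chart_open[OF x(1)] C2_on_imp_C1_on[OF f[OF x(1)]] x(2) inj[OF x(1,2)]]
        by blast
      have "(cball x r, \<psi>) \<in> good" "x \<in> interior (cball x r)"
        using r x(1) by (auto simp: good_def interior_cball)
      then show "p \<in> \<Union>\<U>"
        using x(3) unfolding \<U>_def by blast
    qed
  qed
  ultimately obtain \<V> where \<V>: "countable \<V>" "\<V> \<subseteq> \<U>" "\<Union>\<V> = topspace (topol M)"
    by (metis Lindelof_spaceD)
  have "\<forall>U\<in>\<V>. \<exists>c. c \<in> good \<and> U \<subseteq> snd c ` fst c"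
  proof
    fix U assume "U \<in> \<V>"
    then obtain K \<psi> where "U = \<psi> ` interior K" "(K, \<psi>) \<in> good"
      using \<V>(2) unfolding \<U>_def by blast
    then show "\<exists>c. c \<in> good \<and> U \<subseteq> snd c ` fst c"
      using interior_subset[of K] by (intro exI[of _ "(K, \<psi>)"]) auto
  qed
  then obtain c where c: "\<And>U. U \<in> \<V> \<Longrightarrow> c U \<in> good \<and> U \<subseteq> snd (c U) ` fst (c U)"
    by metis
  show thesis
  proof (rule that)
    show "countable (c ` \<V>)"
      using \<V>(1) by simp
    have sub: "snd (c U) ` fst (c U) \<subseteq> carrier M" if "U \<in> \<V>" for U
      using c[OF that] chart_carrier by (force simp: good_def)
    show "carrier M = (\<Union>(K, \<psi>)\<in>c ` \<V>. \<psi> ` K)"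
    proof
      show "carrier M \<subseteq> (\<Union>(K, \<psi>)\<in>c ` \<V>. \<psi> ` K)"
        using \<V>(3) c by (force simp: carrier_def case_prod_beta)
      show "(\<Union>(K, \<psi>)\<in>c ` \<V>. \<psi> ` K) \<subseteq> carrier M"
        unfolding case_prod_beta by (rule UN_least) (use sub in blast)
    qed
    fix K \<psi> assume "(K, \<psi>) \<in> c ` \<V>"
    then have "(K, \<psi>) \<in> good"
      using c by (metis imageE)
    then show "compact K \<and> inj_on (f \<circ> \<psi>) K \<and> (\<exists>W. (W, \<psi>) \<in> atlas M \<and> K \<subseteq> W)"
      by (simp add: good_def)
  qed
qed

end

lemma eq_on_if_eq_on_dense:
  fixes f g :: "'a::metric_space \<Rightarrow> 'b::t2_space"
  assumes "continuous_on W f" "continuous_on W g" "D \<subseteq> W" "W \<subseteq> closure D"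
    and "\<And>x. x \<in> D \<Longrightarrow> f x = g x" "x \<in> W"
  shows "f x = g x"
proof -
  obtain s where s: "\<And>n. s n \<in> D" "s \<longlonglongrightarrow> x"
    using assms(4,6) closure_sequential by blast
  then have "(\<lambda>n. f (s n)) \<longlonglongrightarrow> f x" "(\<lambda>n. g (s n)) \<longlonglongrightarrow> g x"
    using assms(1-3,6) by (auto simp: continuous_on_sequentially comp_def subset_iff)
  then show ?thesis
    using s(1) assms(5) by (auto intro: LIMSEQ_unique)
qed

text \<open>The two manifolds are only related through the images of the immersions, so the inclusion
  need not lift to a differentiable, or even continuous, map between them; but the tangent spaces
  of the images agree on a dense set.\<close>

lemma bilinear_zero_on_immersed_image:
  fixes M :: "('p, 'm::euclidean_space) mfd" and N :: "('q, 'k::euclidean_space) mfd"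
    and f :: "'p \<Rightarrow> 'e::euclidean_space" and g :: "'q \<Rightarrow> 'e"
    and \<omega> :: "'e \<Rightarrow> 'e \<Rightarrow> real"
  assumes M: "full_manifold M" and N: "full_manifold N"
    and f: "\<And>W \<psi>. (W, \<psi>) \<in> atlas M \<Longrightarrow> C2_on W (f \<circ> \<psi>)"
    and g: "\<And>W \<phi>. (W, \<phi>) \<in> atlas N \<Longrightarrow> C2_on W (g \<circ> \<phi>)"
      "\<And>W \<phi> y. (W, \<phi>) \<in> atlas N \<Longrightarrow> y \<in> W \<Longrightarrow> inj (frechet_derivative (g \<circ> \<phi>) (at y))"
    and sub: "f ` carrier M \<subseteq> g ` carrier N"
    and \<omega>: "bounded_bilinear \<omega>"
    and zero: "\<And>W \<phi> y w w'. (W, \<phi>) \<in> atlas N \<Longrightarrow> y \<in> W \<Longrightarrow>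
      \<omega> (frechet_derivative (g \<circ> \<phi>) (at y) w) (frechet_derivative (g \<circ> \<phi>) (at y) w') = 0"
    and x: "(W, \<psi>) \<in> atlas M" "x \<in> W"
  shows "\<omega> (frechet_derivative (f \<circ> \<psi>) (at x) w) (frechet_derivative (f \<circ> \<psi>) (at x) w') = 0"
proof -
  interpret M: full_manifold M by fact
  interpret N: full_manifold N by fact
  let ?D = "\<lambda>x. frechet_derivative (f \<circ> \<psi>) (at x)"
  obtain C where C: "countable C" "carrier N = (\<Union>(K, \<phi>)\<in>C. \<phi> ` K)"
    "\<And>K \<phi>. (K, \<phi>) \<in> C \<Longrightarrow> compact K \<and> inj_on (g \<circ> \<phi>) K \<and> (\<exists>W. (W, \<phi>) \<in> atlas N \<and> K \<subseteq> W)"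
    by (rule N.countable_chart_cover[of g], erule g(1), erule (1) g(2)) (rule that)
  have W: "open W"
    using M.chart_open x(1) .
  have diff: "(f \<circ> \<psi>) differentiable at x" if "x \<in> W" for x
    using C2_on_frechet[OF W f[OF x(1)] that] by (auto simp: differentiable_def)
  define C' where "C' = (\<lambda>(K, \<phi>). (K, g \<circ> \<phi>)) ` C"
  have C': "\<exists>\<phi> W. h = g \<circ> \<phi> \<and> (W, \<phi>) \<in> atlas N \<and> K \<subseteq> W \<and> compact K \<and> inj_on h K"
    if Kh: "(K, h) \<in> C'" for K h
  proof -
    obtain \<phi> where "(K, \<phi>) \<in> C" "h = g \<circ> \<phi>"
      using Kh by (auto simp: C'_def)
    then show ?thesis
      using C(3) by blast
  qed
  define Z where "Z = {x \<in> W. \<exists>(K, h)\<in>C'. \<exists>y\<in>K. h y = (f \<circ> \<psi>) x \<and>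
      range (?D x) \<subseteq> range (frechet_derivative h (at y))}"
  have dense: "W \<subseteq> closure Z"
    unfolding Z_def
  proof (rule tangent_inclusion_dense[OF W diff])
    show "countable C'"
      using C(1) by (simp add: C'_def)
    show "(f \<circ> \<psi>) ` W \<subseteq> (\<Union>(K, h)\<in>C'. h ` K)"
    proof clarify
      fix x assume "x \<in> W"
      then have "f (\<psi> x) \<in> g ` carrier N"
        using sub M.chart_carrier[OF x(1)] by blast
      then obtain K \<phi> y where y: "(K, \<phi>) \<in> C" "y \<in> K" "f (\<psi> x) = g (\<phi> y)"
        using C(2) by auto
      then have "(K, g \<circ> \<phi>) \<in> C'"
        unfolding C'_def by (metis (no_types, lifting) case_prod_conv image_eqI)
      then show "(f \<circ> \<psi>) x \<in> (\<Union>(K, h)\<in>C'. h ` K)"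
        by (rule UN_I) (use y(2,3) in auto)
    qed
    fix K h assume Kh: "(K, h) \<in> C'"
    then show "compact K" "inj_on h K"
      using C' by blast+
    fix y assume y: "y \<in> K"
    obtain \<phi> V where \<phi>: "h = g \<circ> \<phi>" "(V, \<phi>) \<in> atlas N" "y \<in> V"
      using C'[OF Kh] y by blast
    show "inj (frechet_derivative h (at y))"
      using g(2) \<phi> by blast
    show "h differentiable at y"
      using C2_on_frechet[OF N.chart_open[OF \<phi>(2)] g(1)[OF \<phi>(2)] \<phi>(3)] \<phi>(1) by (auto simp: differentiable_def)
  qed auto
  have zero_Z: "\<omega> (?D x w) (?D x w') = 0" if xZ: "x \<in> Z" for x
  proof -
    obtain K h y where Kh: "(K, h) \<in> C'" "y \<in> K" "range (?D x) \<subseteq> range (frechet_derivative h (at y))"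
      using xZ unfolding Z_def by blast
    obtain \<phi> V where \<phi>: "h = g \<circ> \<phi>" "(V, \<phi>) \<in> atlas N" "y \<in> V"
      using C'[OF Kh(1)] Kh(2) by blast
    obtain u u' where "?D x w = frechet_derivative h (at y) u" "?D x w' = frechet_derivative h (at y) u'"
      using Kh(3) by blast
    then show ?thesis
      using zero[OF \<phi>(2,3)] \<phi>(1) by simp
  qed
  \<comment> \<open>The value of \<open>\<omega>\<close> depends continuously on the point, so its
    vanishing passes from the dense set \<open>Z\<close> to \<open>W\<close>.\<close>
  have cont: "continuous_on W (\<lambda>x. Blinfun (?D x))"
    using C2_on_open[OF W f[OF x(1)]] by (rule C1_on_imp_continuous_on)
  have "blinfun_apply (Blinfun (?D x)) = ?D x" if "x \<in> W" for x
    using C2_on_frechet[OF W f[OF x(1)] that]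
    by (simp add: bounded_linear_Blinfun_apply has_derivative_bounded_linear)
  then have "continuous_on W (\<lambda>x. ?D x u)" for u
    using blinfun.continuous_on[OF cont continuous_on_const[of W u]] by (simp cong: continuous_on_cong)
  then have "continuous_on W (\<lambda>x. \<omega> (?D x w) (?D x w'))"
    by (intro bounded_bilinear.continuous_on[OF \<omega>])
  from eq_on_if_eq_on_dense[OF this continuous_on_const[of W 0] _ dense zero_Z x(2)]
  show ?thesis
    by (auto simp: Z_def)
qed


section \<open>Submanifolds of a Euclidean space\<close>

locale euclidean_submanifold =
  fixes M :: "('e::euclidean_space, 'm::euclidean_space) mfd"
  assumes immersed: "immersed_submanifold M (euclidean_mfd :: ('e, 'e) mfd)"
    and model_UNIV: "model M = UNIV"
begin

sublocale full_manifold M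
  using immersed model_UNIV by unfold_locales (auto simp: immersed_submanifold_def)

lemma chart_C2: "(W, \<psi>) \<in> atlas M \<Longrightarrow> C2_on W \<psi>"
  using immersed by (auto simp: immersed_submanifold_def immersion_euclidean_iff C2_map_euclidean_iff comp_def)

lemma chart_has_derivative:
  "(W, \<psi>) \<in> atlas M \<Longrightarrow> x \<in> W \<Longrightarrow> (\<psi> has_derivative frechet_derivative \<psi> (at x)) (at x)"
  by (rule C2_on_frechet[OF chart_open chart_C2])

lemma chart_derivative_inj: "(W, \<psi>) \<in> atlas M \<Longrightarrow> x \<in> W \<Longrightarrow> inj (frechet_derivative \<psi> (at x))"
  using immersed model by (auto simp: immersed_submanifold_def immersion_euclidean_iff comp_def)

text \<open>Chain rule for \<open>\<psi>\<close> written as \<open>\<phi>\<close> after the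
  transition map. It is the source of the chart independence of \<open>tangent_space\<close> and
  \<open>deriv_along\<close>.\<close>

lemma transition_derivative:
  assumes "(W, \<psi>) \<in> atlas M" "(W', \<phi>) \<in> atlas M" "x \<in> W" "x' \<in> W'" "\<psi> x = \<phi> x'"
  obtains T where "((inv_into W' \<phi> \<circ> \<psi>) has_derivative T) (at x)"
    "\<And>w. frechet_derivative \<psi> (at x) w = frechet_derivative \<phi> (at x') (T w)"
proof -
  let ?V = "W \<inter> \<psi> -` (\<phi> ` W')" and ?\<tau> = "inv_into W' \<phi> \<circ> \<psi>"
  have V: "open ?V" "x \<in> ?V"
    using chart_open_vimage[OF assms(1) chart_image_openin[OF assms(2)]] assms by auto
  have \<tau>: "(?\<tau> has_derivative frechet_derivative ?\<tau> (at x)) (at x)"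
    using C2_on_frechet[OF V(1) chart_transition[OF assms(1,2)] V(2)] .
  have \<tau>x: "?\<tau> x = x'"
    using assms chart_inj_on[OF assms(2)] by simp
  have "((\<phi> \<circ> ?\<tau>) has_derivative (frechet_derivative \<phi> (at x') \<circ> frechet_derivative ?\<tau> (at x))) (at x)"
    using diff_chain_at[OF \<tau>] chart_has_derivative[OF assms(2,4)] \<tau>x by simp
  moreover have "(\<phi> \<circ> ?\<tau>) y = \<psi> y" if "y \<in> ?V" for y
    using that by (simp add: f_inv_into_f)
  ultimately have "(\<psi> has_derivative (frechet_derivative \<phi> (at x') \<circ> frechet_derivative ?\<tau> (at x))) (at x)"
    using has_derivative_transform_within_open[OF _ V] by blast
  then have "frechet_derivative \<psi> (at x) = frechet_derivative \<phi> (at x') \<circ> frechet_derivative ?\<tau> (at x)"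
    by (rule frechet_derivative_at[symmetric])
  then show thesis
    using that[OF \<tau>] by simp
qed

lemma tangent_space_chart:
  assumes "(W, \<psi>) \<in> atlas M" "x \<in> W"
  shows "tangent_space M (\<psi> x) = range (frechet_derivative \<psi> (at x))"
proof
  show "range (frechet_derivative \<psi> (at x)) \<subseteq> tangent_space M (\<psi> x)"
    using assms unfolding tangent_space_def model by blast
  show "tangent_space M (\<psi> x) \<subseteq> range (frechet_derivative \<psi> (at x))"
  proof
    fix X assume "X \<in> tangent_space M (\<psi> x)"
    then obtain W' \<phi> x' w where *: "(W', \<phi>) \<in> atlas M" "x' \<in> W'" "\<phi> x' = \<psi> x"
      "X = frechet_derivative \<phi> (at x') w"
      unfolding tangent_space_def model by auto
    then show "X \<in> range (frechet_derivative \<psi> (at x))"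
      using transition_derivative[OF *(1) assms(1) *(2) assms(2) *(3)] by (metis rangeI)
  qed
qed

text \<open>Representatives of one tangent vector in different charts correspond under the
  transition derivative because chart derivatives are injective; hence the description in
  \<open>deriv_along\<close> singles out one value.\<close>

lemma deriv_along_chart:
  assumes "(W, \<psi>) \<in> atlas M" "x \<in> W" "((h \<circ> \<psi>) has_derivative H) (at x)"
  shows "deriv_along M h (\<psi> x) (frechet_derivative \<psi> (at x) w) = H w"
  unfolding deriv_along_def model
proof (rule the_equality)
  show "\<exists>W' \<phi> x' w'. (W', \<phi>) \<in> atlas M \<and> x' \<in> W' \<and> \<phi> x' = \<psi> x \<and> w' \<in> UNIV \<and>
      frechet_derivative \<phi> (at x') w' = frechet_derivative \<psi> (at x) w \<and>
      H w = frechet_derivative (h \<circ> \<phi>) (at x') w'"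
    using assms frechet_derivative_at[OF assms(3)] by (metis UNIV_I)
next
  fix d assume "\<exists>W' \<phi> x' w'. (W', \<phi>) \<in> atlas M \<and> x' \<in> W' \<and> \<phi> x' = \<psi> x \<and> w' \<in> UNIV \<and>
      frechet_derivative \<phi> (at x') w' = frechet_derivative \<psi> (at x) w \<and>
      d = frechet_derivative (h \<circ> \<phi>) (at x') w'"
  then obtain W' \<phi> x' w' where *: "(W', \<phi>) \<in> atlas M" "x' \<in> W'" "\<phi> x' = \<psi> x"
    and w': "frechet_derivative \<phi> (at x') w' = frechet_derivative \<psi> (at x) w"
      "d = frechet_derivative (h \<circ> \<phi>) (at x') w'"
    by blast
  let ?\<tau> = "inv_into W \<psi> \<circ> \<phi>"
  obtain T where T: "(?\<tau> has_derivative T) (at x')"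
    "\<And>w. frechet_derivative \<phi> (at x') w = frechet_derivative \<psi> (at x) (T w)"
    using transition_derivative[OF *(1) assms(1) *(2) assms(2) *(3)] by blast
  have "T w' = w"
    using w'(1) T(2) chart_derivative_inj[OF assms(1,2)] by (metis injD)
  have "?\<tau> x' = x"
    using *(3) chart_inj_on[OF assms(1)] assms(2) by simp
  then have "((h \<circ> \<psi> \<circ> ?\<tau>) has_derivative (H \<circ> T)) (at x')"
    using diff_chain_at[OF T(1)] assms(3) by metis
  moreover have "open (W' \<inter> \<phi> -` (\<psi> ` W))" "x' \<in> W' \<inter> \<phi> -` (\<psi> ` W)"
    using chart_open_vimage[OF *(1) chart_image_openin[OF assms(1)]] *(2,3) assms(2) by auto
  moreover have "(h \<circ> \<psi> \<circ> ?\<tau>) y = (h \<circ> \<phi>) y" if "y \<in> W' \<inter> \<phi> -` (\<psi> ` W)" for y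
    using that by (simp add: f_inv_into_f)
  ultimately have "((h \<circ> \<phi>) has_derivative (H \<circ> T)) (at x')"
    using has_derivative_transform_within_open by blast
  then have "frechet_derivative (h \<circ> \<phi>) (at x') = H \<circ> T"
    by (rule frechet_derivative_at[symmetric])
  then show "d = H w"
    using w'(2) \<open>T w' = w\<close> by simp
qed

end


section \<open>Unit vector fields and the congruence of lines they span\<close>

locale unit_field = euclidean_submanifold S
  for S :: "('a::euclidean_space, 'm::euclidean_space) mfd" +
  fixes v :: "'a \<Rightarrow> 'a"
  assumes v_C2_map: "C2_map S (euclidean_mfd :: ('a, 'a) mfd) v"
    and v_tangent_field: "tangent_field S v"
    and v_norm: "\<And>p. p \<in> carrier S \<Longrightarrow> norm (v p) = 1"
begin

abbreviation (input) D :: "('m \<Rightarrow> 'b::real_normed_vector) \<Rightarrow> 'm \<Rightarrow> 'm \<Rightarrow> 'b" where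
  "D f x \<equiv> frechet_derivative f (at x)"

lemma v_chart_C2: "(W, \<psi>) \<in> atlas S \<Longrightarrow> C2_on W (v \<circ> \<psi>)"
  using v_C2_map by (auto simp: C2_map_euclidean_iff)

lemma v_chart_has_derivative:
  "(W, \<psi>) \<in> atlas S \<Longrightarrow> x \<in> W \<Longrightarrow> ((v \<circ> \<psi>) has_derivative D (v \<circ> \<psi>) x) (at x)"
  by (rule C2_on_frechet[OF chart_open v_chart_C2])

lemma v_inner_self: "p \<in> carrier S \<Longrightarrow> v p \<bullet> v p = 1"
  using v_norm[of p] by (simp add: dot_square_norm)

text \<open>Differentiate the constant \<open>v \<bullet> v\<close>.\<close>

lemma v_chart_derivative_orth:
  assumes "(W, \<psi>) \<in> atlas S" "x \<in> W"
  shows "v (\<psi> x) \<bullet> D (v \<circ> \<psi>) x w = 0"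
proof -
  have 1: "((\<lambda>y. (v \<circ> \<psi>) y \<bullet> (v \<circ> \<psi>) y) has_derivative
      (\<lambda>w. (v \<circ> \<psi>) x \<bullet> D (v \<circ> \<psi>) x w + D (v \<circ> \<psi>) x w \<bullet> (v \<circ> \<psi>) x)) (at x)"
    by (intro has_derivative_inner v_chart_has_derivative[OF assms])
  have 2: "(v \<circ> \<psi>) y \<bullet> (v \<circ> \<psi>) y = 1" if "y \<in> W" for y
    using v_inner_self[OF chart_carrier[OF assms(1) that]] by simp
  have "((\<lambda>y. 1) has_derivative
      (\<lambda>w. (v \<circ> \<psi>) x \<bullet> D (v \<circ> \<psi>) x w + D (v \<circ> \<psi>) x w \<bullet> (v \<circ> \<psi>) x)) (at x)"
    by (rule has_derivative_transform_within_open[OF 1 chart_open[OF assms(1)] assms(2)]) (rule 2)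
  then have "(\<lambda>w. (v \<circ> \<psi>) x \<bullet> D (v \<circ> \<psi>) x w + D (v \<circ> \<psi>) x w \<bullet> (v \<circ> \<psi>) x) = (\<lambda>w. 0)"
    using has_derivative_const has_derivative_unique by blast
  then show ?thesis
    by (auto simp: inner_commute dest: fun_cong[of _ _ w])
qed

lemma v_chart_preimage:
  assumes "(W, \<psi>) \<in> atlas S" "x \<in> W"
  obtains w where "D \<psi> x w = v (\<psi> x)"
proof -
  have "v (\<psi> x) \<in> tangent_space S (\<psi> x)"
    using v_tangent_field chart_carrier[OF assms] by (simp add: tangent_field_def)
  then show thesis
    using that by (auto simp: tangent_space_chart[OF assms])
qed

text \<open>The one-form dual to \<^term>\<open>v\<close> is closed, expressed in charts; the second derivatives of the
  charts do not appear because they are symmetric.\<close>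

definition curl_free :: bool where
  "curl_free \<longleftrightarrow> (\<forall>(W, \<psi>)\<in>atlas S. \<forall>x\<in>W. \<forall>w w'.
     D (v \<circ> \<psi>) x w \<bullet> D \<psi> x w' = D (v \<circ> \<psi>) x w' \<bullet> D \<psi> x w)"

lemma curl_freeD:
  "curl_free \<Longrightarrow> (W, \<psi>) \<in> atlas S \<Longrightarrow> x \<in> W \<Longrightarrow> D (v \<circ> \<psi>) x w \<bullet> D \<psi> x w' = D (v \<circ> \<psi>) x w' \<bullet> D \<psi> x w"
  unfolding curl_free_def by blast


subsection \<open>The symplectic form on the space of lines\<close>

lemma Phi_chart_derivative:
  assumes "(W, \<psi>) \<in> atlas S" "x \<in> W"
  shows "D (Phi v \<circ> \<psi>) x = (\<lambda>w. (D (v \<circ> \<psi>) x w,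
    D \<psi> x w - ((v (\<psi> x) \<bullet> \<psi> x) *\<^sub>R D (v \<circ> \<psi>) x w +
      (v (\<psi> x) \<bullet> D \<psi> x w + D (v \<circ> \<psi>) x w \<bullet> \<psi> x) *\<^sub>R v (\<psi> x))))"
proof -
  have "((\<lambda>y. ((v \<circ> \<psi>) y, \<psi> y - ((v \<circ> \<psi>) y \<bullet> \<psi> y) *\<^sub>R (v \<circ> \<psi>) y)) has_derivative
    (\<lambda>w. (D (v \<circ> \<psi>) x w, D \<psi> x w - (((v \<circ> \<psi>) x \<bullet> \<psi> x) *\<^sub>R D (v \<circ> \<psi>) x w +
      ((v \<circ> \<psi>) x \<bullet> D \<psi> x w + D (v \<circ> \<psi>) x w \<bullet> \<psi> x) *\<^sub>R (v \<circ> \<psi>) x)))) (at x)"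
    by (intro has_derivative_Pair has_derivative_diff has_derivative_scaleR has_derivative_inner
        v_chart_has_derivative[OF assms] chart_has_derivative[OF assms])
  moreover have "(\<lambda>y. ((v \<circ> \<psi>) y, \<psi> y - ((v \<circ> \<psi>) y \<bullet> \<psi> y) *\<^sub>R (v \<circ> \<psi>) y)) = Phi v \<circ> \<psi>"
    by (auto simp: Phi_def)
  ultimately show ?thesis
    by (simp add: frechet_derivative_at[symmetric])
qed

text \<open>In the fibre component the multiples of \<open>v\<close> pair to zero with derivatives
  of \<open>v\<close>, and the terms with factor \<open>v (\<psi> x) \<bullet> \<psi> x\<close> are
  symmetric in \<open>w\<close> and \<open>w'\<close> and cancel. The base point \<open>z\<close> is
  arbitrary because \<open>Omega\<close> has constant coefficients.\<close>

lemma Omega_Phi_chart: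
  assumes "(W, \<psi>) \<in> atlas S" "x \<in> W"
  shows "Omega z (D (Phi v \<circ> \<psi>) x w) (D (Phi v \<circ> \<psi>) x w') =
    D (v \<circ> \<psi>) x w \<bullet> D \<psi> x w' - D (v \<circ> \<psi>) x w' \<bullet> D \<psi> x w"
  using v_chart_derivative_orth[OF assms]
  by (simp add: Omega_eq Phi_chart_derivative[OF assms] inner_diff_left inner_diff_right
      inner_add_left inner_add_right inner_commute)

text \<open>By \<open>Omega_eq\<close> a single bilinear form on the ambient space is involved, so
  \<open>bilinear_zero_on_immersed_image\<close> applies. The inclusion of \<open>\<Gamma>\<close>
  and \<open>Phi v\<close> are immersions with the same image, so vanishing transfers in either
  direction.\<close>

lemma isotropic_iff_curl_free:
  fixes \<Gamma> :: "('a \<times> 'a, 'k::euclidean_space) mfd"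
  assumes Phi: "immersion_into_TSphere S (Phi v)"
    and \<Gamma>: "immersed_in_TSphere \<Gamma>" "model \<Gamma> = UNIV" "carrier \<Gamma> = Phi v ` carrier S"
  shows "isotropic \<Gamma> \<longleftrightarrow> curl_free"
proof -
  interpret \<Gamma>: euclidean_submanifold \<Gamma>
    using \<Gamma> by unfold_locales
      (auto simp: immersed_in_TSphere_def immersion_into_TSphere_def immersed_submanifold_def
        carrier_def euclidean_mfd_def)
  have Phi_C2: "C2_on W (Phi v \<circ> \<psi>)" if "(W, \<psi>) \<in> atlas S" for W \<psi>
    using Phi that by (auto simp: immersion_into_TSphere_def immersion_euclidean_iff C2_map_euclidean_iff)
  have Phi_inj: "inj (D (Phi v \<circ> \<psi>) x)" if "(W, \<psi>) \<in> atlas S" "x \<in> W" for W \<psi> x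
    using Phi that model by (auto simp: immersion_into_TSphere_def immersion_euclidean_iff)
  let ?\<omega> = "Omega (0 :: 'a \<times> 'a)"
  have Omega: "Omega z = ?\<omega>" for z :: "'a \<times> 'a"
    by (intro ext) (simp add: Omega_eq)
  have "bounded_bilinear (\<lambda>X Y :: 'a \<times> 'a. fst X \<bullet> snd Y - snd X \<bullet> fst Y)"
    unfolding bilinear_conv_bounded_bilinear[symmetric] bilinear_def linear_iff
    by (auto simp: inner_add_left inner_add_right algebra_simps)
  then have bil: "bounded_bilinear ?\<omega>"
    by (simp add: Omega_eq[abs_def])
  have "isotropic \<Gamma> \<longleftrightarrow> (\<forall>(W, \<phi>)\<in>atlas \<Gamma>. \<forall>y\<in>W. \<forall>w w'.
    ?\<omega> (frechet_derivative \<phi> (at y) w) (frechet_derivative \<phi> (at y) w') = 0)"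
    (is "_ \<longleftrightarrow> ?chart")
  proof
    assume iso: "isotropic \<Gamma>"
    show ?chart
    proof clarify
      fix W \<phi> y w w' assume \<phi>: "(W, \<phi>) \<in> atlas \<Gamma>" "y \<in> W"
      have "frechet_derivative \<phi> (at y) u \<in> tangent_space \<Gamma> (\<phi> y)" for u
        using \<Gamma>.tangent_space_chart[OF \<phi>] by blast
      then show "?\<omega> (frechet_derivative \<phi> (at y) w) (frechet_derivative \<phi> (at y) w') = 0"
        using iso \<Gamma>.chart_carrier[OF \<phi>] Omega unfolding isotropic_def by metis
    qed
  next
    assume chart: ?chart
    show "isotropic \<Gamma>"
      unfolding isotropic_def
    proof (intro ballI)
      fix q X Y assume q: "q \<in> carrier \<Gamma>" and XY: "X \<in> tangent_space \<Gamma> q" "Y \<in> tangent_space \<Gamma> q"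
      obtain W \<phi> y where \<phi>: "(W, \<phi>) \<in> atlas \<Gamma>" "y \<in> W" "\<phi> y = q"
        using \<Gamma>.chart_at[OF q] .
      obtain w w' where "X = frechet_derivative \<phi> (at y) w" "Y = frechet_derivative \<phi> (at y) w'"
        using XY \<Gamma>.tangent_space_chart[OF \<phi>(1,2)] \<phi>(3) by blast
      then show "Omega q X Y = 0"
        using chart \<phi>(1,2) Omega[of q] by auto
    qed
  qed
  also have "\<dots> \<longleftrightarrow> (\<forall>(W, \<psi>)\<in>atlas S. \<forall>x\<in>W. \<forall>w w'.
    ?\<omega> (D (Phi v \<circ> \<psi>) x w) (D (Phi v \<circ> \<psi>) x w') = 0)" (is "_ \<longleftrightarrow> ?Phi")
  proof
    assume chart: ?chart
    show ?Phi
    proof clarify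
      fix W \<psi> x w w' assume \<psi>: "(W, \<psi>) \<in> atlas S" "x \<in> W"
      show "?\<omega> (D (Phi v \<circ> \<psi>) x w) (D (Phi v \<circ> \<psi>) x w') = 0"
      proof (rule bilinear_zero_on_immersed_image[where N = \<Gamma> and g = "\<lambda>q. q"
            and f = "Phi v", OF full_manifold_axioms \<Gamma>.full_manifold_axioms])
        show "Phi v ` carrier S \<subseteq> (\<lambda>q. q) ` carrier \<Gamma>"
          using \<Gamma>(3) by simp
      qed (use Phi_C2 \<Gamma>.chart_C2 \<Gamma>.chart_derivative_inj bil chart \<psi> in \<open>auto simp: comp_def[of "\<lambda>q. q"]\<close>)
    qed
  next
    assume chart: ?Phi
    show ?chart
    proof clarify
      fix W \<phi> y w w' assume \<phi>: "(W, \<phi>) \<in> atlas \<Gamma>" "y \<in> W"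
      have "?\<omega> (frechet_derivative ((\<lambda>q. q) \<circ> \<phi>) (at y) w) (frechet_derivative ((\<lambda>q. q) \<circ> \<phi>) (at y) w') = 0"
      proof (rule bilinear_zero_on_immersed_image[where N = S and f = "\<lambda>q. q" and g = "Phi v",
            OF \<Gamma>.full_manifold_axioms full_manifold_axioms])
        show "(\<lambda>q. q) ` carrier \<Gamma> \<subseteq> Phi v ` carrier S"
          using \<Gamma>(3) by simp
      qed (use Phi_C2 Phi_inj \<Gamma>.chart_C2 bil chart \<phi> in \<open>auto simp: comp_def[of "\<lambda>q. q"]\<close>)
      then show "?\<omega> (frechet_derivative \<phi> (at y) w) (frechet_derivative \<phi> (at y) w') = 0"
        by (simp add: comp_def)
    qed
  qed
  also have "\<dots> \<longleftrightarrow> curl_free"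
    unfolding curl_free_def by (auto simp: Omega_Phi_chart)
  finally show ?thesis .
qed


subsection \<open>The dual one-form and its local primitives\<close>

text \<open>The pullback under \<open>\<psi>\<close> of the one-form dual to \<open>v\<close>, with
  values in the normed space of bounded linear maps so that it can itself be differentiated.\<close>

definition chart_form :: "('m \<Rightarrow> 'a) \<Rightarrow> 'm \<Rightarrow> 'm \<Rightarrow>\<^sub>L real" where
  "chart_form \<psi> x = blinfun_inner_right (v (\<psi> x)) o\<^sub>L Blinfun (D \<psi> x)"

lemma Blinfun_chart_derivative:
  "(W, \<psi>) \<in> atlas S \<Longrightarrow> x \<in> W \<Longrightarrow> blinfun_apply (Blinfun (D \<psi> x)) = D \<psi> x"
  by (intro bounded_linear_Blinfun_apply has_derivative_bounded_linear[OF chart_has_derivative])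

lemma chart_form_apply:
  "(W, \<psi>) \<in> atlas S \<Longrightarrow> x \<in> W \<Longrightarrow> blinfun_apply (chart_form \<psi> x) w = v (\<psi> x) \<bullet> D \<psi> x w"
  by (simp add: chart_form_def Blinfun_chart_derivative)

lemma C1_on_chart_form:
  assumes "(W, \<psi>) \<in> atlas S"
  shows "C1_on W (chart_form \<psi>)"
proof -
  have "C1_on W (\<lambda>x. v (\<psi> x))"
    using C2_on_imp_C1_on[OF v_chart_C2[OF assms]] by (simp add: comp_def)
  then show ?thesis
    unfolding chart_form_def[abs_def]
    by (intro C1_on_blinfun_compose bounded_linear.C1_on[OF bounded_linear_blinfun_inner_right]
        C2_on_open[OF chart_open[OF assms] chart_C2[OF assms]])
qed

lemma chart_second_derivative:
  assumes "(W, \<psi>) \<in> atlas S" "x \<in> W"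
  obtains H where "((\<lambda>y. Blinfun (D \<psi> y)) has_derivative H) (at x)" "\<And>w w'. H w w' = H w' w"
proof -
  let ?d = "\<lambda>y. Blinfun (D \<psi> y)"
  have W: "open W"
    using chart_open assms(1) .
  have H: "(?d has_derivative D ?d x) (at x)"
    using C1_on_open[OF W] C2_on_open[OF W chart_C2[OF assms(1)]] assms(2) frechet_derivative_works
    by blast
  have "(\<psi> has_derivative blinfun_apply (?d y)) (at y within W)" if "y \<in> W" for y
    using chart_has_derivative[OF assms(1) that] Blinfun_chart_derivative[OF assms(1) that]
    by (simp add: has_derivative_at_withinI)
  then have "D ?d x w w' = D ?d x w' w" for w w'
    using symmetric_second_derivative[of UNIV W x w w' \<psi> ?d "D ?d x"] W assms(2)
      has_derivative_at_withinI[OF H] by simp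
  then show thesis
    using that H by blast
qed

text \<open>The derivative of the form consists of a term with the second derivative of
  \<open>\<psi>\<close>, symmetric in \<open>w\<close> and \<open>w'\<close>, and a term with the
  derivative of \<open>v\<close>. Antisymmetrizing leaves the exterior derivative in the shape used
  by \<open>curl_free\<close>.\<close>

lemma chart_form_derivative_skew:
  assumes "(W, \<psi>) \<in> atlas S" "x \<in> W" "(chart_form \<psi> has_derivative A) (at x)"
  shows "A w w' - A w' w = D (v \<circ> \<psi>) x w \<bullet> D \<psi> x w' - D (v \<circ> \<psi>) x w' \<bullet> D \<psi> x w"
proof -
  obtain H where H: "((\<lambda>y. Blinfun (D \<psi> y)) has_derivative H) (at x)" "\<And>w w'. H w w' = H w' w"
    using chart_second_derivative[OF assms(1,2)] by blast
  have *: "((\<lambda>y. blinfun_inner_right ((v \<circ> \<psi>) y) o\<^sub>L Blinfun (D \<psi> y)) has_derivative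
    (\<lambda>h. (blinfun_inner_right ((v \<circ> \<psi>) x) o\<^sub>L H h) +
      (blinfun_inner_right (D (v \<circ> \<psi>) x h) o\<^sub>L Blinfun (D \<psi> x)))) (at x)"
    by (rule bounded_bilinear.FDERIV[OF bounded_bilinear_blinfun_compose
          bounded_linear.has_derivative[OF bounded_linear_blinfun_inner_right v_chart_has_derivative[OF assms(1,2)]]
          H(1)])
  have "chart_form \<psi> = (\<lambda>y. blinfun_inner_right ((v \<circ> \<psi>) y) o\<^sub>L Blinfun (D \<psi> y))"
    by (auto simp: chart_form_def)
  from has_derivative_unique[OF assms(3)[unfolded this] *]
  have "A = (\<lambda>h. (blinfun_inner_right ((v \<circ> \<psi>) x) o\<^sub>L H h) +
      (blinfun_inner_right (D (v \<circ> \<psi>) x h) o\<^sub>L Blinfun (D \<psi> x)))"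
    .
  then show ?thesis
    using H(2)[of w w'] by (simp add: plus_blinfun.rep_eq Blinfun_chart_derivative[OF assms(1,2)])
qed

text \<open>The differential of \<open>f\<close> is prescribed in every chart; that \<open>f\<close>
  is then of class C2 follows because \<open>chart_form\<close> is of class C1.\<close>

definition primitive :: "'a set \<Rightarrow> ('a \<Rightarrow> real) \<Rightarrow> bool" where
  "primitive U f \<longleftrightarrow> (\<forall>(W, \<psi>)\<in>atlas S. \<forall>x\<in>W. \<psi> x \<in> U \<longrightarrow>
     ((f \<circ> \<psi>) has_derivative blinfun_apply (chart_form \<psi> x)) (at x))"

lemma primitiveD:
  "primitive U f \<Longrightarrow> (W, \<psi>) \<in> atlas S \<Longrightarrow> x \<in> W \<Longrightarrow> \<psi> x \<in> U \<Longrightarrow>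
    ((f \<circ> \<psi>) has_derivative blinfun_apply (chart_form \<psi> x)) (at x)"
  unfolding primitive_def by blast

lemma gradient_on_iff_primitive:
  assumes "openin (topol S) U"
  shows "gradient_on S U v f \<longleftrightarrow> primitive U f"
proof
  assume grad: "gradient_on S U v f"
  show "primitive U f"
    unfolding primitive_def
  proof clarify
    fix W \<psi> x assume \<psi>: "(W, \<psi>) \<in> atlas S" "x \<in> W" and x: "\<psi> x \<in> U"
    have "C2_on (W \<inter> \<psi> -` U) (f \<circ> \<psi>)"
      using grad \<psi>(1) by (auto simp: gradient_on_def C2_fun_on_def)
    then have f: "((f \<circ> \<psi>) has_derivative D (f \<circ> \<psi>) x) (at x)"
      by (rule C2_on_frechet[OF chart_open_vimage[OF \<psi>(1) assms]]) (use \<psi>(2) x in auto)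
    have "D (f \<circ> \<psi>) x w = v (\<psi> x) \<bullet> D \<psi> x w" for w
    proof -
      have "D \<psi> x w \<in> tangent_space S (\<psi> x)"
        using tangent_space_chart[OF \<psi>] by blast
      then have "v (\<psi> x) \<bullet> D \<psi> x w = deriv_along S f (\<psi> x) (D \<psi> x w)"
        using grad x unfolding gradient_on_def is_gradient_at_def by blast
      then show ?thesis
        using deriv_along_chart[OF \<psi> f] by simp
    qed
    then have "D (f \<circ> \<psi>) x = blinfun_apply (chart_form \<psi> x)"
      by (simp add: fun_eq_iff chart_form_apply[OF \<psi>])
    then show "((f \<circ> \<psi>) has_derivative blinfun_apply (chart_form \<psi> x)) (at x)"
      using f by simp
  qed
next
  assume prim: "primitive U f"
  have "C2_on (W \<inter> \<psi> -` U) (f \<circ> \<psi>)" if "(W, \<psi>) \<in> atlas S" for W \<psi>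
    using primitiveD[OF prim that] C1_on_subset[OF C1_on_chart_form[OF that]]
    by (intro C2_onI[of _ _ "chart_form \<psi>"]) (auto intro: has_derivative_at_withinI)
  moreover have "is_gradient_at S f p (v p)" if p: "p \<in> U" for p
  proof -
    have pS: "p \<in> carrier S"
      using openin_subset[OF assms] p by (auto simp: carrier_def)
    obtain W \<psi> x where \<psi>: "(W, \<psi>) \<in> atlas S" "x \<in> W" "\<psi> x = p"
      using chart_at[OF pS] .
    have "v p \<bullet> u = deriv_along S f p u" if u: "u \<in> tangent_space S p" for u
    proof -
      obtain w where "u = D \<psi> x w"
        using u tangent_space_chart[OF \<psi>(1,2)] \<psi>(3) by auto
      then show ?thesis
        using deriv_along_chart[OF \<psi>(1,2) primitiveD[OF prim \<psi>(1,2)]] \<psi>(3) p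
        by (simp add: chart_form_apply[OF \<psi>(1,2)])
    qed
    then show ?thesis
      using v_tangent_field pS by (auto simp: is_gradient_at_def tangent_field_def)
  qed
  ultimately show "gradient_on S U v f"
    by (auto simp: gradient_on_def C2_fun_on_def)
qed

text \<open>A primitive on the coordinate ball is carried to \<open>S\<close> by the inverse of
  \<open>\<psi>\<close>; in any other chart \<open>\<phi>\<close> the transition derivative pulls
  \<open>chart_form \<psi>\<close> back to \<open>chart_form \<phi>\<close>.\<close>

lemma curl_free_imp_primitive:
  assumes "curl_free" "(W, \<psi>) \<in> atlas S" "ball x0 r \<subseteq> W"
  obtains f where "primitive (\<psi> ` ball x0 r) f"
proof -
  have "A w w' = A w' w" if "x \<in> ball x0 r" "(chart_form \<psi> has_derivative A) (at x)" for x A w w'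
  proof -
    have x: "x \<in> W" using that(1) assms(3) by blast
    show ?thesis
      using chart_form_derivative_skew[OF assms(2) x that(2), of w w'] curl_freeD[OF assms(1,2) x, of w w']
      by simp
  qed
  then obtain f where f: "\<And>x. x \<in> ball x0 r \<Longrightarrow> (f has_derivative blinfun_apply (chart_form \<psi> x)) (at x)"
    using closed_one_form_primitive[OF C1_on_subset[OF C1_on_chart_form[OF assms(2)] assms(3)]] by blast
  have "primitive (\<psi> ` ball x0 r) (f \<circ> inv_into W \<psi>)"
    unfolding primitive_def
  proof clarify
    fix W' \<phi> x' x assume \<phi>: "(W', \<phi>) \<in> atlas S" "x' \<in> W'" and x: "\<phi> x' = \<psi> x" "x \<in> ball x0 r"
    have xW: "x \<in> W" using x(2) assms(3) by blast
    obtain T where T: "((inv_into W \<psi> \<circ> \<phi>) has_derivative T) (at x')"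
      "\<And>w. D \<phi> x' w = D \<psi> x (T w)"
      using transition_derivative[OF \<phi>(1) assms(2) \<phi>(2) xW x(1)] by blast
    have "(inv_into W \<psi> \<circ> \<phi>) x' = x"
      using x(1) xW chart_inj_on[OF assms(2)] by simp
    then have "((f \<circ> (inv_into W \<psi> \<circ> \<phi>)) has_derivative (blinfun_apply (chart_form \<psi> x) \<circ> T)) (at x')"
      using diff_chain_at[OF T(1)] f[OF x(2)] by metis
    moreover have "blinfun_apply (chart_form \<psi> x) \<circ> T = blinfun_apply (chart_form \<phi> x')"
      by (simp add: fun_eq_iff chart_form_apply[OF \<phi>] chart_form_apply[OF assms(2) xW] T(2) x(1))
    ultimately show "((f \<circ> inv_into W \<psi> \<circ> \<phi>) has_derivative blinfun_apply (chart_form \<phi> x')) (at x')"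
      by (simp add: comp_assoc)
  qed
  then show thesis
    by (rule that)
qed

text \<open>The converse is the symmetry of the second derivative of
  \<open>f \<circ> \<psi>\<close>, whose first derivative is
  \<open>chart_form \<psi>\<close>.\<close>

lemma curl_free_iff_local_primitive:
  "curl_free \<longleftrightarrow> (\<forall>p\<in>carrier S. \<exists>U f. openin (topol S) U \<and> p \<in> U \<and> primitive U f)"
proof
  assume cf: curl_free
  show "\<forall>p\<in>carrier S. \<exists>U f. openin (topol S) U \<and> p \<in> U \<and> primitive U f"
  proof
    fix p assume "p \<in> carrier S"
    then obtain W \<psi> x where \<psi>: "(W, \<psi>) \<in> atlas S" "x \<in> W" "\<psi> x = p"
      using chart_at by blast
    obtain r where r: "r > 0" "ball x r \<subseteq> W"
      using chart_open[OF \<psi>(1)] \<psi>(2) openE by blast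
    obtain f where "primitive (\<psi> ` ball x r) f"
      using curl_free_imp_primitive[OF cf \<psi>(1) r(2)] .
    moreover have "p \<in> \<psi> ` ball x r"
      using \<psi>(3) r(1) by auto
    ultimately show "\<exists>U f. openin (topol S) U \<and> p \<in> U \<and> primitive U f"
      using chart_openin_image[OF \<psi>(1) open_ball r(2)] by blast
  qed
next
  assume loc: "\<forall>p\<in>carrier S. \<exists>U f. openin (topol S) U \<and> p \<in> U \<and> primitive U f"
  show curl_free
    unfolding curl_free_def
  proof clarify
    fix W \<psi> x w w' assume \<psi>: "(W, \<psi>) \<in> atlas S" "x \<in> W"
    obtain U f where U: "openin (topol S) U" "\<psi> x \<in> U" "primitive U f"
      using loc chart_carrier[OF \<psi>] by blast
    let ?V = "W \<inter> \<psi> -` U"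
    have V: "open ?V" "x \<in> ?V"
      using chart_open_vimage[OF \<psi>(1) U(1)] U(2) \<psi>(2) by auto
    have f: "((f \<circ> \<psi>) has_derivative blinfun_apply (chart_form \<psi> y)) (at y within ?V)" if "y \<in> ?V" for y
      using primitiveD[OF U(3) \<psi>(1)] that by (auto intro: has_derivative_at_withinI)
    have A: "(chart_form \<psi> has_derivative D (chart_form \<psi>) x) (at x)"
      using C1_on_open[OF chart_open[OF \<psi>(1)]] C1_on_chart_form[OF \<psi>(1)] \<psi>(2) frechet_derivative_works
      by blast
    have "D (chart_form \<psi>) x w w' = D (chart_form \<psi>) x w' w"
      using symmetric_second_derivative[of UNIV ?V x w w' "f \<circ> \<psi>" "chart_form \<psi>"] V f
        has_derivative_at_withinI[OF A] by simp
    then show "D (v \<circ> \<psi>) x w \<bullet> D \<psi> x w' = D (v \<circ> \<psi>) x w' \<bullet> D \<psi> x w"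
      using chart_form_derivative_skew[OF \<psi> A, of w w'] by simp
  qed
qed

end


section \<open>Geodesic fields\<close>

text \<open>A profile for cutoffs that is C1 but not C2, matching the regularity of the fields in
  \<open>levi_civita\<close>.\<close>

lemma has_real_derivative_max_0_square:
  "((\<lambda>s::real. (max 0 s)\<^sup>2) has_real_derivative 2 * max 0 s) (at s)"
proof (cases s "0::real" rule: linorder_cases)
  case less
  have "((\<lambda>s::real. 0) has_real_derivative 0) (at s)"
    by simp
  then have "((\<lambda>s::real. (max 0 s)\<^sup>2) has_real_derivative 0) (at s)"
    by (rule DERIV_cong_ev[THEN iffD1, rotated 3])
      (use less in \<open>auto intro!: eventually_mono[OF order_tendstoD(2)[OF tendsto_ident_at less]] eventually_nhds_in_open[of "{..<0}", THEN eventually_mono]\<close>)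
  then show ?thesis
    using less by simp
next
  case equal
  have "(\<lambda>h::real. ((max 0 (0 + h))\<^sup>2 - (max 0 0)\<^sup>2) / h) \<midarrow>0\<rightarrow> 0"
  proof (rule Lim_null_comparison)
    have "norm (((max 0 (0 + h))\<^sup>2 - (max 0 0)\<^sup>2) / h) \<le> \<bar>h\<bar>" for h :: real
      by (cases "h = 0") (auto simp: power2_eq_square max_def)
    then show "\<forall>\<^sub>F h::real in at 0. norm (((max 0 (0 + h))\<^sup>2 - (max 0 0)\<^sup>2) / h) \<le> \<bar>h\<bar>"
      by simp
    show "(\<lambda>h::real. \<bar>h\<bar>) \<midarrow>0\<rightarrow> 0"
      by (auto intro!: tendsto_eq_intros)
  qed
  then show ?thesis
    using equal by (simp add: DERIV_def)
next
  case greater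
  have "((\<lambda>s::real. s\<^sup>2) has_real_derivative 2 * s) (at s)"
    by (auto intro!: derivative_eq_intros)
  then have "((\<lambda>s::real. (max 0 s)\<^sup>2) has_real_derivative 2 * s) (at s)"
    by (rule DERIV_cong_ev[THEN iffD1, rotated 3])
      (use greater in \<open>auto intro!: eventually_nhds_in_open[of "{0<..}", THEN eventually_mono]\<close>)
  then show ?thesis
    using greater by simp
qed

lemma C1_bump_function:
  fixes x0 :: "'m::euclidean_space"
  assumes "r > 0"
  obtains \<beta> :: "'m \<Rightarrow> real" where "C1_on UNIV \<beta>" "\<beta> x0 = 1" "\<And>x. x \<notin> ball x0 r \<Longrightarrow> \<beta> x = 0"
proof -
  let ?q = "\<lambda>x. r\<^sup>2 - (x - x0) \<bullet> (x - x0)"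
  let ?\<beta> = "\<lambda>x. inverse ((r\<^sup>2)\<^sup>2) *\<^sub>R (max 0 (?q x))\<^sup>2"
  have "C1_on UNIV (\<lambda>s::real. (max 0 s)\<^sup>2)"
  proof (rule C1_onI)
    show "((\<lambda>s. (max 0 s)\<^sup>2) has_derivative blinfun_scaleR_left (2 * max 0 s)) (at s)" for s :: real
      using has_real_derivative_max_0_square[of s] by (simp add: has_field_derivative_def mult_commute_abs)
    show "continuous_on UNIV (\<lambda>s::real. blinfun_scaleR_left (2 * max 0 s))"
      by (intro bounded_linear.continuous_on[OF bounded_linear_blinfun_scaleR_left] continuous_intros)
  qed
  moreover have "C1_on UNIV ?q"
    by (intro C1_on_diff C1_on_const C1_on_inner C1_on_id)
  ultimately have "C1_on UNIV (\<lambda>x. (max 0 (?q x))\<^sup>2)"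
    using C1_on_compose by blast
  then have "C1_on UNIV ?\<beta>"
    by (rule bounded_linear.C1_on[OF bounded_linear_scaleR_right])
  moreover have "?\<beta> x0 = 1"
    using assms by simp
  moreover have "?\<beta> x = 0" if "x \<notin> ball x0 r" for x
  proof -
    have "r\<^sup>2 \<le> (norm (x - x0))\<^sup>2"
      using that assms by (intro power_mono) (auto simp: dist_norm norm_minus_commute)
    then show ?thesis
      by (simp add: power2_norm_eq_inner)
  qed
  ultimately show thesis
    by (rule that)
qed

section \<open>Tangent vectors as values of global C1 fields\<close>

context full_manifold
begin

lemma Hausdorff: "Hausdorff_space (topol M)"
  using C2_manifold by (simp add: C2_manifold_def)

text \<open>Compact sets in a Hausdorff space are closed. The complement is therefore open in all of
  \<open>M\<close>, and a field cut off inside \<open>K\<close> is zero on it.\<close>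

lemma chart_closedin_image:
  assumes "(W, \<psi>) \<in> atlas M" "compact K" "K \<subseteq> W"
  shows "closedin (topol M) (\<psi> ` K)"
proof (rule compactin_imp_closedin[OF Hausdorff])
  have "compactin (top_of_set W) K"
    using assms by (simp add: compactin_subtopology)
  then show "compactin (topol M) (\<psi> ` K)"
    using chart_continuous_map[OF assms(1)] by (rule image_compactin)
qed

end

text \<open>The axioms in \<open>levi_civita\<close> speak only of fields on the whole manifold. The
  coordinate field of a chart in the direction \<open>w\<close> is multiplied by a cutoff and
  extended by zero; one derivative of the C2 chart is spent, so the field is C1.\<close>

lemma (in euclidean_submanifold) C1_tangent_field_through:
  assumes "p \<in> carrier M" "u \<in> tangent_space M p"
  obtains Z where "C1_fun M Z" "tangent_field M Z" "Z p = u"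
proof -
  obtain W \<psi> x0 where \<psi>: "(W, \<psi>) \<in> atlas M" "x0 \<in> W" "\<psi> x0 = p"
    using chart_at[OF assms(1)] .
  obtain w where w: "u = frechet_derivative \<psi> (at x0) w"
    using assms(2) tangent_space_chart[OF \<psi>(1,2)] \<psi>(3) by blast
  have W: "open W"
    using chart_open \<psi>(1) .
  obtain r where r: "r > 0" "cball x0 r \<subseteq> W"
    using W \<psi>(2) open_contains_cball by blast
  obtain \<beta> where \<beta>: "C1_on UNIV \<beta>" "\<beta> x0 = (1::real)" "\<And>x. x \<notin> ball x0 r \<Longrightarrow> \<beta> x = 0"
    using C1_bump_function[OF r(1)] by blast
  define \<zeta> where "\<zeta> x = \<beta> x *\<^sub>R blinfun_apply (Blinfun (frechet_derivative \<psi> (at x))) w" for x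
  have \<zeta>_eq: "\<zeta> x = frechet_derivative \<psi> (at x) (\<beta> x *\<^sub>R w)" if "x \<in> W" for x
    using chart_has_derivative[OF \<psi>(1) that]
    by (simp add: \<zeta>_def bounded_linear_Blinfun_apply has_derivative_bounded_linear
        linear_cmul[OF has_derivative_linear])
  have \<zeta>: "C1_on W \<zeta>"
    unfolding \<zeta>_def[abs_def]
    by (intro C1_on_scaleR C1_on_subset[OF \<beta>(1)] C1_on_blinfun_apply C1_on_const
        C2_on_open[OF W chart_C2[OF \<psi>(1)]]) simp
  define Z where "Z q = (if q \<in> \<psi> ` W then \<zeta> (inv_into W \<psi> q) else 0)" for q
  have Z_chart: "Z (\<psi> x) = \<zeta> x" if "x \<in> W" for x
    using that chart_inj_on[OF \<psi>(1)] by (simp add: Z_def)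
  have Z_off: "Z q = 0" if "q \<notin> \<psi> ` cball x0 r" for q
  proof (cases "q \<in> \<psi> ` W")
    case True
    then obtain x where x: "x \<in> W" "q = \<psi> x" by blast
    then have "x \<notin> ball x0 r"
      using that by (auto simp: image_iff)
    then show ?thesis
      using \<beta>(3) x(2) Z_chart[OF x(1)] by (simp add: \<zeta>_def)
  qed (simp add: Z_def)
  have off: "openin (topol M) (carrier M - \<psi> ` cball x0 r)"
    using chart_closedin_image[OF \<psi>(1) compact_cball r(2)] unfolding carrier_def
    by (simp add: openin_diff)
  show thesis
  proof (rule that)
    show "C1_fun M Z"
      unfolding C1_fun_def
    proof clarify
      fix W' \<phi> assume \<phi>: "(W', \<phi>) \<in> atlas M"
      \<comment> \<open>\<open>Z\<close> is the transported \<open>\<zeta>\<close> on the first set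
        and zero on the second; both sets are open, and they exhaust \<open>W'\<close> because the
        closed ball lies in \<open>W\<close>.\<close>
      let ?V1 = "W' \<inter> \<phi> -` (\<psi> ` W)" and ?V2 = "W' \<inter> \<phi> -` (carrier M - \<psi> ` cball x0 r)"
      have "C1_on ?V1 (\<lambda>x. \<zeta> ((inv_into W \<psi> \<circ> \<phi>) x))"
        by (rule C1_on_compose[OF C2_on_imp_C1_on[OF chart_transition[OF \<phi> \<psi>(1)]] \<zeta>])
          (auto intro: inv_into_into)
      then have 1: "C1_on ?V1 (Z \<circ> \<phi>)"
        by (rule C1_on_cong[THEN iffD1, rotated]) (auto simp: Z_def)
      have 2: "C1_on ?V2 (Z \<circ> \<phi>)"
        using C1_on_const[of ?V2 0] by (rule C1_on_cong[THEN iffD1, rotated]) (simp add: Z_off)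
      have "C1_on (?V1 \<union> ?V2) (Z \<circ> \<phi>)"
        using chart_open_vimage[OF \<phi> chart_image_openin[OF \<psi>(1)]] chart_open_vimage[OF \<phi> off] 1 2
        by (rule C1_on_Un_open)
      moreover have "?V1 \<union> ?V2 = W'"
        using image_mono[OF r(2), of \<psi>] chart_carrier[OF \<phi>] by blast
      ultimately show "C1_on W' (Z \<circ> \<phi>)"
        by simp
    qed
    show "tangent_field M Z"
      unfolding tangent_field_def
    proof
      fix q assume q: "q \<in> carrier M"
      show "Z q \<in> tangent_space M q"
      proof (cases "q \<in> \<psi> ` W")
        case True
        then obtain x where x: "x \<in> W" "q = \<psi> x" by blast
        then show ?thesis
          using Z_chart \<zeta>_eq tangent_space_chart[OF \<psi>(1)] by simp
      next
        case False
        obtain W' \<phi> x where \<phi>: "(W', \<phi>) \<in> atlas M" "x \<in> W'" "\<phi> x = q"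
          using chart_at[OF q] .
        have "frechet_derivative \<phi> (at x) 0 = 0"
          using linear_0[OF has_derivative_linear[OF chart_has_derivative[OF \<phi>(1,2)]]] .
        then have "0 \<in> tangent_space M q"
          using tangent_space_chart[OF \<phi>(1,2)] \<phi>(3) by (metis rangeI)
        then show ?thesis
          using False by (simp add: Z_def)
      qed
    qed
    show "Z p = u"
      using Z_chart[OF \<psi>(2)] \<zeta>_eq[OF \<psi>(2)] \<beta>(2) \<psi>(3) w by simp
  qed
qed

section \<open>The covariant derivative of the field along itself\<close>

context unit_field
begin

text \<open>The Koszul computation for the single derivative \<open>\<nabla>\<^sub>v v\<close>: the terms differentiating \<open>Z\<close> cancel.\<close>

lemma levi_civita_inner:
  assumes lc: "levi_civita S nabla" and p: "p \<in> carrier S"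
    and Z: "C1_fun S Z" "tangent_field S Z"
  shows "nabla v v p \<bullet> Z p = deriv_along S v p (v p) \<bullet> Z p"
proof -
  obtain W \<psi> x where \<psi>: "(W, \<psi>) \<in> atlas S" "x \<in> W" "\<psi> x = p"
    using chart_at[OF p] .
  obtain w where w: "D \<psi> x w = v p"
    using v_chart_preimage[OF \<psi>(1,2)] \<psi>(3) by metis
  obtain z where z: "D \<psi> x z = Z p"
    using Z(2) p tangent_space_chart[OF \<psi>(1,2)] \<psi>(3) unfolding tangent_field_def by (metis imageE)
  have v_C1: "C1_fun S v"
    using C2_on_imp_C1_on v_chart_C2 by (auto simp: C1_fun_def)
  \<comment> \<open>The axioms form one implication that also asks for a scalar function; zero
    serves in each instantiation.\<close>
  have zero: "C1_fun S (\<lambda>q. 0::real)"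
    using C1_on_const[of _ "0::real"] by (auto simp: C1_fun_def comp_def)
  have dv: "((v \<circ> \<psi>) has_derivative D (v \<circ> \<psi>) x) (at x)"
    using v_chart_has_derivative[OF \<psi>(1,2)] .
  have "C1_on W (Z \<circ> \<psi>)"
    using Z(1) \<psi>(1) by (auto simp: C1_fun_def)
  then have dZ: "((Z \<circ> \<psi>) has_derivative D (Z \<circ> \<psi>) x) (at x)"
    using C1_on_open[OF chart_open[OF \<psi>(1)]] \<psi>(2) frechet_derivative_works by blast
  have along_v: "deriv_along S v p (D \<psi> x u) = D (v \<circ> \<psi>) x u" for u
    using deriv_along_chart[OF \<psi>(1,2) dv] \<psi>(3) by simp
  have along_Z: "deriv_along S Z p (D \<psi> x u) = D (Z \<circ> \<psi>) x u" for u
    using deriv_along_chart[OF \<psi>(1,2) dZ] \<psi>(3) by simp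
  have "((\<lambda>q. v q \<bullet> Z q) \<circ> \<psi> has_derivative (\<lambda>u. v p \<bullet> D (Z \<circ> \<psi>) x u + D (v \<circ> \<psi>) x u \<bullet> Z p)) (at x)"
    using has_derivative_inner[OF dv dZ] \<psi>(3) by (simp add: comp_def)
  from deriv_along_chart[OF \<psi>(1,2) this, of w]
  have vZ: "deriv_along S (\<lambda>q. v q \<bullet> Z q) p (v p) = v p \<bullet> D (Z \<circ> \<psi>) x w + D (v \<circ> \<psi>) x w \<bullet> Z p"
    using \<psi>(3) w by simp
  have orth: "v p \<bullet> D (v \<circ> \<psi>) x u = 0" for u
    using v_chart_derivative_orth[OF \<psi>(1,2)] \<psi>(3) by simp
  \<comment> \<open>Constancy of \<open>v \<bullet> v\<close> along \<open>Z\<close>, together with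
    compatibility with the metric, will show that \<open>nabla Z v p\<close> is orthogonal to
    \<open>v p\<close>.\<close>
  have "((\<lambda>q. v q \<bullet> v q) \<circ> \<psi> has_derivative (\<lambda>u. v p \<bullet> D (v \<circ> \<psi>) x u + D (v \<circ> \<psi>) x u \<bullet> v p)) (at x)"
    using has_derivative_inner[OF dv dv] \<psi>(3) by (simp add: comp_def)
  from deriv_along_chart[OF \<psi>(1,2) this, of z]
  have vv: "deriv_along S (\<lambda>q. v q \<bullet> v q) p (Z p) = 0"
    using \<psi>(3) z orth by (simp add: inner_commute)
  have "deriv_along S (\<lambda>q. v q \<bullet> Z q) p (v p) = nabla v v p \<bullet> Z p + v p \<bullet> nabla v Z p"
    using lc[unfolded levi_civita_def, rule_format, of p v v Z "\<lambda>q. 0"] p v_C1 v_tangent_field Z zero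
    by blast
  moreover have "deriv_along S (\<lambda>q. v q \<bullet> v q) p (Z p) = nabla Z v p \<bullet> v p + v p \<bullet> nabla Z v p"
    using lc[unfolded levi_civita_def, rule_format, of p Z v v "\<lambda>q. 0"] p v_C1 v_tangent_field Z zero
    by blast
  moreover have "nabla v Z p - nabla Z v p = lie_bracket S v Z p"
    using lc[unfolded levi_civita_def, rule_format, of p v Z v "\<lambda>q. 0"] p v_C1 v_tangent_field Z zero
    by blast
  then have "v p \<bullet> nabla v Z p = v p \<bullet> nabla Z v p + v p \<bullet> lie_bracket S v Z p"
    by (simp add: algebra_simps flip: inner_add_right)
  \<comment> \<open>The bracket contributes exactly the term with the derivative of \<open>Z\<close>
    in \<open>vZ\<close>; its other half is orthogonal to \<open>v p\<close>.\<close>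
  moreover have "v p \<bullet> lie_bracket S v Z p = v p \<bullet> D (Z \<circ> \<psi>) x w"
    using along_Z[of w] along_v[of z] w z orth by (simp add: lie_bracket_def inner_diff_right)
  ultimately show ?thesis
    using vZ vv along_v[of w] w by (simp add: inner_commute)
qed

text \<open>By \<open>levi_civita_inner\<close> the vector \<open>nabla v v p\<close> is the
  tangential part of the derivative of \<open>v\<close> along itself. Being tangent, it can be
  tested against a field extending itself.\<close>

lemma geodesic_iff_chart:
  assumes "levi_civita S nabla"
  shows "(\<forall>p\<in>carrier S. nabla v v p = 0) \<longleftrightarrow> (\<forall>(W, \<psi>)\<in>atlas S. \<forall>x\<in>W. \<forall>w w'.
    D \<psi> x w = v (\<psi> x) \<longrightarrow> D (v \<circ> \<psi>) x w \<bullet> D \<psi> x w' = 0)" (is "?L \<longleftrightarrow> ?R")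
proof
  assume L: ?L
  show ?R
  proof clarify
    fix W \<psi> x w w' assume \<psi>: "(W, \<psi>) \<in> atlas S" "x \<in> W" and w: "D \<psi> x w = v (\<psi> x)"
    have p: "\<psi> x \<in> carrier S"
      using chart_carrier[OF \<psi>] .
    have "D \<psi> x w' \<in> tangent_space S (\<psi> x)"
      using tangent_space_chart[OF \<psi>] by blast
    then obtain Z where Z: "C1_fun S Z" "tangent_field S Z" "Z (\<psi> x) = D \<psi> x w'"
      using C1_tangent_field_through[OF p] by blast
    have "deriv_along S v (\<psi> x) (v (\<psi> x)) \<bullet> D \<psi> x w' = 0"
      using levi_civita_inner[OF assms p Z(1,2)] L p Z(3) by simp
    then show "D (v \<circ> \<psi>) x w \<bullet> D \<psi> x w' = 0"
      using deriv_along_chart[OF \<psi> v_chart_has_derivative[OF \<psi>], of w] w by simp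
  qed
next
  assume R: ?R
  show ?L
  proof
    fix p assume p: "p \<in> carrier S"
    obtain W \<psi> x where \<psi>: "(W, \<psi>) \<in> atlas S" "x \<in> W" "\<psi> x = p"
      using chart_at[OF p] .
    obtain w where w: "D \<psi> x w = v p"
      using v_chart_preimage[OF \<psi>(1,2)] \<psi>(3) by metis
    have "C1_fun S v" "C1_fun S (\<lambda>q. 0::real)"
      using C2_on_imp_C1_on v_chart_C2 C1_on_const[of _ "0::real"] by (auto simp: C1_fun_def comp_def)
    then have tan: "nabla v v p \<in> tangent_space S p"
      using assms[unfolded levi_civita_def, rule_format, of p v v v "\<lambda>q. 0"] p v_tangent_field by blast
    then obtain Z where Z: "C1_fun S Z" "tangent_field S Z" "Z p = nabla v v p"
      using C1_tangent_field_through[OF p] by blast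
    obtain w' where w': "nabla v v p = D \<psi> x w'"
      using tan tangent_space_chart[OF \<psi>(1,2)] \<psi>(3) by blast
    have "nabla v v p \<bullet> nabla v v p = D (v \<circ> \<psi>) x w \<bullet> D \<psi> x w'"
      using levi_civita_inner[OF assms p Z(1,2)] Z(3) w w' \<psi>(3)
        deriv_along_chart[OF \<psi>(1,2) v_chart_has_derivative[OF \<psi>(1,2)], of w] by simp
    also have "\<dots> = 0"
      using R \<psi> w by blast
    finally show "nabla v v p = 0"
      by simp
  qed
qed

text \<open>Symmetry moves \<open>v\<close> from the slot of the differentiation to the other one,
  where unit length makes the pairing vanish.\<close>

lemma curl_free_imp_geodesic:
  assumes "levi_civita S nabla" "curl_free"
  shows "\<forall>p\<in>carrier S. nabla v v p = 0"
proof -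
  have "D (v \<circ> \<psi>) x w \<bullet> D \<psi> x w' = 0"
    if "(W, \<psi>) \<in> atlas S" "x \<in> W" "D \<psi> x w = v (\<psi> x)" for W \<psi> x w w'
    using curl_freeD[OF assms(2) that(1,2), of w w'] v_chart_derivative_orth[OF that(1,2), of w'] that(3)
    by (simp add: inner_commute)
  then show ?thesis
    unfolding geodesic_iff_chart[OF assms(1)] by blast
qed

end


section \<open>The orthogonal distribution\<close>

text \<open>Test with the component \<open>z\<close> of \<open>F u\<close> normal to
  \<open>T'\<close>: the function \<open>z \<bullet> f\<close> vanishes on \<open>W\<close>, so
  \<open>z \<bullet> F u\<close>, which equals \<open>z \<bullet> z\<close>, is zero.\<close>

lemma has_derivative_in_subspace:
  fixes f :: "'m::real_normed_vector \<Rightarrow> 'b::euclidean_space"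
  assumes T: "subspace T" "openin (top_of_set T) W" "x \<in> W" "u \<in> T"
    and T': "subspace T'" "f ` W \<subseteq> T'" and f: "(f has_derivative F) (at x within W)"
  shows "F u \<in> T'"
proof -
  obtain y z where yz: "y \<in> T'" "\<And>b. b \<in> T' \<Longrightarrow> z \<bullet> b = 0" "F u = y + z"
    using orthogonal_subspace_decomp_exists[of T' "F u"] span_eq_iff[THEN iffD2, OF T'(1)]
    unfolding orthogonal_def by metis
  have "((\<lambda>y. z \<bullet> f y) has_derivative (\<lambda>h. z \<bullet> F h)) (at x within W)"
    by (rule has_derivative_inner_right[OF f])
  then have "((\<lambda>y. 0) has_derivative (\<lambda>h. z \<bullet> F h)) (at x within W)"
    by (rule has_derivative_transform[OF T(3), rotated]) (use yz(2) T'(2) in force)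
  then have "z \<bullet> F u = 0"
    using has_derivative_unique_subspace[OF T _ has_derivative_const] by metis
  then have "z = 0"
    using yz by (simp add: inner_add_right)
  then show ?thesis
    using yz by simp
qed

text \<open>The analogue of \<open>tangent_space_chart\<close> when the model may be a proper
  subspace. The additional point is that the derivative of a transition map sends the model into
  itself, so that \<open>u\<close> is found there.\<close>

lemma tangent_space_within_chart:
  fixes N :: "('e::euclidean_space, 'm::euclidean_space) mfd"
  assumes N: "C2_manifold N"
    and diff: "\<And>W \<kappa> y. (W, \<kappa>) \<in> atlas N \<Longrightarrow> y \<in> W \<Longrightarrow> \<kappa> differentiable (at y within model N)"
    and \<kappa>: "(W, \<kappa>) \<in> atlas N" "y \<in> W" and X: "X \<in> tangent_space N (\<kappa> y)"
  obtains u where "u \<in> model N" "X = frechet_derivative \<kappa> (at y within model N) u"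
proof -
  obtain W' \<phi> y' w where \<phi>: "(W', \<phi>) \<in> atlas N" "y' \<in> W'" "\<phi> y' = \<kappa> y" and w: "w \<in> model N"
    "X = frechet_derivative \<phi> (at y' within model N) w"
    using X unfolding tangent_space_def by blast
  let ?T = "model N" and ?V = "W' \<inter> \<phi> -` (\<kappa> ` W)" and ?\<sigma> = "inv_into W \<kappa> \<circ> \<phi>"
  have T: "subspace ?T"
    using N by (simp add: C2_manifold_def)
  have charts: "\<forall>(W, \<psi>)\<in>atlas N. openin (top_of_set ?T) W \<and> openin (topol N) (\<psi> ` W) \<and>
        homeomorphic_map (top_of_set W) (subtopology (topol N) (\<psi> ` W)) \<psi>"
    using N unfolding C2_manifold_def by (elim conjE)
  have trans: "\<forall>(W, \<psi>)\<in>atlas N. \<forall>(W', \<phi>)\<in>atlas N. C2_on (W \<inter> \<psi> -` (\<phi> ` W')) (inv_into W' \<phi> \<circ> \<psi>)"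
    using N unfolding C2_manifold_def by (elim conjE)
  have W: "openin (top_of_set ?T) W" "openin (topol N) (\<kappa> ` W)"
    "homeomorphic_map (top_of_set W) (subtopology (topol N) (\<kappa> ` W)) \<kappa>"
    using bspec[OF charts \<kappa>(1)] by simp_all
  have W': "openin (top_of_set ?T) W'"
    "homeomorphic_map (top_of_set W') (subtopology (topol N) (\<phi> ` W')) \<phi>"
    using bspec[OF charts \<phi>(1)] by simp_all
  have inj: "inj_on \<kappa> W"
    using homeomorphic_imp_injective_map[OF W(3)] by simp
  have "continuous_map (top_of_set W') (topol N) \<phi>"
    using homeomorphic_imp_continuous_map[OF W'(2)] continuous_map_into_fulltopology by blast
  from openin_continuous_map_preimage[OF this W(2)]
  have "openin (top_of_set W') ?V"
    by (simp add: vimage_def Int_def)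
  then have V: "openin (top_of_set ?T) ?V"
    using W'(1) openin_trans by blast
  have y'V: "y' \<in> ?V"
    using \<phi>(2,3) \<kappa>(2) by auto
  have "C2_on ?V ?\<sigma>"
    using bspec[OF bspec[OF trans \<phi>(1), unfolded case_prod_conv] \<kappa>(1)] by simp
  then obtain \<sigma>' where \<sigma>': "(?\<sigma> has_derivative blinfun_apply (\<sigma>' y')) (at y' within ?V)"
    using y'V unfolding C2_on_def by blast
  have \<sigma>y: "?\<sigma> y' = y"
    using \<phi>(3) \<kappa>(2) inj by simp
  have \<sigma>V: "?\<sigma> ` ?V \<subseteq> W"
    by (auto intro: inv_into_into)
  have "W \<subseteq> ?T"
    using W(1) openin_imp_subset by blast
  then have u: "\<sigma>' y' w \<in> ?T"
    using has_derivative_in_subspace[OF T V y'V w(1) T _ \<sigma>'] \<sigma>V by blast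
  have "(\<kappa> has_derivative frechet_derivative \<kappa> (at y within ?T)) (at y within W)"
    using diff[OF \<kappa>] frechet_derivative_works at_within_openin_subspace[OF W(1) \<kappa>(2)] by metis
  then have "(\<kappa> has_derivative frechet_derivative \<kappa> (at y within ?T)) (at (?\<sigma> y') within ?\<sigma> ` ?V)"
    using has_derivative_subset[OF _ \<sigma>V] \<sigma>y by metis
  from has_derivative_in_compose[OF \<sigma>' this]
  have 1: "((\<lambda>z. \<kappa> (?\<sigma> z)) has_derivative (\<lambda>h. frechet_derivative \<kappa> (at y within ?T) (\<sigma>' y' h)))
    (at y' within ?V)" .
  have "(\<phi> has_derivative (\<lambda>h. frechet_derivative \<kappa> (at y within ?T) (\<sigma>' y' h))) (at y' within ?V)"
    using y'V _ 1 by (rule has_derivative_transform) (simp add: f_inv_into_f)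
  moreover have "(\<phi> has_derivative frechet_derivative \<phi> (at y' within ?T)) (at y' within ?V)"
    using diff[OF \<phi>(1,2)] frechet_derivative_works at_within_openin_subspace[OF V y'V] by metis
  ultimately have "X = frechet_derivative \<kappa> (at y within ?T) (\<sigma>' y' w)"
    using has_derivative_unique_subspace[OF T V y'V w(1)] w(2) by metis
  with u show thesis
    by (rule that)
qed

section \<open>Integral manifolds versus closedness of the one-form\<close>

context unit_field
begin

text \<open>On a leaf with chart \<open>\<kappa>\<close> the identity \<open>\<langle>v, d\<kappa>\<rangle> = 0\<close> can be differentiated.\<close>

lemma leaf_symmetric:
  fixes N :: "('a, 'm) mfd"
  assumes N: "immersed_submanifold N S" "\<And>q. q \<in> carrier N \<Longrightarrow> tangent_space N q = orth_distribution S v q"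
    and \<psi>: "(W, \<psi>) \<in> atlas S" "x \<in> W" and p: "\<psi> x \<in> carrier N"
    and w: "v (\<psi> x) \<bullet> D \<psi> x w = 0" "v (\<psi> x) \<bullet> D \<psi> x w' = 0"
  shows "D (v \<circ> \<psi>) x w \<bullet> D \<psi> x w' = D (v \<circ> \<psi>) x w' \<bullet> D \<psi> x w"
proof -
  let ?T = "model N"
  have mN: "C2_manifold N" and map: "C2_map N S (\<lambda>q. q)"
    using N(1) by (auto simp: immersed_submanifold_def immersion_def)
  have T: "subspace ?T"
    using mN by (simp add: C2_manifold_def)
  have charts: "\<forall>(W, \<psi>)\<in>atlas N. openin (top_of_set ?T) W \<and> openin (topol N) (\<psi> ` W) \<and>
        homeomorphic_map (top_of_set W) (subtopology (topol N) (\<psi> ` W)) \<psi>"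
    using mN unfolding C2_manifold_def by (elim conjE)
  have cover: "carrier N = (\<Union>(W, \<psi>)\<in>atlas N. \<psi> ` W)"
    using mN unfolding C2_manifold_def by (elim conjE)
  \<comment> \<open>The inclusion of the leaf is given as C2 in terms of charts of \<open>S\<close>.
    Composing with such a chart makes \<open>\<kappa>\<close> itself C2 as a map into the ambient
    space, so that its second derivative is available and symmetric.\<close>
  have factor: "openin (top_of_set ?T) (V \<inter> \<kappa> -` (\<phi> ` U)) \<and> C2_on (V \<inter> \<kappa> -` (\<phi> ` U)) (inv_into U \<phi> \<circ> \<kappa>)
    \<and> C2_on (V \<inter> \<kappa> -` (\<phi> ` U)) \<kappa>"
    if \<kappa>: "(V, \<kappa>) \<in> atlas N" and \<phi>: "(U, \<phi>) \<in> atlas S" for V \<kappa> U \<phi>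
  proof -
    let ?V = "V \<inter> \<kappa> -` (\<phi> ` U)"
    have V: "openin (top_of_set ?T) V" "homeomorphic_map (top_of_set V) (subtopology (topol N) (\<kappa> ` V)) \<kappa>"
      using bspec[OF charts \<kappa>] by simp_all
    have "continuous_map (top_of_set V) (topol N) \<kappa>"
      using homeomorphic_imp_continuous_map[OF V(2)] continuous_map_into_fulltopology by blast
    moreover have "continuous_map (topol N) (topol S) (\<lambda>q. q)"
      using map by (simp add: C2_map_def)
    ultimately have "continuous_map (top_of_set V) (topol S) ((\<lambda>q. q) \<circ> \<kappa>)"
      by (rule continuous_map_compose)
    from openin_continuous_map_preimage[OF this chart_image_openin[OF \<phi>]]
    have "openin (top_of_set V) ?V"
      by (simp add: vimage_def Int_def)
    then have 1: "openin (top_of_set ?T) ?V"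
      using V(1) openin_trans by blast
    have "\<forall>(W, \<psi>)\<in>atlas N. \<forall>(W', \<phi>)\<in>atlas S.
        C2_on (W \<inter> ((\<lambda>q. q) \<circ> \<psi>) -` (\<phi> ` W')) (inv_into W' \<phi> \<circ> (\<lambda>q. q) \<circ> \<psi>)"
      using map unfolding C2_map_def by blast
    from bspec[OF bspec[OF this \<kappa>, unfolded case_prod_conv] \<phi>]
    have 2: "C2_on ?V (inv_into U \<phi> \<circ> \<kappa>)"
      by (simp add: comp_def vimage_def)
    have "C2_on ?V (\<lambda>z. \<phi> ((inv_into U \<phi> \<circ> \<kappa>) z))"
      by (rule C2_on_compose[OF 2 chart_C2[OF \<phi>]]) (auto intro: inv_into_into)
    then have "C2_on ?V \<kappa>"
      by (rule C2_on_cong[THEN iffD1, rotated]) (simp add: f_inv_into_f)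
    with 1 2 show ?thesis
      by blast
  qed
  have diff: "\<kappa> differentiable (at y within ?T)" if \<kappa>: "(V, \<kappa>) \<in> atlas N" "y \<in> V" for V \<kappa> y
  proof -
    have "\<kappa> y \<in> carrier N"
      using \<kappa> cover by blast
    then have "\<kappa> y \<in> carrier S"
      using N(1) by (auto simp: immersed_submanifold_def)
    then obtain U \<phi> z where \<phi>: "(U, \<phi>) \<in> atlas S" "z \<in> U" "\<phi> z = \<kappa> y"
      using chart_at by blast
    have y: "y \<in> V \<inter> \<kappa> -` (\<phi> ` U)"
      using \<kappa>(2) \<phi>(2,3) by (metis IntI image_eqI vimageI)
    obtain \<kappa>' where "(\<kappa> has_derivative blinfun_apply (\<kappa>' y)) (at y within (V \<inter> \<kappa> -` (\<phi> ` U)))"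
      using factor[OF \<kappa>(1) \<phi>(1)] y unfolding C2_on_def by blast
    then show ?thesis
      using at_within_openin_subspace[OF factor[OF \<kappa>(1) \<phi>(1), THEN conjunct1] y]
      by (auto simp: differentiable_def)
  qed
  obtain V0 \<kappa> y where \<kappa>: "(V0, \<kappa>) \<in> atlas N" "y \<in> V0" "\<kappa> y = \<psi> x"
    using p cover by auto
  define V where "V = V0 \<inter> \<kappa> -` (\<psi> ` W)"
  \<comment> \<open>The leaf in the coordinates of \<open>\<psi>\<close>; its derivative carries
    model vectors of the leaf to coordinate vectors of \<open>S\<close>.\<close>
  define \<tau> where "\<tau> = inv_into W \<psi> \<circ> \<kappa>"
  have V: "openin (top_of_set ?T) V" "C2_on V \<tau>" "C2_on V \<kappa>"
    using factor[OF \<kappa>(1) \<psi>(1)] by (auto simp: V_def \<tau>_def)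
  have y: "y \<in> V"
    using \<kappa>(2,3) \<psi>(2) by (auto simp: V_def)
  have \<tau>y: "\<tau> y = x"
    using \<kappa>(3) \<psi>(2) chart_inj_on[OF \<psi>(1)] by (simp add: \<tau>_def)
  have \<tau>V: "\<tau> ` V \<subseteq> W"
    by (auto simp: \<tau>_def V_def intro: inv_into_into)
  have \<psi>\<tau>: "\<psi> (\<tau> z) = \<kappa> z" if "z \<in> V" for z
    using that by (simp add: \<tau>_def V_def f_inv_into_f)
  obtain \<tau>' where \<tau>': "(\<tau> has_derivative blinfun_apply \<tau>') (at y within V)"
    using V(2) y unfolding C2_on_def by blast
  have chain: "((\<lambda>z. h (\<tau> z)) has_derivative (\<lambda>u. D h x (\<tau>' u))) (at y within V)"
    if "(h has_derivative D h x) (at x)" for h :: "'m \<Rightarrow> 'a"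
    using has_derivative_in_compose[OF \<tau>', of h "D h x"] that \<tau>y by (simp add: has_derivative_at_withinI)
  obtain \<kappa>' where \<kappa>': "\<And>z. z \<in> V \<Longrightarrow> (\<kappa> has_derivative blinfun_apply (\<kappa>' z)) (at z within V)"
    "C1_on V \<kappa>'"
    using V(3) unfolding C2_on_def by blast
  obtain \<kappa>'' where \<kappa>'': "(\<kappa>' has_derivative blinfun_apply \<kappa>'') (at y within V)"
    using \<kappa>'(2) y unfolding C1_on_def by blast
  have frechet_\<kappa>: "frechet_derivative \<kappa> (at z within ?T) u = \<kappa>' z u" if z: "z \<in> V" and u: "u \<in> ?T" for z u
  proof -
    have "\<kappa> differentiable (at z within V)"
      using \<kappa>'(1)[OF z] by (auto simp: differentiable_def)
    then have "(\<kappa> has_derivative frechet_derivative \<kappa> (at z within ?T)) (at z within V)"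
      using frechet_derivative_works at_within_openin_subspace[OF V(1) z] by metis
    then show ?thesis
      using has_derivative_unique_subspace[OF T V(1) z u _ \<kappa>'(1)[OF z]] by blast
  qed
  have orth: "v (\<kappa> z) \<bullet> \<kappa>' z u = 0" if z: "z \<in> V" and u: "u \<in> ?T" for z u
  proof -
    have "z \<in> V0" using z by (simp add: V_def)
    then have "\<kappa>' z u \<in> tangent_space N (\<kappa> z)" "\<kappa> z \<in> carrier N"
      using \<kappa>(1) u frechet_\<kappa>[OF z u] cover unfolding tangent_space_def by (auto, metis)
    then show ?thesis
      using N(2) by (simp add: orth_distribution_def inner_commute)
  qed
  have \<kappa>'y: "\<kappa>' y u = D \<psi> x (\<tau>' u)" if u: "u \<in> ?T" for u
  proof -
    have "(\<kappa> has_derivative (\<lambda>u. D \<psi> x (\<tau>' u))) (at y within V)"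
      using y _ chain[OF chart_has_derivative[OF \<psi>]] by (rule has_derivative_transform) (simp add: \<psi>\<tau>)
    then show ?thesis
      by (rule has_derivative_unique_subspace[OF T V(1) y u \<kappa>'(1)[OF y]])
  qed
  have v_chain: "((\<lambda>z. v (\<kappa> z)) has_derivative (\<lambda>u. D (v \<circ> \<psi>) x (\<tau>' u))) (at y within V)"
    using y _ chain[OF v_chart_has_derivative[OF \<psi>]] by (rule has_derivative_transform) (simp add: \<psi>\<tau>)
  \<comment> \<open>Differentiating \<open>orth\<close> in the direction \<open>h\<close> trades the
    derivative of \<open>v\<close> for the second derivative of \<open>\<kappa>\<close>, which is
    symmetric.\<close>
  have skew: "D (v \<circ> \<psi>) x (\<tau>' h) \<bullet> \<kappa>' y u = - (v (\<psi> x) \<bullet> \<kappa>'' h u)" if h: "h \<in> ?T" and u: "u \<in> ?T" for h u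
  proof -
    have "((\<lambda>z. \<kappa>' z u) has_derivative (\<lambda>h. \<kappa>'' h u)) (at y within V)"
      by (rule bounded_linear.has_derivative[OF blinfun.bounded_linear_left \<kappa>''])
    from has_derivative_inner[OF v_chain this]
    have "((\<lambda>z. v (\<kappa> z) \<bullet> \<kappa>' z u) has_derivative
      (\<lambda>h. v (\<kappa> y) \<bullet> \<kappa>'' h u + D (v \<circ> \<psi>) x (\<tau>' h) \<bullet> \<kappa>' y u)) (at y within V)" .
    then have "((\<lambda>z. 0) has_derivative
      (\<lambda>h. v (\<kappa> y) \<bullet> \<kappa>'' h u + D (v \<circ> \<psi>) x (\<tau>' h) \<bullet> \<kappa>' y u)) (at y within V)"
      by (rule has_derivative_transform[OF y, rotated]) (simp add: orth u)
    from has_derivative_unique_subspace[OF T V(1) y h this has_derivative_const]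
    show ?thesis
      using \<kappa>(3) by simp
  qed
  have "\<kappa>'' h u = \<kappa>'' u h" if "h \<in> ?T" "u \<in> ?T" for h u
    by (rule symmetric_second_derivative[OF T V(1) y that \<kappa>'(1) \<kappa>''])
  then have sym: "D (v \<circ> \<psi>) x (\<tau>' h) \<bullet> \<kappa>' y u = D (v \<circ> \<psi>) x (\<tau>' u) \<bullet> \<kappa>' y h"
    if "h \<in> ?T" "u \<in> ?T" for h u
    using that skew by simp
  \<comment> \<open>Every coordinate vector orthogonal to \<open>v\<close> comes from the leaf,
    whose tangent space is the whole fibre of the distribution.\<close>
  have lift: "\<exists>u\<in>?T. \<tau>' u = w" if w: "v (\<psi> x) \<bullet> D \<psi> x w = 0" for w
  proof -
    have "D \<psi> x w \<in> orth_distribution S v (\<psi> x)"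
      using w tangent_space_chart[OF \<psi>] by (auto simp: orth_distribution_def inner_commute)
    then have X: "D \<psi> x w \<in> tangent_space N (\<kappa> y)"
      using N(2) p \<kappa>(3) by simp
    obtain u where u: "u \<in> ?T" "D \<psi> x w = frechet_derivative \<kappa> (at y within ?T) u"
      by (rule tangent_space_within_chart[OF mN _ \<kappa>(1,2) X], erule (1) diff) (rule that)
    then have "D \<psi> x w = D \<psi> x (\<tau>' u)"
      using frechet_\<kappa>[OF y] \<kappa>'y by simp
    then have "w = \<tau>' u"
      using chart_derivative_inj[OF \<psi>] by (rule injD[rotated])
    with u(1) show ?thesis
      by blast
  qed
  obtain h u where "h \<in> ?T" "\<tau>' h = w" "u \<in> ?T" "\<tau>' u = w'"
    using lift w by blast
  then show ?thesis
    using sym[of h u] \<kappa>'y by simp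
qed

text \<open>Split coordinate vectors along the representative \<open>e\<close> of \<open>v\<close>.
  The bilinear form \<open>?B\<close> vanishes with \<open>e\<close> on the left since
  \<open>v\<close> is geodesic, and with \<open>e\<close> on the right since \<open>v\<close> has
  unit length; on the remaining parts it is symmetric by \<open>leaf_symmetric\<close>.\<close>

lemma integrable_geodesic_imp_curl_free:
  assumes lc: "levi_civita S nabla" and int: "integrable_distribution S (orth_distribution S v)"
    and geo: "\<forall>p\<in>carrier S. nabla v v p = 0"
  shows curl_free
  unfolding curl_free_def
proof clarify
  fix W \<psi> x w w' assume \<psi>: "(W, \<psi>) \<in> atlas S" "x \<in> W"
  let ?B = "\<lambda>w w'. D (v \<circ> \<psi>) x w \<bullet> D \<psi> x w'"
  have lin: "linear (D (v \<circ> \<psi>) x)" "linear (D \<psi> x)"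
    using has_derivative_linear v_chart_has_derivative[OF \<psi>] chart_has_derivative[OF \<psi>] by blast+
  have p: "\<psi> x \<in> carrier S"
    using chart_carrier[OF \<psi>] .
  obtain N :: "('a, 'm) mfd" where N: "immersed_submanifold N S" "\<psi> x \<in> carrier N"
    "\<And>q. q \<in> carrier N \<Longrightarrow> tangent_space N q = orth_distribution S v q"
    using int p unfolding integrable_distribution_def by blast
  obtain e where e: "D \<psi> x e = v (\<psi> x)"
    using v_chart_preimage[OF \<psi>] .
  have B_left: "?B e u = 0" for u
    using geo[unfolded geodesic_iff_chart[OF lc]] \<psi> e by blast
  have B_right: "?B u e = 0" for u
    using v_chart_derivative_orth[OF \<psi>] e by (simp add: inner_commute)
  define c where "c u = v (\<psi> x) \<bullet> D \<psi> x u" for u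
  have "v (\<psi> x) \<bullet> D \<psi> x (u - c u *\<^sub>R e) = 0" for u
    using v_inner_self[OF p] by (simp add: linear_diff[OF lin(2)] linear_cmul[OF lin(2)] e c_def inner_diff_right)
  then have "?B (w - c w *\<^sub>R e) (w' - c w' *\<^sub>R e) = ?B (w' - c w' *\<^sub>R e) (w - c w *\<^sub>R e)"
    by (intro leaf_symmetric[OF N(1,3) \<psi> N(2)])
  moreover have "?B (u - c u *\<^sub>R e) (u' - c u' *\<^sub>R e) = ?B u u'" for u u'
    using B_left B_right
    by (simp add: linear_diff[OF lin(2)] linear_cmul[OF lin(2)] linear_diff[OF lin(1)] linear_cmul[OF lin(1)]
        inner_diff_left inner_diff_right)
  ultimately show "?B w w' = ?B w' w"
    by simp
qed

text \<open>The leaf through \<open>\<psi> x0\<close> is the level set of the primitive \<open>f\<close>. The map \<open>G\<close> straightens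
  the level sets of \<open>f \<circ> \<psi>\<close> to the translates of the kernel of its derivative at \<open>x0\<close>.\<close>

lemma level_set_parametrization:
  assumes "(W, \<psi>) \<in> atlas S" "x0 \<in> W" "open B" "x0 \<in> B" "B \<subseteq> W" and f: "primitive (\<psi> ` B) f"
  obtains V g g' where "open V" "0 \<in> V" "g 0 = x0" "g ` V \<subseteq> B" "C2_on V g"
    "\<And>y. y \<in> V \<Longrightarrow> (g has_derivative g' y) (at y)"
    "\<And>y u. y \<in> V \<Longrightarrow> chart_form \<psi> (g y) (g' y u) = chart_form \<psi> x0 u"
    "\<And>y. y \<in> V \<Longrightarrow> bij (g' y)" "\<exists>G. homeomorphism V (g ` V) g G"
proof -
  let ?\<alpha> = "chart_form \<psi>"
  obtain e where "D \<psi> x0 e = v (\<psi> x0)"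
    using v_chart_preimage[OF assms(1,2)] .
  then have e: "?\<alpha> x0 e = 1"
    using v_inner_self[OF chart_carrier[OF assms(1,2)]] by (simp add: chart_form_apply[OF assms(1,2)])
  define h where "h = f \<circ> \<psi>"
  have h: "(h has_derivative blinfun_apply (?\<alpha> x)) (at x)" if "x \<in> B" for x
    unfolding h_def using that assms(5) by (intro primitiveD[OF f assms(1)]) auto
  have \<alpha>: "C1_on B ?\<alpha>"
    using C1_on_subset[OF C1_on_chart_form[OF assms(1)] assms(5)] .
  \<comment> \<open>Since the form at \<open>x0\<close> takes the value 1 on \<open>e\<close>, the
    correction gives \<open>chart_form \<psi> x0 (G x) = h x - h x0\<close>: level sets of
    \<open>h\<close> go to parallels of the kernel. The derivative at \<open>x0\<close> is the
    identity.\<close>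
  define G where "G x = (x - x0) + (h x - h x0 - ?\<alpha> x0 (x - x0)) *\<^sub>R e" for x
  define G' where "G' x = id_blinfun + (blinfun_scaleR_left e o\<^sub>L (?\<alpha> x - ?\<alpha> x0))" for x
  have G'_apply: "G' x u = u + (?\<alpha> x u - ?\<alpha> x0 u) *\<^sub>R e" for x u
    by (simp add: G'_def plus_blinfun.rep_eq minus_blinfun.rep_eq)
  have derG: "(G has_derivative blinfun_apply (G' x)) (at x)" if "x \<in> B" for x
    unfolding G_def[abs_def] G'_apply[abs_def]
    by (rule derivative_eq_intros h[OF that] refl | simp)+
  have contG: "continuous_on B G'"
    unfolding G'_def[abs_def]
    by (intro continuous_intros C1_on_imp_continuous_on[OF \<alpha>])
  have "id_blinfun o\<^sub>L G' x0 = id_blinfun"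
    by (intro blinfun_eqI) (simp add: G'_apply)
  from inverse_function_theorem[OF assms(3) derG contG assms(4) this]
  obtain U V g g' where U: "open U" "U \<subseteq> B" "x0 \<in> U" and V: "open V" "G x0 \<in> V" "homeomorphism U V G g"
    and g: "\<And>y. y \<in> V \<Longrightarrow> (g has_derivative (g' y)) (at y)"
      "\<And>y. y \<in> V \<Longrightarrow> g' y = inv (blinfun_apply (G' (g y)))"
      "\<And>y. y \<in> V \<Longrightarrow> bij (blinfun_apply (G' (g y)))"
    by blast
  have G0: "G x0 = 0"
    by (simp add: G_def blinfun.zero_right)
  have gV: "g ` V = U" "homeomorphism V U g G"
    using V(3) by (auto simp: homeomorphism_def)
  have gB: "g y \<in> B" if "y \<in> V" for y
    using that gV(1) U(2) by blast
  have G'g': "G' (g y) (g' y u) = u" if "y \<in> V" for y u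
    using g(2,3)[OF that] by (simp add: bij_is_surj surj_f_inv_f)
  have g'_form: "?\<alpha> (g y) (g' y u) = ?\<alpha> x0 u" if y: "y \<in> V" for y u
  proof -
    have "?\<alpha> x0 u = ?\<alpha> x0 (G' (g y) (g' y u))"
      using G'g'[OF y] by simp
    then show ?thesis
      unfolding G'_apply using e by (simp add: blinfun.add_right blinfun.scaleR_right)
  qed
  \<comment> \<open>Otherwise \<open>G' (g y)\<close> would annihilate \<open>e\<close>, against its
    bijectivity.\<close>
  have nz: "?\<alpha> (g y) e \<noteq> 0" if y: "y \<in> V" for y
  proof
    assume "?\<alpha> (g y) e = 0"
    then have "G' (g y) e = G' (g y) 0"
      using e by (simp add: G'_apply blinfun.zero_right)
    then have "e = 0"
      using bij_is_inj[OF g(3)[OF y]] by (simp add: inj_def)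
    then show False
      using e by (simp add: blinfun.zero_right)
  qed
  \<comment> \<open>The Sherman-Morrison formula for the inverse of a rank-one perturbation of the
    identity. It expresses the derivative of \<open>g\<close> through
    \<open>chart_form \<psi> (g y)\<close>, hence continuously; \<open>g\<close> is then C1, the
    same expression becomes C1, and \<open>g\<close> is C2.\<close>
  define \<gamma> where "\<gamma> y = id_blinfun -
    inverse (?\<alpha> (g y) e) *\<^sub>R (blinfun_scaleR_left e o\<^sub>L (?\<alpha> (g y) - ?\<alpha> x0))" for y
  have \<gamma>: "blinfun_apply (\<gamma> y) = g' y" if y: "y \<in> V" for y
  proof
    fix u
    define c where "c = ?\<alpha> (g y) (g' y u) - ?\<alpha> x0 (g' y u)"
    have u: "u = g' y u + c *\<^sub>R e"
      using G'g'[OF y, of u] by (simp add: G'_apply c_def)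
    have "?\<alpha> (g y) u = ?\<alpha> x0 u + c * ?\<alpha> (g y) e"
      using arg_cong[OF u, of "blinfun_apply (?\<alpha> (g y))"] g'_form[OF y, of u]
      by (simp add: blinfun.add_right blinfun.scaleR_right)
    then have c: "c = inverse (?\<alpha> (g y) e) * (?\<alpha> (g y) u - ?\<alpha> x0 u)"
      using nz[OF y] by simp
    have "\<gamma> y u = u - c *\<^sub>R e"
      unfolding c by (simp add: \<gamma>_def minus_blinfun.rep_eq scaleR_blinfun.rep_eq)
    also have "\<dots> = g' y u"
      using u by (metis add_diff_cancel_right')
    finally show "\<gamma> y u = g' y u" .
  qed
  have cont_g: "continuous_on V g"
    using V(3) by (simp add: homeomorphism_def)
  have "C1_on V g"
  proof (rule C1_onI)
    show "(g has_derivative blinfun_apply (\<gamma> y)) (at y within V)" if "y \<in> V" for y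
      using g(1)[OF that] \<gamma>[OF that] by (simp add: has_derivative_at_withinI)
    have "continuous_on V (\<lambda>y. ?\<alpha> (g y))"
      by (rule continuous_on_compose2[OF C1_on_imp_continuous_on[OF \<alpha>] cont_g]) (use gB in auto)
    then show "continuous_on V \<gamma>"
      unfolding \<gamma>_def[abs_def] using nz by (intro continuous_intros) auto
  qed
  then have \<alpha>g: "C1_on V (\<lambda>y. ?\<alpha> (g y))"
    by (rule C1_on_compose[OF _ \<alpha>]) (use gB in auto)
  have "C1_on V \<gamma>"
    unfolding \<gamma>_def[abs_def] using nz
    by (intro C1_on_diff C1_on_const C1_on_scaleR C1_on_inverse C1_on_blinfun_apply
        C1_on_blinfun_compose \<alpha>g) auto
  then have "C2_on V g"
    using g(1) \<gamma> by (intro C2_onI[of V g \<gamma>]) (auto intro: has_derivative_at_withinI)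
  moreover have "bij (g' y)" if "y \<in> V" for y
    using g(2,3)[OF that] by (simp add: bij_imp_bij_inv)
  moreover have "g 0 = x0"
    using V(3) U(3) G0 by (metis homeomorphism_apply1)
  moreover have "\<exists>G. homeomorphism V (g ` V) g G"
    using gV by auto
  ultimately show thesis
    using that[OF V(1), of g g'] V(2) G0 g(1) g'_form gB by (auto simp: image_subset_iff)
qed

text \<open>A piece of the leaf with a single chart is enough: the straightened parametrization
  restricted to the part \<open>Y\<close> of the kernel of the form at \<open>x0\<close>. Its
  tangent spaces are the right ones because \<open>g'\<close> maps that kernel onto the kernel at
  \<open>g y\<close>.\<close>

lemma curl_free_imp_integrable:
  assumes curl_free
  shows "integrable_distribution S (orth_distribution S v)"
  unfolding integrable_distribution_def
proof
  fix p assume "p \<in> carrier S"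
  then obtain W \<psi> x0 where \<psi>: "(W, \<psi>) \<in> atlas S" "x0 \<in> W" "\<psi> x0 = p"
    using chart_at by blast
  obtain r where r: "r > 0" "ball x0 r \<subseteq> W"
    using chart_open[OF \<psi>(1)] \<psi>(2) openE by blast
  obtain f where f: "primitive (\<psi> ` ball x0 r) f"
    using curl_free_imp_primitive[OF assms \<psi>(1) r(2)] .
  have "x0 \<in> ball x0 r" using r(1) by simp
  from level_set_parametrization[OF \<psi>(1,2) open_ball this r(2) f]
  obtain V g g' where V: "open V" "0 \<in> V" "g 0 = x0" "g ` V \<subseteq> ball x0 r" "C2_on V g"
    and g': "\<And>y. y \<in> V \<Longrightarrow> (g has_derivative g' y) (at y)"
      "\<And>y u. y \<in> V \<Longrightarrow> chart_form \<psi> (g y) (g' y u) = chart_form \<psi> x0 u"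
      "\<And>y. y \<in> V \<Longrightarrow> bij (g' y)" and hom: "\<exists>G. homeomorphism V (g ` V) g G"
    by blast
  define T where "T = {u. chart_form \<psi> x0 u = 0}"
  define Y where "Y = V \<inter> T"
  define \<kappa> where "\<kappa> = \<psi> \<circ> g"
  \<comment> \<open>The topology is inherited from \<open>S\<close> itself, which may be finer than
    the topology of the ambient space.\<close>
  define N :: "('a, 'm) mfd" where
    "N = \<lparr>model = T, topol = subtopology (topol S) (\<kappa> ` Y), atlas = {(Y, \<kappa>)}\<rparr>"
  have N_simps: "model N = T" "topol N = subtopology (topol S) (\<kappa> ` Y)" "atlas N = {(Y, \<kappa>)}"
    by (simp_all add: N_def)
  have T: "subspace T"
    unfolding T_def by (auto simp: subspace_def blinfun.zero_right blinfun.add_right blinfun.scaleR_right)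
  have Y: "openin (top_of_set T) Y"
    using V(1) by (auto simp: Y_def openin_open)
  have gW: "g y \<in> W" if "y \<in> Y" for y
    using that V(4) r(2) by (auto simp: Y_def)
  have \<kappa>S: "\<kappa> ` Y \<subseteq> carrier S"
    using gW chart_carrier[OF \<psi>(1)] by (auto simp: \<kappa>_def)
  have carN: "carrier N = \<kappa> ` Y"
    using \<kappa>S by (auto simp: carrier_def N_simps)
  have inj: "inj_on \<kappa> Y"
  proof -
    have "inj_on g V"
      using hom by (metis homeomorphism_apply1 inj_on_inverseI)
    then have "inj_on g Y"
      by (rule inj_on_subset) (simp add: Y_def)
    then show ?thesis
      unfolding \<kappa>_def using gW by (intro comp_inj_on inj_on_subset[OF chart_inj_on[OF \<psi>(1)]]) auto
  qed
  have \<kappa>': "(\<kappa> has_derivative (D \<psi> (g y) \<circ> g' y)) (at y within A)" if y: "y \<in> Y" for y A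
  proof -
    have "(\<kappa> has_derivative (D \<psi> (g y) \<circ> g' y)) (at y)"
      unfolding \<kappa>_def using y by (intro diff_chain_at g' chart_has_derivative[OF \<psi>(1)] gW) (auto simp: Y_def)
    then show ?thesis
      by (rule has_derivative_at_withinI)
  qed
  have frechet_\<kappa>: "frechet_derivative \<kappa> (at y within T) u = D \<psi> (g y) (g' y u)"
    if y: "y \<in> Y" and u: "u \<in> T" for y u
  proof -
    have "(\<kappa> has_derivative frechet_derivative \<kappa> (at y within T)) (at y within T)"
      using \<kappa>'[OF y] by (auto simp: differentiable_def frechet_derivative_works[symmetric])
    moreover have "y \<in> T" using y by (simp add: Y_def)
    ultimately show ?thesis
      using has_derivative_unique_subspace[OF T openin_subtopology_self _ u _ \<kappa>'[OF y]] by fastforce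
  qed
  \<comment> \<open>The restriction of \<open>g\<close> and the chart \<open>\<psi>\<close> are
    embeddings, hence so is their composite.\<close>
  have "homeomorphic_map (top_of_set Y) (subtopology (topol S) (\<kappa> ` Y)) \<kappa>"
  proof -
    obtain G where G: "homeomorphism V (g ` V) g G"
      using hom by blast
    have GY: "homeomorphism Y (g ` Y) g G"
      by (rule homeomorphism_of_subsets[OF G]) (auto simp: Y_def)
    then have "homeomorphic_maps (top_of_set Y) (top_of_set (g ` Y)) g G"
      by (auto simp: homeomorphic_maps_def homeomorphism_def)
    then have "homeomorphic_map (top_of_set Y) (top_of_set (g ` Y)) g"
      by (rule homeomorphic_maps_imp_map)
    moreover have "top_of_set (g ` Y) = subtopology (top_of_set W) (g ` Y)"
      using gW by (simp add: subtopology_subtopology Int_absorb1 image_subset_iff)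
    ultimately have "embedding_map (top_of_set Y) (top_of_set W) g"
      by (simp add: embedding_map_def)
    moreover have "embedding_map (top_of_set W) (topol S) \<psi>"
      using chart_homeomorphic[OF \<psi>(1)] by (simp add: embedding_map_def)
    ultimately have "embedding_map (top_of_set Y) (topol S) \<kappa>"
      unfolding \<kappa>_def by (rule embedding_map_compose)
    then show ?thesis
      by (simp add: embedding_map_def)
  qed
  then have homN: "homeomorphic_map (top_of_set Y) (subtopology (topol N) (\<kappa> ` Y)) \<kappa>"
    by (simp add: N_simps subtopology_subtopology)
  have C2_id: "C2_on Y (\<lambda>x. x)"
    by (rule C2_onI[of _ _ "\<lambda>_. id_blinfun"]) (auto simp: C1_on_const)
  have manN: "C2_manifold N"
    unfolding C2_manifold_def
  proof (intro conjI)
    show "Hausdorff_space (topol N)" "second_countable (topol N)"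
      using Hausdorff C2_manifold unfolding N_simps C2_manifold_def
      by (auto intro: Hausdorff_space_subtopology second_countable_subtopology)
    have "openin (topol N) (\<kappa> ` Y)"
      using carN unfolding carrier_def by (metis openin_topspace)
    then show "\<forall>(W, \<psi>)\<in>atlas N. openin (top_of_set (model N)) W \<and> openin (topol N) (\<psi> ` W) \<and>
        homeomorphic_map (top_of_set W) (subtopology (topol N) (\<psi> ` W)) \<psi>"
      using homN Y by (simp add: N_simps)
    have "C2_on (Y \<inter> \<kappa> -` (\<kappa> ` Y)) (inv_into Y \<kappa> \<circ> \<kappa>)"
      by (rule C2_on_cong[THEN iffD1, OF _ C2_on_subset[OF C2_id]]) (auto simp: inj)
    then show "\<forall>(W, \<psi>)\<in>atlas N. \<forall>(W', \<phi>)\<in>atlas N. C2_on (W \<inter> \<psi> -` (\<phi> ` W')) (inv_into W' \<phi> \<circ> \<psi>)"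
      by (simp add: N_simps)
  qed (use T carN in \<open>simp_all add: N_simps\<close>)
  have immN: "immersion N S (\<lambda>q. q)"
    unfolding immersion_def
  proof (intro conjI)
    show "C2_map N S (\<lambda>q. q)"
      unfolding C2_map_def
    proof (intro conjI)
      show "continuous_map (topol N) (topol S) (\<lambda>q. q)"
        unfolding N_simps by (rule continuous_map_from_subtopology) (simp add: continuous_map_id[unfolded id_def])
      have "C2_on (Y \<inter> ((\<lambda>q. q) \<circ> \<kappa>) -` (\<phi> ` W')) (inv_into W' \<phi> \<circ> (\<lambda>q. q) \<circ> \<kappa>)"
        if \<phi>: "(W', \<phi>) \<in> atlas S" for W' \<phi>
      proof -
        let ?A = "Y \<inter> ((\<lambda>q. q) \<circ> \<kappa>) -` (\<phi> ` W')"
        have "C2_on ?A (\<lambda>y. (inv_into W' \<phi> \<circ> \<psi>) (g y))"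
          by (rule C2_on_compose[OF C2_on_subset[OF V(5)] chart_transition[OF \<psi>(1) \<phi>]])
            (use gW in \<open>auto simp: Y_def \<kappa>_def\<close>)
        then show ?thesis
          by (simp add: \<kappa>_def comp_def)
      qed
      then show "\<forall>(W, \<psi>)\<in>atlas N. \<forall>(W', \<phi>)\<in>atlas S.
          C2_on (W \<inter> ((\<lambda>q. q) \<circ> \<psi>) -` (\<phi> ` W')) (inv_into W' \<phi> \<circ> (\<lambda>q. q) \<circ> \<psi>)"
        by (auto simp: N_simps)
    qed
    have "inj_on (frechet_derivative (inv_into W' \<phi> \<circ> (\<lambda>q. q) \<circ> \<kappa>) (at y within T)) T"
      if \<phi>: "(W', \<phi>) \<in> atlas S" and y: "y \<in> Y" "\<kappa> y \<in> \<phi> ` W'" for W' \<phi> y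
    proof -
      obtain z where z: "z \<in> W'" "\<psi> (g y) = \<phi> z"
        using y(2) by (auto simp: \<kappa>_def)
      obtain F where F: "((inv_into W' \<phi> \<circ> \<psi>) has_derivative F) (at (g y))"
        "\<And>w. D \<psi> (g y) w = D \<phi> z (F w)"
        using transition_derivative[OF \<psi>(1) \<phi> gW[OF y(1)] z] by blast
      let ?\<sigma> = "inv_into W' \<phi> \<circ> (\<lambda>q. q) \<circ> \<kappa>"
      have "(inv_into W' \<phi> \<circ> \<psi> \<circ> g has_derivative (F \<circ> g' y)) (at y)"
        using y(1) by (intro diff_chain_at g' F) (simp add: Y_def)
      then have \<sigma>: "(?\<sigma> has_derivative (F \<circ> g' y)) (at y within T)"
        by (simp add: \<kappa>_def comp_def has_derivative_at_withinI)
      then have "(?\<sigma> has_derivative frechet_derivative ?\<sigma> (at y within T)) (at y within T)"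
        by (auto simp: differentiable_def frechet_derivative_works[symmetric])
      moreover have "y \<in> T" using y by (simp add: Y_def)
      ultimately have eq: "frechet_derivative ?\<sigma> (at y within T) u = (F \<circ> g' y) u" if "u \<in> T" for u
        using has_derivative_unique_subspace[OF T openin_subtopology_self _ that _ \<sigma>] by fastforce
      have "inj (D \<psi> (g y))"
        using chart_derivative_inj[OF \<psi>(1) gW[OF y(1)]] .
      then have "inj F"
        using F(2) by (metis injD injI)
      moreover have "inj (g' y)"
        using g'(3) y(1) by (simp add: Y_def bij_is_inj)
      ultimately have "inj_on (F \<circ> g' y) T"
        using inj_compose inj_on_subset by blast
      then show ?thesis
        using eq by (simp cong: inj_on_cong)
    qed
    then show "\<forall>(W, \<psi>)\<in>atlas N. \<forall>(W', \<phi>)\<in>atlas S. \<forall>x \<in> W \<inter> ((\<lambda>q. q) \<circ> \<psi>) -` (\<phi> ` W').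
        inj_on (frechet_derivative (inv_into W' \<phi> \<circ> (\<lambda>q. q) \<circ> \<psi>) (at x within model N)) (model N)"
      by (auto simp: N_simps)
  qed
  have "tangent_space N q = orth_distribution S v q" if q: "q \<in> carrier N" for q
  proof -
    have form: "v (\<kappa> y) \<bullet> D \<psi> (g y) w = chart_form \<psi> (g y) w" if "y \<in> Y" for y w
      using chart_form_apply[OF \<psi>(1) gW[OF that]] by (simp add: \<kappa>_def)
    have tanS: "tangent_space S (\<kappa> y) = range (D \<psi> (g y))" if "y \<in> Y" for y
      using tangent_space_chart[OF \<psi>(1) gW[OF that]] by (simp add: \<kappa>_def)
    show ?thesis
    proof
      show "tangent_space N q \<subseteq> orth_distribution S v q"
      proof
        fix X assume "X \<in> tangent_space N q"
        then obtain y u where y: "y \<in> Y" "\<kappa> y = q" "u \<in> T" "X = frechet_derivative \<kappa> (at y within T) u"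
          unfolding tangent_space_def N_simps by auto
        then have "X = D \<psi> (g y) (g' y u)"
          using frechet_\<kappa> by simp
        moreover have "v q \<bullet> D \<psi> (g y) (g' y u) = 0"
          using form[OF y(1)] y g'(2)[of y u] by (auto simp: Y_def T_def)
        ultimately show "X \<in> orth_distribution S v q"
          using tanS[OF y(1)] y(2) by (auto simp: orth_distribution_def inner_commute)
      qed
      show "orth_distribution S v q \<subseteq> tangent_space N q"
      proof
        fix X assume X: "X \<in> orth_distribution S v q"
        obtain y where y: "y \<in> Y" "\<kappa> y = q"
          using q unfolding carN by auto
        then have yV: "y \<in> V" by (simp add: Y_def)
        obtain w where w: "X = D \<psi> (g y) w"
          using X tanS[OF y(1)] y(2) by (auto simp: orth_distribution_def)
        \<comment> \<open>Surjectivity of \<open>g' y\<close> supplies the preimage, and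
          preservation of the form places it in \<open>T\<close>.\<close>
        obtain u where u: "w = g' y u"
          using surjD[OF bij_is_surj[OF g'(3)[OF yV]], of w] by blast
        have "chart_form \<psi> (g y) w = 0"
          using X form[OF y(1), of w] y(2) w by (simp add: orth_distribution_def inner_commute)
        then have "u \<in> T"
          using g'(2)[OF yV, of u] u by (simp add: T_def)
        then have "X = frechet_derivative \<kappa> (at y within T) u"
          using frechet_\<kappa>[OF y(1)] w u by simp
        then show "X \<in> tangent_space N q"
          unfolding tangent_space_def N_simps using y \<open>u \<in> T\<close> by auto
      qed
    qed
  qed
  moreover have "immersed_submanifold N S"
    using manN immN carN \<kappa>S by (simp add: immersed_submanifold_def)
  moreover have "0 \<in> Y"
    using V(2) T by (simp add: Y_def subspace_0)
  then have "p \<in> carrier N"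
    using V(3) \<psi>(3) unfolding carN \<kappa>_def by (metis comp_apply image_eqI)
  ultimately show "\<exists>N :: ('a, 'm) mfd. immersed_submanifold N S \<and> p \<in> carrier N \<and>
      (\<forall>q\<in>carrier N. tangent_space N q = orth_distribution S v q)"
    by blast
qed

end


section \<open>Global primitives\<close>

lemma pathin_joinpaths:
  fixes p q :: "real \<Rightarrow> 'a::topological_space"
  assumes "pathin X p" "pathin X q" "p 1 = q 0"
  shows "pathin X (p +++ q)"
  unfolding pathin_def joinpaths_def
proof (rule continuous_map_cases_le)
  let ?I = "top_of_set {0..1::real}"
  show "continuous_map ?I euclideanreal (\<lambda>x. x)" "continuous_map ?I euclideanreal (\<lambda>x. 1/2)"
    by (simp_all add: continuous_map_from_subtopology)
  have "continuous_map (subtopology ?I {x \<in> topspace ?I. x \<le> 1/2}) ?I (\<lambda>x. 2 * x)"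
    by (auto simp: continuous_map_in_subtopology continuous_map_from_subtopology subtopology_subtopology
        intro!: continuous_intros)
  from continuous_map_compose[OF this assms(1)[unfolded pathin_def]]
  show "continuous_map (subtopology ?I {x \<in> topspace ?I. x \<le> 1/2}) X (\<lambda>x. p (2 * x))"
    by (simp add: comp_def)
  have "continuous_map (subtopology ?I {x \<in> topspace ?I. 1/2 \<le> x}) ?I (\<lambda>x. 2 * x - 1)"
    by (auto simp: continuous_map_in_subtopology continuous_map_from_subtopology subtopology_subtopology
        intro!: continuous_intros)
  from continuous_map_compose[OF this assms(2)[unfolded pathin_def]]
  show "continuous_map (subtopology ?I {x \<in> topspace ?I. 1/2 \<le> x}) X (\<lambda>x. q (2 * x - 1))"
    by (simp add: comp_def)
  show "p (2 * x) = q (2 * x - 1)" if "x = 1/2" for x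
    unfolding that using assms(3) by simp
qed

lemma pathin_reversepath:
  fixes p :: "real \<Rightarrow> 'a::topological_space"
  assumes "pathin X p"
  shows "pathin X (reversepath p)"
proof -
  have "continuous_map (top_of_set {0..1::real}) (top_of_set {0..1}) (\<lambda>x. 1 - x)"
    by (auto simp: continuous_map_in_subtopology intro!: continuous_intros)
  from continuous_map_compose[OF this assms[unfolded pathin_def]] show ?thesis
    by (simp add: pathin_def reversepath_def comp_def)
qed

section \<open>Continuation of local primitives\<close>

context unit_field
begin

lemma primitive_subset: "primitive U f \<Longrightarrow> V \<subseteq> U \<Longrightarrow> primitive V f"
  unfolding primitive_def by blast

lemma primitive_add_const:
  assumes "primitive U f"
  shows "primitive U (\<lambda>p. f p + c)"
  unfolding primitive_def
proof clarify
  fix W \<psi> x assume *: "(W, \<psi>) \<in> atlas S" "x \<in> W" "\<psi> x \<in> U"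
  show "((\<lambda>p. f p + c) \<circ> \<psi> has_derivative blinfun_apply (chart_form \<psi> x)) (at x)"
    using has_derivative_add_const[OF primitiveD[OF assms *]] by (simp add: comp_def)
qed

text \<open>On a coordinate ball, which is convex, the difference has derivative zero.\<close>

lemma primitive_diff_locally_constant:
  assumes U: "openin (topol S) U" "primitive U f" and V: "openin (topol S) V" "primitive V g"
    and p: "p \<in> U" "p \<in> V"
  obtains B where "openin (topol S) B" "p \<in> B" "B \<subseteq> U \<inter> V" "\<And>q. q \<in> B \<Longrightarrow> f q - g q = f p - g p"
proof -
  have "p \<in> carrier S"
    using openin_subset[OF U(1)] p(1) by (auto simp: carrier_def)
  then obtain W \<psi> x where \<psi>: "(W, \<psi>) \<in> atlas S" "x \<in> W" "\<psi> x = p"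
    using chart_at by blast
  have "open (W \<inter> \<psi> -` (U \<inter> V))" "x \<in> W \<inter> \<psi> -` (U \<inter> V)"
    using chart_open_vimage[OF \<psi>(1) openin_Int[OF U(1) V(1)]] \<psi> p by auto
  then obtain r where r: "r > 0" "ball x r \<subseteq> W \<inter> \<psi> -` (U \<inter> V)"
    using openE by blast
  have "((\<lambda>y. (f \<circ> \<psi>) y - (g \<circ> \<psi>) y) has_derivative (\<lambda>h. 0)) (at y within ball x r)"
    if "y \<in> ball x r" for y
  proof -
    have y: "y \<in> W" "\<psi> y \<in> U" "\<psi> y \<in> V"
      using r(2) that by auto
    show ?thesis
      using has_derivative_diff[OF primitiveD[OF U(2) \<psi>(1) y(1,2)] primitiveD[OF V(2) \<psi>(1) y(1,3)]]
      by (simp add: has_derivative_at_withinI)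
  qed
  from has_derivative_zero_constant[OF convex_ball this]
  obtain c where c: "\<And>y. y \<in> ball x r \<Longrightarrow> (f \<circ> \<psi>) y - (g \<circ> \<psi>) y = c"
    by blast
  have x: "x \<in> ball x r" using r(1) by simp
  show thesis
  proof (rule that[of "\<psi> ` ball x r"])
    show "openin (topol S) (\<psi> ` ball x r)"
      using chart_openin_image[OF \<psi>(1) open_ball] r(2) by auto
    show "p \<in> \<psi> ` ball x r"
      using x \<psi>(3) by auto
    show "\<psi> ` ball x r \<subseteq> U \<inter> V"
      using r(2) by auto
    show "f q - g q = f p - g p" if "q \<in> \<psi> ` ball x r" for q
      using that c c[OF x] \<psi>(3) by auto
  qed
qed

text \<open>\<open>G\<close> continues a primitive along \<open>H\<close>: it lifts \<open>H\<close> to the covering of \<^term>\<open>S\<close> by the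
  germs of local primitives.\<close>

definition primitive_along :: "'x::metric_space set \<Rightarrow> ('x \<Rightarrow> 'a) \<Rightarrow> ('x \<Rightarrow> real) \<Rightarrow> bool" where
  "primitive_along A H G \<longleftrightarrow> (\<forall>z\<in>A. \<exists>N U f. open N \<and> z \<in> N \<and> openin (topol S) U \<and> primitive U f \<and>
     (\<forall>y\<in>A \<inter> N. H y \<in> U \<and> G y = f (H y)))"

lemma primitive_alongE:
  assumes "primitive_along A H G" "z \<in> A"
  obtains N U f where "open N" "z \<in> N" "openin (topol S) U" "primitive U f"
    "\<And>y. y \<in> A \<Longrightarrow> y \<in> N \<Longrightarrow> H y \<in> U" "\<And>y. y \<in> A \<Longrightarrow> y \<in> N \<Longrightarrow> G y = f (H y)"
  using assms unfolding primitive_along_def by (metis IntI)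

lemma primitive_alongI:
  assumes "\<And>z. z \<in> A \<Longrightarrow> \<exists>N U f. open N \<and> z \<in> N \<and> openin (topol S) U \<and> primitive U f \<and>
     (\<forall>y\<in>A. y \<in> N \<longrightarrow> H y \<in> U \<and> G y = f (H y))"
  shows "primitive_along A H G"
  using assms unfolding primitive_along_def by fastforce

lemma primitive_along_subset:
  assumes "primitive_along A H G" "B \<subseteq> A"
  shows "primitive_along B H G"
proof (rule primitive_alongI)
  fix z assume "z \<in> B"
  then have "z \<in> A" using assms(2) by blast
  then obtain N U f where N: "open N" "z \<in> N" "openin (topol S) U" "primitive U f"
    "\<And>y. y \<in> A \<Longrightarrow> y \<in> N \<Longrightarrow> H y \<in> U" "\<And>y. y \<in> A \<Longrightarrow> y \<in> N \<Longrightarrow> G y = f (H y)"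
    using primitive_alongE[OF assms(1)] by metis
  show "\<exists>N U f. open N \<and> z \<in> N \<and> openin (topol S) U \<and> primitive U f \<and>
     (\<forall>y\<in>B. y \<in> N \<longrightarrow> H y \<in> U \<and> G y = f (H y))"
    by (rule exI[of _ N], rule exI[of _ U], rule exI[of _ f]) (use N assms(2) in auto)
qed

text \<open>Pullback along \<open>k\<close>, used to extract edges of a square and halves of a
  joined path. \<open>H'\<close> is kept separate because the composite is known in closed form only
  on \<open>B\<close>.\<close>

lemma primitive_along_compose:
  assumes "primitive_along A H G" "continuous_on B k" "k ` B \<subseteq> A" "\<And>y. y \<in> B \<Longrightarrow> H (k y) = H' y"
  shows "primitive_along B H' (\<lambda>y. G (k y))"
proof (rule primitive_alongI)
  fix z assume z: "z \<in> B"
  then have "k z \<in> A" using assms(3) by blast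
  then obtain N U f where N: "open N" "k z \<in> N" "openin (topol S) U" "primitive U f"
    "\<And>y. y \<in> A \<Longrightarrow> y \<in> N \<Longrightarrow> H y \<in> U" "\<And>y. y \<in> A \<Longrightarrow> y \<in> N \<Longrightarrow> G y = f (H y)"
    using primitive_alongE[OF assms(1)] by metis
  obtain N' where N': "open N'" "N' \<inter> B = k -` N \<inter> B"
    using assms(2) N(1) unfolding continuous_on_open_invariant by blast
  have "H' y \<in> U \<and> G (k y) = f (H' y)" if "y \<in> B" "y \<in> N'" for y
  proof -
    have "k y \<in> N" "k y \<in> A"
      using that N'(2) assms(3) by auto
    then show ?thesis
      using N(5,6)[of "k y"] assms(4)[OF that(1)] by simp
  qed
  moreover have "z \<in> N'"
    using z N(2) N'(2) by auto
  ultimately show "\<exists>N U f. open N \<and> z \<in> N \<and> openin (topol S) U \<and> primitive U f \<and>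
     (\<forall>y\<in>B. y \<in> N \<longrightarrow> H' y \<in> U \<and> G (k y) = f (H' y))"
    using N' N(3,4) by blast
qed

lemma primitive_along_add_const:
  assumes "primitive_along A H G"
  shows "primitive_along A H (\<lambda>y. G y + c)"
proof (rule primitive_alongI)
  fix z assume "z \<in> A"
  then obtain N U f where N: "open N" "z \<in> N" "openin (topol S) U" "primitive U f"
    "\<And>y. y \<in> A \<Longrightarrow> y \<in> N \<Longrightarrow> H y \<in> U" "\<And>y. y \<in> A \<Longrightarrow> y \<in> N \<Longrightarrow> G y = f (H y)"
    using primitive_alongE[OF assms] by metis
  show "\<exists>N U f. open N \<and> z \<in> N \<and> openin (topol S) U \<and> primitive U f \<and>
     (\<forall>y\<in>A. y \<in> N \<longrightarrow> H y \<in> U \<and> G y + c = f (H y))"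
    by (rule exI[of _ N], rule exI[of _ U], rule exI[of _ "\<lambda>p. f p + c"])
      (use N primitive_add_const[OF N(4)] in auto)
qed

lemma continuous_map_vimage_open:
  fixes H :: "'x::metric_space \<Rightarrow> 'a"
  assumes "continuous_map (top_of_set A) (topol S) H" "openin (topol S) B"
  obtains N where "open N" "\<And>y. y \<in> A \<Longrightarrow> H y \<in> B \<longleftrightarrow> y \<in> N"
proof -
  have "openin (top_of_set A) {y \<in> topspace (top_of_set A). H y \<in> B}"
    using openin_continuous_map_preimage[OF assms] .
  then obtain N where "open N" "{y \<in> A. H y \<in> B} = A \<inter> N"
    by (auto simp: openin_open)
  then show thesis
    by (intro that[of N]) auto
qed

text \<open>Unique lifting up to a constant: near each point both continuations are local primitives
  composed with \<open>H\<close>, so their difference is locally constant on a connected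
  set.\<close>

lemma primitive_along_unique:
  assumes H: "continuous_map (top_of_set A) (topol S) H" and A: "connected A"
    and G: "primitive_along A H G" "primitive_along A H G'" and y: "y \<in> A" "z \<in> A"
  shows "G y - G z = G' y - G' z"
proof -
  have "(\<lambda>y. G y - G' y) constant_on A"
  proof (rule locally_constant_imp_constant[OF A])
    fix z assume z: "z \<in> A"
    obtain N U f where N: "open N" "z \<in> N" "openin (topol S) U" "primitive U f"
      "\<And>y. y \<in> A \<Longrightarrow> y \<in> N \<Longrightarrow> H y \<in> U" "\<And>y. y \<in> A \<Longrightarrow> y \<in> N \<Longrightarrow> G y = f (H y)"
      using primitive_alongE[OF G(1) z] by metis
    obtain N' U' f' where N': "open N'" "z \<in> N'" "openin (topol S) U'" "primitive U' f'"
      "\<And>y. y \<in> A \<Longrightarrow> y \<in> N' \<Longrightarrow> H y \<in> U'" "\<And>y. y \<in> A \<Longrightarrow> y \<in> N' \<Longrightarrow> G' y = f' (H y)"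
      using primitive_alongE[OF G(2) z] by metis
    obtain B where B: "openin (topol S) B" "H z \<in> B" "\<And>q. q \<in> B \<Longrightarrow> f q - f' q = f (H z) - f' (H z)"
      using primitive_diff_locally_constant[OF N(3,4) N'(3,4) N(5)[OF z N(2)] N'(5)[OF z N'(2)]] by metis
    obtain O' where O': "open O'" "\<And>y. y \<in> A \<Longrightarrow> H y \<in> B \<longleftrightarrow> y \<in> O'"
      using continuous_map_vimage_open[OF H B(1)] by metis
    let ?T = "A \<inter> (N \<inter> N' \<inter> O')"
    have "openin (top_of_set A) ?T"
      using N(1) N'(1) O'(1) by (simp add: openin_open_Int open_Int)
    moreover have "z \<in> ?T"
      using z N(2) N'(2) O' B(2) by auto
    moreover have "G y - G' y = G z - G' z" if "y \<in> ?T" for y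
      using that B(3)[of "H y"] O'(2)[of y] N(6)[of y] N'(6)[of y] N(6)[OF z N(2)] N'(6)[OF z N'(2)] by auto
    ultimately show "\<exists>T. openin (top_of_set A) T \<and> z \<in> T \<and> (\<forall>y\<in>T. G y - G' y = G z - G' z)"
      by blast
  qed
  then have "G y - G' y = G z - G' z"
    using y unfolding constant_on_def by metis
  then show ?thesis
    by simp
qed

text \<open>Connectedness of the overlap gives one constant by which the continuations differ there.
  Closedness gives a point of only one set a neighbourhood avoiding the other; at a common point the
  two local primitives agree near \<open>H z\<close> after the shift, and one of them serves both
  sides.\<close>

lemma primitive_along_Un:
  assumes H: "continuous_map (top_of_set (A \<union> B)) (topol S) H" and cl: "closed A" "closed B" and AB: "connected (A \<inter> B)"
    and G: "primitive_along A H G" "primitive_along B H G'"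
  shows "\<exists>K. primitive_along (A \<union> B) H K"
proof -
  obtain c where c: "\<And>y. y \<in> A \<inter> B \<Longrightarrow> G y = G' y + c"
  proof (cases "A \<inter> B = {}")
    case False
    then obtain z where z: "z \<in> A \<inter> B" by blast
    have "continuous_map (top_of_set (A \<inter> B)) (topol S) H"
      using H by (rule continuous_map_from_subtopology_mono) auto
    from primitive_along_unique[OF this AB primitive_along_subset[OF G(1)] primitive_along_subset[OF G(2)] _ z]
    have "G y = G' y + (G z - G' z)" if "y \<in> A \<inter> B" for y
      using that by fastforce
    then show thesis
      by (rule that)
  qed (use that in blast)
  define G2 where "G2 y = G' y + c" for y
  have G2: "primitive_along B H G2"
    unfolding G2_def[abs_def] by (rule primitive_along_add_const[OF G(2)])
  have agree: "G y = G2 y" if "y \<in> A" "y \<in> B" for y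
    using c that by (simp add: G2_def)
  define K where "K y = (if y \<in> A then G y else G2 y)" for y
  have "primitive_along (A \<union> B) H K"
  proof (rule primitive_alongI)
    fix z assume "z \<in> A \<union> B"
    then consider "z \<in> A" "z \<notin> B" | "z \<notin> A" "z \<in> B" | "z \<in> A" "z \<in> B" by blast
    then show "\<exists>N U f. open N \<and> z \<in> N \<and> openin (topol S) U \<and> primitive U f \<and>
      (\<forall>y\<in>A \<union> B. y \<in> N \<longrightarrow> H y \<in> U \<and> K y = f (H y))"
    proof cases
      case 1
      obtain N U f where N: "open N" "z \<in> N" "openin (topol S) U" "primitive U f"
        "\<And>y. y \<in> A \<Longrightarrow> y \<in> N \<Longrightarrow> H y \<in> U" "\<And>y. y \<in> A \<Longrightarrow> y \<in> N \<Longrightarrow> G y = f (H y)"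
        using primitive_alongE[OF G(1) 1(1)] by metis
      show ?thesis
        by (rule exI[of _ "N - B"], rule exI[of _ U], rule exI[of _ f])
          (use N cl 1 in \<open>auto simp: K_def\<close>)
    next
      case 2
      obtain N U f where N: "open N" "z \<in> N" "openin (topol S) U" "primitive U f"
        "\<And>y. y \<in> B \<Longrightarrow> y \<in> N \<Longrightarrow> H y \<in> U" "\<And>y. y \<in> B \<Longrightarrow> y \<in> N \<Longrightarrow> G2 y = f (H y)"
        using primitive_alongE[OF G2 2(2)] by metis
      show ?thesis
        by (rule exI[of _ "N - A"], rule exI[of _ U], rule exI[of _ f])
          (use N cl 2 in \<open>auto simp: K_def\<close>)
    next
      case 3
      obtain N U f where N: "open N" "z \<in> N" "openin (topol S) U" "primitive U f"
        "\<And>y. y \<in> A \<Longrightarrow> y \<in> N \<Longrightarrow> H y \<in> U" "\<And>y. y \<in> A \<Longrightarrow> y \<in> N \<Longrightarrow> G y = f (H y)"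
        using primitive_alongE[OF G(1) 3(1)] by metis
      obtain N' U' f' where N': "open N'" "z \<in> N'" "openin (topol S) U'" "primitive U' f'"
        "\<And>y. y \<in> B \<Longrightarrow> y \<in> N' \<Longrightarrow> H y \<in> U'" "\<And>y. y \<in> B \<Longrightarrow> y \<in> N' \<Longrightarrow> G2 y = f' (H y)"
        using primitive_alongE[OF G2 3(2)] by metis
      obtain V where V: "openin (topol S) V" "H z \<in> V" "V \<subseteq> U \<inter> U'"
        "\<And>q. q \<in> V \<Longrightarrow> f q - f' q = f (H z) - f' (H z)"
        using primitive_diff_locally_constant[OF N(3,4) N'(3,4) N(5)[OF 3(1) N(2)] N'(5)[OF 3(2) N'(2)]] by metis
      have "f (H z) = f' (H z)"
        using N(6)[OF 3(1) N(2)] N'(6)[OF 3(2) N'(2)] agree[OF 3] by simp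
      then have ff': "f q = f' q" if "q \<in> V" for q
        using V(4)[OF that] by simp
      obtain O' where O': "open O'" "\<And>y. y \<in> A \<union> B \<Longrightarrow> H y \<in> V \<longleftrightarrow> y \<in> O'"
        using continuous_map_vimage_open[OF H V(1)] by metis
      have "H y \<in> V \<and> K y = f (H y)" if "y \<in> A \<union> B" "y \<in> N \<inter> N' \<inter> O'" for y
        using that O'(2)[of y] N(6)[of y] N'(6)[of y] ff'[of "H y"] by (auto simp: K_def)
      moreover have "open (N \<inter> N' \<inter> O')" "z \<in> N \<inter> N' \<inter> O'"
        using N(1,2) N'(1,2) O' 3 V(2) by auto
      moreover have "primitive V f"
        using primitive_subset[OF N(4)] V(3) by blast
      ultimately show ?thesis
        using V(1) by blast
    qed
  qed
  then show ?thesis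
    by blast
qed

lemma primitive_along_local:
  fixes H :: "'x::metric_space \<Rightarrow> 'a"
  assumes curl_free and H: "continuous_map (top_of_set A) (topol S) H" and z: "z \<in> A"
  obtains N G where "open N" "z \<in> N" "primitive_along (A \<inter> N) H G"
proof -
  have "H z \<in> carrier S"
    using continuous_map_image_subset_topspace[OF H] z by (auto simp: carrier_def)
  then obtain U f where U: "openin (topol S) U" "H z \<in> U" "primitive U f"
    using assms(1) curl_free_iff_local_primitive by blast
  obtain N where N: "open N" "\<And>y. y \<in> A \<Longrightarrow> H y \<in> U \<longleftrightarrow> y \<in> N"
    using continuous_map_vimage_open[OF H U(1)] by metis
  have "primitive_along (A \<inter> N) H (\<lambda>y. f (H y))"
    by (rule primitive_alongI, rule exI[of _ N], rule exI[of _ U], rule exI[of _ f]) (use N U in auto)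
  moreover have "z \<in> N"
    using N(2) z U(2) by blast
  ultimately show thesis
    using N(1) that by blast
qed

text \<open>Bisection in each variable plays the role of a Lebesgue number. Adjacent rectangles meet
  in a degenerate rectangle, which is convex and so connected, as \<open>primitive_along_Un\<close>
  demands.\<close>

lemma primitive_along_square:
  fixes H :: "real \<times> real \<Rightarrow> 'a"
  defines "Q \<equiv> {0..1} \<times> {0..1}"
  assumes cf: curl_free and H: "continuous_map (top_of_set Q) (topol S) H"
  obtains G where "primitive_along Q H G"
proof -
  \<comment> \<open>Clipping to \<open>Q\<close> admits strips that stick out at the edges of the
    square; a rectangle may also be empty, which still counts as connected.\<close>
  define R where "R a b c d = Q \<inter> ({a..b} \<times> {c..d})" for a b c d :: real
  have R: "closed (R a b c d)" "connected (R a b c d)" "R a b c d \<subseteq> Q" for a b c d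
    by (auto simp: R_def Q_def intro!: closed_Int closed_Times convex_connected convex_Int convex_Times)
  have glue: "\<exists>G. primitive_along C H G"
    if "C \<subseteq> Q" "C = R a b c d \<union> R a' b' c' d'" "R a b c d \<inter> R a' b' c' d' = R a'' b'' c'' d''"
      "primitive_along (R a b c d) H G" "primitive_along (R a' b' c' d') H G'"
    for C a b c d a' b' c' d' a'' b'' c'' d'' G G'
    unfolding that(2)
    by (rule primitive_along_Un[OF _ R(1) R(1) _ that(4,5)])
      (use that R continuous_map_from_subtopology_mono[OF H] in auto)
  have strip: "\<exists>e>0. \<exists>G. primitive_along (R (s - e) (s + e) 0 1) H G" if s: "0 \<le> s" "s \<le> 1" for s
  proof -
    \<comment> \<open>The half-width \<open>e\<close> is existential so that gluing two rectangles
      may shrink it to the smaller one.\<close>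
    define P where "P a b \<longleftrightarrow> (\<exists>e>0. \<exists>G. primitive_along (R (s - e) (s + e) a b) H G)" for a b
    have "0 \<le> (1::real)" by simp
    then have "P 0 1"
    proof (induct rule: Bolzano)
      case (trans a b c)
      then obtain e G e' G' where e: "e > 0" "primitive_along (R (s - e) (s + e) a b) H G"
        "e' > 0" "primitive_along (R (s - e') (s + e') b c) H G'"
        unfolding P_def by blast
      define d where "d = min e e'"
      have "\<exists>G. primitive_along (R (s - d) (s + d) a c) H G"
      proof (rule glue)
        show "primitive_along (R (s - d) (s + d) a b) H G" "primitive_along (R (s - d) (s + d) b c) H G'"
          by (rule primitive_along_subset[OF e(2)] primitive_along_subset[OF e(4)], force simp: R_def d_def)+
        show "R (s - d) (s + d) a b \<inter> R (s - d) (s + d) b c = R (s - d) (s + d) b b"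
          "R (s - d) (s + d) a c = R (s - d) (s + d) a b \<union> R (s - d) (s + d) b c"
          using trans(3,4) by (auto simp: R_def)
      qed (rule R)
      then show ?case
        unfolding P_def using e(1,3) by (intro exI[of _ d]) (simp add: d_def)
    next
      case (local t)
      have "(s, t) \<in> Q"
        using s local by (simp add: Q_def)
      then obtain N G where N: "open N" "(s, t) \<in> N" "primitive_along (Q \<inter> N) H G"
        using primitive_along_local[OF cf H] by blast
      obtain A B where AB: "open A" "open B" "(s, t) \<in> A \<times> B" "A \<times> B \<subseteq> N"
        using N(1,2) open_prod_elim by metis
      obtain e where e: "e > 0" "cball s e \<subseteq> A"
        using AB(1,3) open_contains_cball by blast
      obtain e' where e': "e' > 0" "cball t e' \<subseteq> B"
        using AB(2,3) open_contains_cball by blast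
      have "primitive_along (R (s - e) (s + e) a b) H G" if "a \<le> t" "t \<le> b" "b - a < e'" for a b
      proof (rule primitive_along_subset[OF N(3)])
        have "{s - e..s + e} \<subseteq> A"
          using e(2) by (simp add: cball_eq_atLeastAtMost)
        moreover have "{a..b} \<subseteq> B"
          using e'(2) that by (force simp: cball_eq_atLeastAtMost)
        ultimately show "R (s - e) (s + e) a b \<subseteq> Q \<inter> N"
          using AB(4) unfolding R_def by blast
      qed
      then show ?case
        unfolding P_def using e(1) e'(1) by blast
    qed
    then show ?thesis
      by (simp add: P_def)
  qed
  define P where "P a b \<longleftrightarrow> (\<exists>G. primitive_along (R a b 0 1) H G)" for a b
  have "0 \<le> (1::real)" by simp
  then have "P 0 1"
  proof (induct rule: Bolzano)
    case (trans a b c)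
    then obtain G G' where G: "primitive_along (R a b 0 1) H G" "primitive_along (R b c 0 1) H G'"
      unfolding P_def by blast
    show ?case
      unfolding P_def
    proof (rule glue[OF _ _ _ G])
      show "R a b 0 1 \<inter> R b c 0 1 = R b b 0 1" "R a c 0 1 = R a b 0 1 \<union> R b c 0 1"
        using trans(3,4) by (auto simp: R_def)
    qed (rule R)
  next
    case (local s)
    then obtain e G where e: "e > 0" "primitive_along (R (s - e) (s + e) 0 1) H G"
      using strip by blast
    have "primitive_along (R a b 0 1) H G" if "a \<le> s" "s \<le> b" "b - a < e" for a b
      by (rule primitive_along_subset[OF e(2)]) (use that in \<open>auto simp: R_def\<close>)
    then show ?case
      unfolding P_def using e(1) by blast
  qed
  moreover have "R 0 1 0 1 = Q"
    by (simp add: R_def Q_def)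
  ultimately show thesis
    using that by (auto simp: P_def)
qed

section \<open>Paths and monodromy\<close>

lemma primitive_along_path:
  assumes curl_free "pathin (topol S) p"
  obtains G where "primitive_along {0..1} p G"
proof -
  \<comment> \<open>A path is read as a map of the square that does not depend on the first
    variable.\<close>
  have "continuous_map (top_of_set ({0..1::real} \<times> {0..1::real})) (top_of_set {0..1::real}) snd"
    by (auto simp: continuous_map_in_subtopology intro!: continuous_intros)
  from continuous_map_compose[OF this assms(2)[unfolded pathin_def]]
  obtain G where G: "primitive_along ({0..1::real} \<times> {0..1}) (p \<circ> snd) G"
    by (rule primitive_along_square[OF assms(1)])
  have "primitive_along {0..1} p (\<lambda>t. G (0, t))"
    by (rule primitive_along_compose[OF G]) (auto intro!: continuous_intros)
  then show thesis
    by (rule that)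
qed

text \<open>Continue over the square of a homotopy through loops to a constant loop. Bottom and top
  edge trace the same curve and give equal increments, the right edge is constant and gives none;
  hence neither does the left edge, which is the loop.\<close>

lemma primitive_along_loop:
  assumes cf: curl_free and sc: "simply_connected_space (topol S)"
    and p: "pathin (topol S) p" "p 1 = p 0" and G: "primitive_along {0..1} p G"
  shows "G 1 = G 0"
proof -
  let ?I = "{0..1::real}"
  have p0: "p 0 \<in> topspace (topol S)"
    using path_start_in_topspace[OF p(1)] .
  then have "homotopic_with (\<lambda>r. r 1 = r 0) (top_of_set ?I) (topol S) p (\<lambda>t. p 0)"
    using sc[unfolded simply_connected_space_def, rule_format, of p "\<lambda>t. p 0"] p by simp
  then obtain h where h: "continuous_map (prod_topology (top_of_set ?I) (top_of_set ?I)) (topol S) h"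
    "\<And>t. h (0, t) = p t" "\<And>t. h (1, t) = p 0" "\<And>s. s \<in> ?I \<Longrightarrow> h (s, 1) = h (s, 0)"
    unfolding homotopic_with_def by blast
  have ch: "continuous_map (top_of_set (?I \<times> ?I)) (topol S) h"
    using h(1) by (simp add: subtopology_Times[symmetric])
  obtain K where K: "primitive_along (?I \<times> ?I) h K"
    using primitive_along_square[OF cf ch] .
  have along: "primitive_along ?I (\<lambda>t. h (k t)) (\<lambda>t. K (k t))"
    "continuous_map (top_of_set ?I) (topol S) (\<lambda>t. h (k t))"
    if "continuous_on ?I k" "k ` ?I \<subseteq> ?I \<times> ?I" for k
  proof -
    show "primitive_along ?I (\<lambda>t. h (k t)) (\<lambda>t. K (k t))"
      by (rule primitive_along_compose[OF K that]) simp
    have "continuous_map (top_of_set ?I) (top_of_set (?I \<times> ?I)) k"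
      using that by (auto simp: continuous_map_in_subtopology)
    from continuous_map_compose[OF this ch]
    show "continuous_map (top_of_set ?I) (topol S) (\<lambda>t. h (k t))"
      by (simp add: comp_def)
  qed
  have k: "continuous_on ?I (\<lambda>s. (s, 0))" "continuous_on ?I (\<lambda>s. (s, 1))" "continuous_on ?I (\<lambda>t. (0, t))"
    "continuous_on ?I (\<lambda>t. (1, t))"
    by (auto intro!: continuous_intros)
  have "(\<lambda>s. (s, 0)) ` ?I \<subseteq> ?I \<times> ?I"
    by auto
  note bottom = along[OF k(1) this]
  have "primitive_along ?I (\<lambda>s. h (s, 0)) (\<lambda>s. K (s, 1))"
    by (rule primitive_along_compose[OF K k(2)]) (auto simp: h(4))
  from primitive_along_unique[OF bottom(2) connected_Icc this bottom(1), of 1 0]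
  have 1: "K (1, 1) - K (0, 1) = K (1, 0) - K (0, 0)"
    by simp
  have left: "primitive_along ?I p (\<lambda>t. K (0, t))"
    by (rule primitive_along_compose[OF K k(3)]) (auto simp: h(2))
  from primitive_along_unique[OF p(1)[unfolded pathin_def] connected_Icc G this, of 1 0]
  have 2: "G 1 - G 0 = K (0, 1) - K (0, 0)"
    by simp
  have right: "primitive_along ?I (\<lambda>t. p 0) (\<lambda>t. K (1, t))"
    by (rule primitive_along_compose[OF K k(4)]) (auto simp: h(3))
  have "primitive_along ?I (\<lambda>t. p 0) (\<lambda>t. K (1, 0))"
    by (rule primitive_along_compose[OF K, where k = "\<lambda>t. (1, 0)"]) (auto simp: h(3))
  from primitive_along_unique[OF _ connected_Icc right this, of 1 0]
  have "K (1, 1) - K (1, 0) = 0"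
    using p0 by simp
  with 1 2 show ?thesis
    by simp
qed

text \<open>The loop that follows \<open>p\<close> and returns along \<open>q\<close> has increment
  zero, and its two halves reproduce the given continuations up to constants.\<close>

lemma primitive_along_path_independent:
  assumes cf: curl_free and sc: "simply_connected_space (topol S)"
    and p: "pathin (topol S) p" "primitive_along {0..1} p G"
    and q: "pathin (topol S) q" "primitive_along {0..1} q G'"
    and ends: "p 0 = q 0" "p 1 = q 1"
  shows "G 1 - G 0 = G' 1 - G' 0"
proof -
  let ?r = "p +++ reversepath q"
  have r: "pathin (topol S) ?r"
    using p(1) pathin_reversepath[OF q(1)] ends(2) by (intro pathin_joinpaths) (simp_all add: reversepath_def)
  obtain K where K: "primitive_along {0..1} ?r K"
    using primitive_along_path[OF cf r] .
  have "primitive_along {0..1} p (\<lambda>t. K (t / 2))"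
    by (rule primitive_along_compose[OF K]) (auto simp: joinpaths_def intro!: continuous_intros)
  from primitive_along_unique[OF p(1)[unfolded pathin_def] connected_Icc p(2) this, of 1 0]
  have 1: "G 1 - G 0 = K (1 / 2) - K 0"
    by simp
  \<comment> \<open>The parameter runs backwards through the second half of the loop, that is, along
    \<open>q\<close> in its own direction.\<close>
  have "primitive_along {0..1} q (\<lambda>t. K (1 - t / 2))"
    by (rule primitive_along_compose[OF K])
      (use ends in \<open>auto simp: joinpaths_def reversepath_def intro!: continuous_intros\<close>)
  from primitive_along_unique[OF q(1)[unfolded pathin_def] connected_Icc q(2) this, of 1 0]
  have 2: "G' 1 - G' 0 = K (1 / 2) - K 1"
    by simp
  have "K 1 = K 0"
    by (rule primitive_along_loop[OF cf sc r _ K]) (simp add: joinpaths_def reversepath_def ends(1))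
  with 1 2 show ?thesis
    by simp
qed

text \<open>\<open>simply_connected_space\<close> makes any two loops freely homotopic, so it
  contains path-connectedness: for two constant loops the track of the base point is a path.\<close>

lemma simply_connected_imp_path:
  assumes "simply_connected_space (topol S)" "b \<in> carrier S" "x \<in> carrier S"
  obtains p where "pathin (topol S) p" "p 0 = b" "p 1 = x"
proof -
  let ?I = "{0..1::real}"
  have "homotopic_with (\<lambda>r. r 1 = r 0) (top_of_set ?I) (topol S) (\<lambda>t. b) (\<lambda>t. x)"
    using assms unfolding simply_connected_space_def carrier_def by simp
  then obtain h where h: "continuous_map (prod_topology (top_of_set ?I) (top_of_set ?I)) (topol S) h"
    "\<And>t. h (0, t) = b" "\<And>t. h (1, t) = x"
    unfolding homotopic_with_def by blast
  have ch: "continuous_map (top_of_set (?I \<times> ?I)) (topol S) h"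
    using h(1) by (simp add: subtopology_Times[symmetric])
  have "continuous_map (top_of_set ?I) (top_of_set (?I \<times> ?I)) (\<lambda>s. (s, 0))"
    by (auto simp: continuous_map_in_subtopology intro!: continuous_intros)
  from continuous_map_compose[OF this ch]
  have "pathin (topol S) (\<lambda>s. h (s, 0))"
    by (simp add: pathin_def comp_def)
  then show thesis
    using that[of "\<lambda>s. h (s, 0)"] h(2,3) by simp
qed

text \<open>The value at \<open>x\<close> is the increment of a continuation along any path from a
  base point, which is well defined by \<open>primitive_along_path_independent\<close>. Prolonging a
  path by the image of a coordinate segment shows that it differs from a local primitive by a
  constant.\<close>

lemma simply_connected_imp_primitive:
  assumes cf: curl_free and sc: "simply_connected_space (topol S)"
  obtains f where "primitive (carrier S) f"
proof (cases "carrier S = {}")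
  case True
  then have "primitive (carrier S) (\<lambda>_. 0)"
    by (simp add: primitive_def)
  then show thesis
    by (rule that)
next
  case False
  then obtain b where b: "b \<in> carrier S" by blast
  have "\<exists>c. \<forall>p G. pathin (topol S) p \<longrightarrow> p 0 = b \<longrightarrow> p 1 = x \<longrightarrow> primitive_along {0..1} p G \<longrightarrow>
    G 1 - G 0 = c" if x: "x \<in> carrier S" for x
  proof -
    obtain p where p: "pathin (topol S) p" "p 0 = b" "p 1 = x"
      using simply_connected_imp_path[OF sc b x] .
    obtain G where "primitive_along {0..1} p G"
      using primitive_along_path[OF cf p(1)] .
    then have "\<forall>q G'. pathin (topol S) q \<longrightarrow> q 0 = b \<longrightarrow> q 1 = x \<longrightarrow> primitive_along {0..1} q G' \<longrightarrow>
      G' 1 - G' 0 = G 1 - G 0"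
      using primitive_along_path_independent[OF cf sc _ _ p(1)] p by metis
    then show ?thesis ..
  qed
  then obtain f where f: "\<And>x p G. x \<in> carrier S \<Longrightarrow> pathin (topol S) p \<Longrightarrow> p 0 = b \<Longrightarrow> p 1 = x \<Longrightarrow>
    primitive_along {0..1} p G \<Longrightarrow> G 1 - G 0 = f x"
    by metis
  have "primitive (carrier S) f"
    unfolding primitive_def
  proof clarify
    fix W \<psi> x assume \<psi>: "(W, \<psi>) \<in> atlas S" "x \<in> W" and xS: "\<psi> x \<in> carrier S"
    obtain U g where U: "openin (topol S) U" "\<psi> x \<in> U" "primitive U g"
      using cf xS curl_free_iff_local_primitive by blast
    have "open (W \<inter> \<psi> -` U)" "x \<in> W \<inter> \<psi> -` U"
      using chart_open_vimage[OF \<psi>(1) U(1)] U(2) \<psi>(2) by auto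
    then obtain r where r: "r > 0" "ball x r \<subseteq> W \<inter> \<psi> -` U"
      using openE by blast
    obtain p where p: "pathin (topol S) p" "p 0 = b" "p 1 = \<psi> x"
      using simply_connected_imp_path[OF sc b xS] .
    have shift: "f (\<psi> y) = g (\<psi> y) + (f (\<psi> x) - g (\<psi> x))" if y: "y \<in> ball x r" for y
    proof -
      define \<sigma> where "\<sigma> t = \<psi> (x + t *\<^sub>R (y - x))" for t :: real
      have seg: "x + t *\<^sub>R (y - x) \<in> ball x r" if "t \<in> {0..1}" for t
      proof -
        have "norm (t *\<^sub>R (y - x)) \<le> 1 * norm (y - x)"
          unfolding norm_scaleR using that by (intro mult_right_mono) auto
        then show ?thesis
          using y by (simp add: dist_norm norm_minus_commute)
      qed
      have "continuous_map (top_of_set {0..1::real}) (top_of_set W) (\<lambda>t. x + t *\<^sub>R (y - x))"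
        using seg r(2) by (auto simp: continuous_map_in_subtopology intro!: continuous_intros)
      from continuous_map_compose[OF this chart_continuous_map[OF \<psi>(1)]]
      have \<sigma>: "pathin (topol S) \<sigma>"
        by (simp add: pathin_def comp_def \<sigma>_def[abs_def])
      have \<sigma>_ends: "\<sigma> 0 = \<psi> x" "\<sigma> 1 = \<psi> y"
        by (simp_all add: \<sigma>_def)
      have \<sigma>U: "\<sigma> t \<in> U" if "t \<in> {0..1}" for t
        using seg[OF that] r(2) by (auto simp: \<sigma>_def)
      have g\<sigma>: "primitive_along {0..1} \<sigma> (\<lambda>t. g (\<sigma> t))"
        by (rule primitive_alongI, rule exI[of _ UNIV], rule exI[of _ U], rule exI[of _ g])
          (use U \<sigma>U in auto)
      have join: "pathin (topol S) (p +++ \<sigma>)"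
        using p \<sigma> \<sigma>_ends(1) by (intro pathin_joinpaths) simp_all
      obtain K where K: "primitive_along {0..1} (p +++ \<sigma>) K"
        using primitive_along_path[OF cf join] .
      have "\<psi> y \<in> carrier S"
        using chart_carrier[OF \<psi>(1)] y r(2) by blast
      then have 1: "K 1 - K 0 = f (\<psi> y)"
        using f[OF _ join _ _ K] p(2) \<sigma>_ends(2) by (simp add: joinpaths_def)
      have "primitive_along {0..1} p (\<lambda>t. K (t / 2))"
        by (rule primitive_along_compose[OF K]) (auto simp: joinpaths_def intro!: continuous_intros)
      then have 2: "K (1 / 2) - K 0 = f (\<psi> x)"
        using f[OF xS p, of "\<lambda>t. K (t / 2)"] by simp
      have "primitive_along {0..1} \<sigma> (\<lambda>t. K ((1 + t) / 2))"
        by (rule primitive_along_compose[OF K])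
          (use p(3) \<sigma>_ends(1) in \<open>auto simp: joinpaths_def field_simps intro!: continuous_intros\<close>)
      from primitive_along_unique[OF \<sigma>[unfolded pathin_def] connected_Icc this g\<sigma>, of 1 0]
      have "K 1 - K (1 / 2) = g (\<psi> y) - g (\<psi> x)"
        by (simp add: \<sigma>_ends)
      with 1 2 show ?thesis
        by simp
    qed
    have "((\<lambda>p. g p + (f (\<psi> x) - g (\<psi> x))) \<circ> \<psi> has_derivative blinfun_apply (chart_form \<psi> x)) (at x)"
      by (rule primitiveD[OF primitive_add_const[OF U(3)] \<psi> U(2)])
    then show "(f \<circ> \<psi> has_derivative blinfun_apply (chart_form \<psi> x)) (at x)"
    proof (rule has_derivative_transform_within_open[OF _ open_ball[of x r]])
      show "((\<lambda>p. g p + (f (\<psi> x) - g (\<psi> x))) \<circ> \<psi>) y = (f \<circ> \<psi>) y" if "y \<in> ball x r" for y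
        unfolding comp_apply by (rule shift[OF that, symmetric])
    qed (use r(1) in simp)
  qed
  then show thesis
    by (rule that)
qed

end

theorem theorem1:
  fixes S :: "('a::euclidean_space, 'm::euclidean_space) mfd"
    and \<Gamma> :: "('a \<times> 'a, 'k::euclidean_space) mfd"
    and v :: "'a \<Rightarrow> 'a"
    and nabla :: "('a \<Rightarrow> 'a) \<Rightarrow> ('a \<Rightarrow> 'a) \<Rightarrow> 'a \<Rightarrow> 'a"
  assumes "immersed_submanifold S (euclidean_mfd :: ('a, 'a) mfd)" and "model S = UNIV"
    and "levi_civita S nabla"
    and "C2_map S (euclidean_mfd :: ('a, 'a) mfd) v" and "tangent_field S v"
    and "\<forall>p\<in>carrier S. norm (v p) = 1"
    and "immersion_into_TSphere S (Phi v)"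
    and "immersed_in_TSphere \<Gamma>" and "model \<Gamma> = UNIV" and "carrier \<Gamma> = Phi v ` carrier S"
  shows "(isotropic \<Gamma> \<longleftrightarrow>
            (\<forall>p\<in>carrier S. \<exists>U f. openin (topol S) U \<and> p \<in> U \<and> gradient_on S U v f))
       \<and> (isotropic \<Gamma> \<longleftrightarrow>
            integrable_distribution S (orth_distribution S v) \<and>
            (\<forall>p\<in>carrier S. nabla v v p = 0))
       \<and> (simply_connected_space (topol S) \<and>
            (\<forall>p\<in>carrier S. \<exists>U f. openin (topol S) U \<and> p \<in> U \<and> gradient_on S U v f) \<longrightarrow>
            (\<exists>f. gradient_on S (carrier S) v f))"
proof -
  interpret unit_field S v
    using assms by unfold_locales auto
  have iso: "isotropic \<Gamma> \<longleftrightarrow> curl_free"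
    using assms by (intro isotropic_iff_curl_free)
  have "(\<exists>U f. openin (topol S) U \<and> p \<in> U \<and> gradient_on S U v f) \<longleftrightarrow>
      (\<exists>U f. openin (topol S) U \<and> p \<in> U \<and> primitive U f)" for p
    using gradient_on_iff_primitive by blast
  then have loc: "(\<forall>p\<in>carrier S. \<exists>U f. openin (topol S) U \<and> p \<in> U \<and> gradient_on S U v f) \<longleftrightarrow> curl_free"
    using curl_free_iff_local_primitive by simp
  have int: "curl_free \<longleftrightarrow> integrable_distribution S (orth_distribution S v) \<and>
      (\<forall>p\<in>carrier S. nabla v v p = 0)"
    using curl_free_imp_integrable curl_free_imp_geodesic[OF assms(3)]
      integrable_geodesic_imp_curl_free[OF assms(3)] by blast
  \<comment> \<open>The carrier is open in its own topology, so a global primitive is a gradient by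
    the same criterion as the local ones.\<close>
  have "\<exists>f. gradient_on S (carrier S) v f" if "simply_connected_space (topol S)" curl_free
    using simply_connected_imp_primitive[OF that(2,1)] gradient_on_iff_primitive[of "carrier S"]
    by (auto simp: carrier_def)
  with iso loc int show ?thesis
    by blast
qed

end
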